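(* Let $J=I_1I_2\cdots I_n$. An irredundant primary decomposition of $J$ is given by $$J=\bigcap_{B} I_B^{\#B},$$ where $B$ varies in the set $\{B\in F(\mathcal V):\ \operatorname{rk}^*_{\mathcal V}(B)=\operatorname{rk}_{\mathcal V}(B)-1\}$. In particular, $$\operatorname{Ass}(S/J)=\{I_B:\ B\in F(\mathcal V)\text{ and }\operatorname{rk}^*_{\mathcal V}(B)=\operatorname{rk}_{\mathcal V}(B)-1\}.$$
   Context: $K$ is an infinite field, $V$ a finite-dimensional $K$-vector space, $S=\mathrm{Sym}_K(V)$ (a polynomial ring), and $\mathcal V=V_1,\dots,V_n$ a subspace arrangement, i.e. a finite collection of non-zero $K$-subspaces of $V$ (inclusions and equalities allowed). $[n]=\{1,\dots,n\}$. $I_i$ is the ideal of $S$ generated by $V_i$, and for $A\subseteq[n]$, $I_A=\sum_{i\in A}I_i$ (a prime ideal generated by linear forms, whose powers are primary). $\operatorname{rk}_{\mathcal V}(A)=\dim_K\sum_{i\in A}V_i$. The Dilworth truncation is $\operatorname{rk}^*_{\mathcal V}(A)=\min\{\sum_{i=1}^p\operatorname{rk}_{\mathcal V}(A_i)-p: A_1,\dots,A_p\text{ is a partition of }A\}$ for $A\ne\emptyset$ (partitions have non-empty blocks), and $\operatorname{rk}^*_{\mathcal V}(\emptyset)=0$. The set of flats is $F(\mathcal V)=\{B\subseteq[n]:\operatorname{rk}_{\mathcal V}(B)<\operatorname{rk}_{\mathcal V}(A)\text{ for all }B\subsetneq A\subseteq[n]\}$. A primary decomposition is irredundant if the components have pairwise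 distinct radicals and no component can be omitted. *)

theory Defs
  imports Complex_Main "HOL-Library.Poly_Mapping" "HOL-Library.Disjoint_Sets" "HOL-Algebra.Ideal_Product" "HOL-Algebra.QuotRing"
begin

subsection \<open>The symmetric algebra of a finite-dimensional vector space\<close>

text \<open>
  The vector space is the whole type \<open>'v\<close>, with scalar multiplication \<open>scale\<close>, and \<open>B\<close> is a basis.
  A monomial is a finitely supported exponent function \<open>'v \<Rightarrow>\<^sub>0 nat\<close>, and the symmetric algebra is
  the polynomial ring over \<open>'k\<close> whose variables are the elements of \<open>B\<close>. A vector is
  sent to the linear form given by its coordinates. The lemmas \<open>sym_algebra_universal_ex\<close> and
  \<open>sym_algebra_universal_unique\<close> below give the universal property, which does not mention \<open>B\<close>.
\<close>

definition sym_algebra :: "'v set \<Rightarrow> (('v \<Rightarrow>\<^sub>0 nat) \<Rightarrow>\<^sub>0 'k::field) ring" where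
  "sym_algebra B =
     \<lparr>carrier = {p. \<forall>m \<in> Poly_Mapping.keys p. Poly_Mapping.keys m \<subseteq> B},
      mult = (*), one = 1, zero = 0, add = (+)\<rparr>"

definition sym_const :: "'k::field \<Rightarrow> (('v \<Rightarrow>\<^sub>0 nat) \<Rightarrow>\<^sub>0 'k)" where
  "sym_const c = Poly_Mapping.single 0 c"

definition sym_emb ::
    "('k::field \<Rightarrow> 'v::ab_group_add \<Rightarrow> 'v) \<Rightarrow> 'v set \<Rightarrow> 'v \<Rightarrow> (('v \<Rightarrow>\<^sub>0 nat) \<Rightarrow>\<^sub>0 'k)" where
  "sym_emb scale B v =
     (\<Sum>b\<in>B. Poly_Mapping.single (Poly_Mapping.single b 1) (module.representation scale B v b))"

lemma sym_algebra_ops: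
  "x \<oplus>\<^bsub>sym_algebra B\<^esub> y = x + y" "x \<otimes>\<^bsub>sym_algebra B\<^esub> y = x * y"
  "\<zero>\<^bsub>sym_algebra B\<^esub> = 0" "\<one>\<^bsub>sym_algebra B\<^esub> = 1"
  by (simp_all add: sym_algebra_def)

lemma cring_sym_algebra: "cring (sym_algebra B :: (('v \<Rightarrow>\<^sub>0 nat) \<Rightarrow>\<^sub>0 'k::field) ring)"
proof -
  let ?R = "sym_algebra B :: (('v \<Rightarrow>\<^sub>0 nat) \<Rightarrow>\<^sub>0 'k::field) ring"
  have add: "p + q \<in> carrier ?R" if "p \<in> carrier ?R" "q \<in> carrier ?R" for p q
    using that Poly_Mapping.keys_add[of p q] unfolding sym_algebra_def by auto
  have mult: "p * q \<in> carrier ?R" if "p \<in> carrier ?R" "q \<in> carrier ?R" for p q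
  proof -
    have "Poly_Mapping.keys m \<subseteq> B" if "m \<in> Poly_Mapping.keys (p * q)" for m
    proof -
      from that keys_mult[of p q] obtain a b where
        "m = a + b" "a \<in> Poly_Mapping.keys p" "b \<in> Poly_Mapping.keys q" by blast
      then show ?thesis
        using \<open>p \<in> _\<close> \<open>q \<in> _\<close> Poly_Mapping.keys_add[of a b] unfolding sym_algebra_def by auto blast
    qed
    then show ?thesis by (simp add: sym_algebra_def)
  qed
  have neg: "- p \<in> carrier ?R" if "p \<in> carrier ?R" for p
    using that unfolding sym_algebra_def by (simp add: in_keys_iff)
  have zo: "0 \<in> carrier ?R" "1 \<in> carrier ?R"
    by (simp_all add: sym_algebra_def)
  have "\<exists>y\<in>carrier ?R. y + x = 0" if "x \<in> carrier ?R" for x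
    using neg[OF that] by (intro bexI[of _ "- x"]) simp_all
  then have "abelian_group ?R"
    by (intro abelian_groupI) (simp_all only: sym_algebra_ops add zo ac_simps add_0_left add_0_right)
  moreover have "comm_monoid ?R"
    by (intro comm_monoidI) (simp_all only: sym_algebra_ops mult zo ac_simps mult_1_left mult_1_right)
  ultimately show ?thesis
    by (rule cringI) (simp only: sym_algebra_ops distrib_right)
qed

lemma sum_monomials:
  "p = (\<Sum>m\<in>Poly_Mapping.keys p. Poly_Mapping.single m (Poly_Mapping.lookup p m))"
proof (rule poly_mapping_eqI)
  fix k
  have "(\<Sum>m\<in>Poly_Mapping.keys p. if m = k then Poly_Mapping.lookup p m else 0) = Poly_Mapping.lookup p k"
    by (simp add: in_keys_iff)
  then show "Poly_Mapping.lookup p k = Poly_Mapping.lookup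
      (\<Sum>m\<in>Poly_Mapping.keys p. Poly_Mapping.single m (Poly_Mapping.lookup p m)) k"
    by (simp only: lookup_sum lookup_single when_def)
qed

lemma sum_const_monomial:
  fixes p :: "('v \<Rightarrow>\<^sub>0 nat) \<Rightarrow>\<^sub>0 'k::field"
  shows "p = (\<Sum>m\<in>Poly_Mapping.keys p.
          sym_const (Poly_Mapping.lookup p m) *
          (\<Prod>b\<in>Poly_Mapping.keys m. Poly_Mapping.single (Poly_Mapping.single b 1) 1 ^ Poly_Mapping.lookup m b))"
proof -
  have pw: "Poly_Mapping.single (Poly_Mapping.single b (1::nat)) (1::'k) ^ k =
      Poly_Mapping.single (Poly_Mapping.single b k) 1" for b :: 'v and k
    by (induction k) (simp_all add: mult_single single_add[symmetric])
  have pr: "(\<Prod>b\<in>A. Poly_Mapping.single (g b) (1::'k)) = Poly_Mapping.single (\<Sum>b\<in>A. g b) 1"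
    if "finite A" for A :: "'v set" and g :: "'v \<Rightarrow> ('v \<Rightarrow>\<^sub>0 nat)"
    using that by (induction A rule: finite_induct) (simp_all add: mult_single)
  have "sym_const (Poly_Mapping.lookup p m) *
      (\<Prod>b\<in>Poly_Mapping.keys m. Poly_Mapping.single (Poly_Mapping.single b 1) 1 ^ Poly_Mapping.lookup m b)
      = Poly_Mapping.single m (Poly_Mapping.lookup p m)" for m
    by (simp only: pw pr finite_keys sym_const_def mult_single sum_monomials[symmetric]
        add_0_left mult_1_right)
  then show ?thesis
    by (simp only: sum_monomials[symmetric])
qed

lemma sym_emb_basis:
  assumes "finite_dimensional_vector_space scale B" and "b \<in> B"
  shows "sym_emb scale B b = Poly_Mapping.single (Poly_Mapping.single b 1) 1"
proof -
  interpret finite_dimensional_vector_space scale B by fact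
  have "representation B b = (\<lambda>c. if c = b then 1 else 0)"
    by (rule representation_basis[OF independent_Basis \<open>b \<in> B\<close>])
  then show ?thesis
    using \<open>b \<in> B\<close> finite_Basis unfolding sym_emb_def
    by (simp add: if_distrib[of "Poly_Mapping.single _"] sum.delta cong: if_cong)
qed

lemma sym_emb_linear:
  assumes "finite_dimensional_vector_space scale B"
  shows "sym_emb scale B v \<in> carrier (sym_algebra B)"
    and "sym_emb scale B (v + w) = sym_emb scale B v + sym_emb scale B w"
    and "sym_emb scale B (scale c v) = sym_const c * sym_emb scale B v"
proof -
  interpret finite_dimensional_vector_space scale B by fact
  have "Poly_Mapping.keys (sym_emb scale B v) \<subseteq> (\<lambda>b. Poly_Mapping.single b 1) ` B"
  proof
    fix m assume "m \<in> Poly_Mapping.keys (sym_emb scale B v)"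
    then have "(\<Sum>b\<in>B. Poly_Mapping.lookup (Poly_Mapping.single (Poly_Mapping.single b (1::nat))
        (representation B v b)) m) \<noteq> 0"
      by (simp add: in_keys_iff sym_emb_def lookup_sum)
    then obtain b where "b \<in> B" "Poly_Mapping.lookup (Poly_Mapping.single (Poly_Mapping.single b (1::nat))
        (representation B v b)) m \<noteq> 0"
      by (meson sum.not_neutral_contains_not_neutral)
    then show "m \<in> (\<lambda>b. Poly_Mapping.single b 1) ` B"
      by (auto simp: lookup_single when_def split: if_splits)
  qed
  then show "sym_emb scale B v \<in> carrier (sym_algebra B)"
    by (fastforce simp: sym_algebra_def)
  show "sym_emb scale B (v + w) = sym_emb scale B v + sym_emb scale B w"
    using representation_add[OF independent_Basis, of w v]
    by (simp add: sym_emb_def span_Basis add.commute[of w v] single_add sum.distrib)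
  show "sym_emb scale B (scale c v) = sym_const c * sym_emb scale B v"
    using representation_scale[OF independent_Basis, of v c]
    by (simp add: sym_emb_def sym_const_def span_Basis mult_single sum_distrib_left)
qed

text \<open>
  A commutative algebra over the field \<open>'k\<close> is a commutative ring \<open>'a\<close> with a ring
  homomorphism \<open>h :: 'k \<Rightarrow> 'a\<close>.
\<close>

lemma sym_algebra_universal_ex:
  fixes scale :: "'k::field \<Rightarrow> 'v::ab_group_add \<Rightarrow> 'v"
    and h :: "'k \<Rightarrow> 'a::comm_ring_1" and f :: "'v \<Rightarrow> 'a"
  assumes fd: "finite_dimensional_vector_space scale B"
    and h: "h 1 = 1" "\<And>a b. h (a + b) = h a + h b" "\<And>a b. h (a * b) = h a * h b"
    and f: "\<And>v w. f (v + w) = f v + f w" "\<And>c v. f (scale c v) = h c * f v"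
  shows "\<exists>F :: (('v \<Rightarrow>\<^sub>0 nat) \<Rightarrow>\<^sub>0 'k) \<Rightarrow> 'a.
      (\<forall>p \<in> carrier (sym_algebra B). \<forall>q \<in> carrier (sym_algebra B).
         F (p + q) = F p + F q \<and> F (p * q) = F p * F q) \<and>
      (\<forall>c. F (sym_const c) = h c) \<and> (\<forall>v. F (sym_emb scale B v) = f v)"
proof -
  interpret finite_dimensional_vector_space scale B by fact
  have h0: "h 0 = 0" using h(2)[of 0 0] by simp
  have f0: "f 0 = 0" using f(1)[of 0 0] by simp
  define M :: "('v \<Rightarrow>\<^sub>0 nat) \<Rightarrow> 'a"
    where "M m = (\<Prod>b\<in>Poly_Mapping.keys m. f b ^ Poly_Mapping.lookup m b)" for m
  define F :: "(('v \<Rightarrow>\<^sub>0 nat) \<Rightarrow>\<^sub>0 'k) \<Rightarrow> 'a"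
    where "F p = (\<Sum>m\<in>Poly_Mapping.keys p. h (Poly_Mapping.lookup p m) * M m)" for p
  have Msup: "M m = (\<Prod>b\<in>A. f b ^ Poly_Mapping.lookup m b)"
    if "finite A" "Poly_Mapping.keys m \<subseteq> A" for A m
    unfolding M_def by (rule prod.mono_neutral_left) (use that in \<open>auto simp: in_keys_iff\<close>)
  have Fsup: "F p = (\<Sum>m\<in>A. h (Poly_Mapping.lookup p m) * M m)"
    if "finite A" "Poly_Mapping.keys p \<subseteq> A" for A p
    unfolding F_def by (rule sum.mono_neutral_left) (use that in \<open>auto simp: in_keys_iff h0\<close>)
  have Madd: "M (m + k) = M m * M k" for m k
  proof -
    let ?A = "Poly_Mapping.keys m \<union> Poly_Mapping.keys k"
    show ?thesis
      using Msup[of ?A m] Msup[of ?A k] Msup[of ?A "m + k"] Poly_Mapping.keys_add[of m k]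
      by (simp add: lookup_add power_add prod.distrib)
  qed
  have Fadd: "F (p + q) = F p + F q" for p q
  proof -
    let ?A = "Poly_Mapping.keys p \<union> Poly_Mapping.keys q"
    show ?thesis
      using Fsup[of ?A p] Fsup[of ?A q] Fsup[of ?A "p + q"] Poly_Mapping.keys_add[of p q]
      by (simp add: lookup_add h(2) algebra_simps sum.distrib)
  qed
  have Fsingle: "F (Poly_Mapping.single m c) = h c * M m" for m c
    using Fsup[of "{m}" "Poly_Mapping.single m c"] by simp
  have F0: "F 0 = 0" by (simp add: F_def)
  have Fsum_basis: "F (\<Sum>i\<in>A. g i) = (\<Sum>i\<in>A. F (g i))" for A :: "'v set" and g
    by (induction A rule: infinite_finite_induct) (simp_all add: F0 Fadd)
  have Fsum_monom: "F (\<Sum>i\<in>A. g i) = (\<Sum>i\<in>A. F (g i))" for A :: "('v \<Rightarrow>\<^sub>0 nat) set" and g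
    by (induction A rule: infinite_finite_induct) (simp_all add: F0 Fadd)
  have Fmult: "F (p * q) = F p * F q" for p q
  proof -
    have "p * q = (\<Sum>m\<in>Poly_Mapping.keys p. \<Sum>k\<in>Poly_Mapping.keys q.
        Poly_Mapping.single (m + k) (Poly_Mapping.lookup p m * Poly_Mapping.lookup q k))"
      using arg_cong2[OF sum_monomials[of p] sum_monomials[of q], of "(*)"]
      by (simp only: sum_product mult_single)
    then have "F (p * q) = (\<Sum>m\<in>Poly_Mapping.keys p. \<Sum>k\<in>Poly_Mapping.keys q.
        (h (Poly_Mapping.lookup p m) * M m) * (h (Poly_Mapping.lookup q k) * M k))"
      by (simp add: Fsum_monom Fsingle Madd h(3) algebra_simps)
    then show ?thesis by (simp add: F_def sum_product)
  qed
  have "F (sym_const c) = h c" for c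
    by (simp add: sym_const_def Fsingle M_def)
  moreover have "F (sym_emb scale B v) = f v" for v
  proof -
    have fsum: "f (\<Sum>i\<in>A. g i) = (\<Sum>i\<in>A. f (g i))" for A :: "'v set" and g
      by (induction A rule: infinite_finite_induct) (simp_all add: f0 f(1))
    have "v = (\<Sum>b\<in>B. scale (representation B v b) b)"
      using sum_representation_eq[OF independent_Basis _ finite_Basis, of v] span_Basis by simp
    then have "f v = f (\<Sum>b\<in>B. scale (representation B v b) b)"
      by (rule arg_cong)
    also have "\<dots> = (\<Sum>b\<in>B. h (representation B v b) * f b)"
      by (simp only: fsum f(2))
    finally have "f v = (\<Sum>b\<in>B. h (representation B v b) * f b)" .
    then show ?thesis
      by (simp add: sym_emb_def Fsum_basis Fsingle M_def)
  qed
  ultimately show ?thesis using Fadd Fmult by blast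
qed

lemma sym_algebra_universal_unique:
  fixes scale :: "'k::field \<Rightarrow> 'v::ab_group_add \<Rightarrow> 'v"
    and F G :: "(('v \<Rightarrow>\<^sub>0 nat) \<Rightarrow>\<^sub>0 'k) \<Rightarrow> 'a::comm_ring_1"
  assumes fd: "finite_dimensional_vector_space scale B"
    and F: "\<And>p q. \<lbrakk>p \<in> carrier (sym_algebra B); q \<in> carrier (sym_algebra B)\<rbrakk> \<Longrightarrow>
              F (p + q) = F p + F q \<and> F (p * q) = F p * F q"
    and G: "\<And>p q. \<lbrakk>p \<in> carrier (sym_algebra B); q \<in> carrier (sym_algebra B)\<rbrakk> \<Longrightarrow>
              G (p + q) = G p + G q \<and> G (p * q) = G p * G q"
    and const: "\<And>c. F (sym_const c) = G (sym_const c)"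
    and emb: "\<And>v. F (sym_emb scale B v) = G (sym_emb scale B v)"
    and p: "p \<in> carrier (sym_algebra B)"
  shows "F p = G p"
proof -
  define E where "E = {q \<in> carrier (sym_algebra B). F q = G q}"
  interpret cring "sym_algebra B :: (('v \<Rightarrow>\<^sub>0 nat) \<Rightarrow>\<^sub>0 'k) ring" by (rule cring_sym_algebra)
  have add: "q + r \<in> E" and mult: "q * r \<in> E" if "q \<in> E" "r \<in> E" for q r
    using that F[of q r] G[of q r] add.m_closed[of q r] m_closed[of q r]
    by (simp_all add: E_def sym_algebra_ops)
  have cE: "sym_const c \<in> E" for c
    using const[of c] by (auto simp: E_def sym_algebra_def sym_const_def split: if_splits)
  have "0 \<in> E" "1 \<in> E"
    using cE[of 0] cE[of 1] by (simp_all add: sym_const_def)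
  have vE: "Poly_Mapping.single (Poly_Mapping.single b 1) 1 \<in> E" if "b \<in> B" for b
    using emb[of b] sym_emb_basis[OF fd that] sym_emb_linear(1)[OF fd, of b] by (simp add: E_def)
  have powE: "q ^ k \<in> E" if "q \<in> E" for q k
    by (induction k) (use that \<open>1 \<in> E\<close> mult in auto)
  have prodE: "(\<Prod>i\<in>A. g i) \<in> E" if "\<And>i. i \<in> A \<Longrightarrow> g i \<in> E" for A :: "'v set" and g
    using that by (induction A rule: infinite_finite_induct) (use \<open>1 \<in> E\<close> mult in auto)
  have sumE: "(\<Sum>i\<in>A. g i) \<in> E" if "\<And>i. i \<in> A \<Longrightarrow> g i \<in> E" for A :: "('v \<Rightarrow>\<^sub>0 nat) set" and g
    using that by (induction A rule: infinite_finite_induct) (use \<open>0 \<in> E\<close> add in auto)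
  have "p \<in> E"
    by (subst sum_const_monomial[of p], intro sumE mult prodE powE cE vE)
      (use p in \<open>auto simp: sym_algebra_def\<close>)
  then show ?thesis by (simp add: E_def)
qed


subsection \<open>Primary decompositions and associated primes\<close>

definition radical_ideal :: "('a, 'b) ring_scheme \<Rightarrow> 'a set \<Rightarrow> 'a set" where
  "radical_ideal R Q = {a \<in> carrier R. \<exists>k::nat. a [^]\<^bsub>R\<^esub> k \<in> Q}"

definition primary_ideal :: "('a, 'b) ring_scheme \<Rightarrow> 'a set \<Rightarrow> bool" where
  "primary_ideal R Q \<longleftrightarrow>
     ideal Q R \<and> Q \<noteq> carrier R \<and>
     (\<forall>a \<in> carrier R. \<forall>b \<in> carrier R. a \<otimes>\<^bsub>R\<^esub> b \<in> Q \<longrightarrow> a \<in> Q \<or> b \<in> radical_ideal R Q)"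

text \<open>
  The components form a family \<open>Q\<close> indexed by \<open>T\<close>. Intersecting with the carrier makes the empty
  intersection the unit ideal.
\<close>

definition irredundant_primary_decomposition ::
    "('a, 'b) ring_scheme \<Rightarrow> 'a set \<Rightarrow> 'i set \<Rightarrow> ('i \<Rightarrow> 'a set) \<Rightarrow> bool" where
  "irredundant_primary_decomposition R J T Q \<longleftrightarrow>
     finite T \<and>
     (\<forall>i \<in> T. primary_ideal R (Q i)) \<and>
     J = carrier R \<inter> (\<Inter>i\<in>T. Q i) \<and>
     inj_on (\<lambda>i. radical_ideal R (Q i)) T \<and>
     (\<forall>j \<in> T. J \<noteq> carrier R \<inter> (\<Inter>i\<in>T - {j}. Q i))"

text \<open>
  The associated primes of the \<open>R\<close>-module \<open>R/J\<close>: the prime ideals that are annihilators of an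
  element of \<open>R/J\<close>. An element \<open>a\<close> of \<open>R\<close> acts on \<open>R/J\<close> as multiplication by the coset
  \<open>J +> a\<close>.
\<close>

definition ass_quotient :: "('a, 'b) ring_scheme \<Rightarrow> 'a set \<Rightarrow> 'a set set" where
  "ass_quotient R J =
     {P. primeideal P R \<and>
         (\<exists>x \<in> carrier (R Quot J).
            P = {a \<in> carrier R. (J +>\<^bsub>R\<^esub> a) \<otimes>\<^bsub>R Quot J\<^esub> x = \<zero>\<^bsub>R Quot J\<^esub>})}"


subsection \<open>Subspace arrangements\<close>

definition subspace_arrangement ::
    "('k::field \<Rightarrow> 'v::ab_group_add \<Rightarrow> 'v) \<Rightarrow> nat \<Rightarrow> (nat \<Rightarrow> 'v set) \<Rightarrow> bool" where
  "subspace_arrangement scale n V \<longleftrightarrow> (\<forall>i \<in> {1..n}. module.subspace scale (V i) \<and> V i \<noteq> {0})"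

text \<open>The rank functions are integer-valued because \<open>rk(B) - 1\<close> is \<open>-1\<close> for empty \<open>B\<close>.\<close>

definition arr_rk ::
    "('k::field \<Rightarrow> 'v::ab_group_add \<Rightarrow> 'v) \<Rightarrow> (nat \<Rightarrow> 'v set) \<Rightarrow> nat set \<Rightarrow> int" where
  "arr_rk scale V A = int (vector_space.dim scale (module.span scale (\<Union>i\<in>A. V i)))"

definition dilworth_rk ::
    "('k::field \<Rightarrow> 'v::ab_group_add \<Rightarrow> 'v) \<Rightarrow> (nat \<Rightarrow> 'v set) \<Rightarrow> nat set \<Rightarrow> int" where
  "dilworth_rk scale V A =
     (if A = {} then 0
      else Min {(\<Sum>C\<in>P. arr_rk scale V C) - int (card P) | P. partition_on A P})"

definition arr_flats ::
    "('k::field \<Rightarrow> 'v::ab_group_add \<Rightarrow> 'v) \<Rightarrow> nat \<Rightarrow> (nat \<Rightarrow> 'v set) \<Rightarrow> nat set set" where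
  "arr_flats scale n V =
     {B. B \<subseteq> {1..n} \<and> (\<forall>A. B \<subset> A \<and> A \<subseteq> {1..n} \<longrightarrow> arr_rk scale V B < arr_rk scale V A)}"

definition arr_ideal ::
    "('k::field \<Rightarrow> 'v::ab_group_add \<Rightarrow> 'v) \<Rightarrow> 'v set \<Rightarrow> (nat \<Rightarrow> 'v set) \<Rightarrow> nat \<Rightarrow>
     (('v \<Rightarrow>\<^sub>0 nat) \<Rightarrow>\<^sub>0 'k) set" where
  "arr_ideal scale Basis V i = Idl\<^bsub>sym_algebra Basis\<^esub> (sym_emb scale Basis ` V i)"

text \<open>
  Sums, products and powers of ideals are taken in the semiring \<^const>\<open>ideals_set\<close> of all ideals.
\<close>

definition arr_ideal_sum ::
    "('k::field \<Rightarrow> 'v::ab_group_add \<Rightarrow> 'v) \<Rightarrow> 'v set \<Rightarrow> (nat \<Rightarrow> 'v set) \<Rightarrow> nat set \<Rightarrow>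
     (('v \<Rightarrow>\<^sub>0 nat) \<Rightarrow>\<^sub>0 'k) set" where
  "arr_ideal_sum scale Basis V A =
     (\<Oplus>\<^bsub>ideals_set (sym_algebra Basis)\<^esub> i\<in>A. arr_ideal scale Basis V i)"

definition arr_ideal_prod ::
    "('k::field \<Rightarrow> 'v::ab_group_add \<Rightarrow> 'v) \<Rightarrow> 'v set \<Rightarrow> nat \<Rightarrow> (nat \<Rightarrow> 'v set) \<Rightarrow>
     (('v \<Rightarrow>\<^sub>0 nat) \<Rightarrow>\<^sub>0 'k) set" where
  "arr_ideal_prod scale Basis n V =
     (\<Otimes>\<^bsub>ideals_set (sym_algebra Basis)\<^esub> i\<in>{1..n}. arr_ideal scale Basis V i)"

end

theory Submission
  imports Defs "Jordan_Normal_Form.Determinant"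
begin

text \<open>
  Write \<open>V\<^sub>A\<close> for the sum of the \<open>V\<^sub>i\<close> with \<open>i \<in> A\<close>, so that \<open>I\<^sub>A\<close> is generated by \<open>V\<^sub>A\<close>, and let \<open>J\<close> be
  the product of all the \<open>I\<^sub>i\<close>. The proof has three parts.

  \<^emph>\<open>The product is the intersection of all the powers \<open>I\<^sub>A\<^sup>#\<^sup>A\<close>\<close>
  (\<open>in_lin_prod_if_in_lin_pows\<close>, a theorem of Conca and Herzog). Pick a generic \<open>l \<in> V\<^sub>1\<close>: whenever \<open>l\<close>
  lies in some \<open>V\<^sub>A\<close>, so does all of \<open>V\<^sub>1\<close>. Projecting along \<open>l\<close> lowers a dimension, so by induction an element
  of the intersection is \<open>g + l h\<close> with \<open>g \<in> J\<close>, and \<open>l h\<close> is again in the intersection. For \<open>A\<close> without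
  the index 1 either \<open>l\<close> is outside the prime \<open>I\<^sub>A\<close> and can be cancelled, or \<open>I\<^sub>A\<close> already contains \<open>V\<^sub>1\<close>,
  and then \<open>l h\<close> lies in \<open>I\<^sub>A\<close> to the power \<open>#A + 1\<close>, whence \<open>h\<close> lies in the power \<open>#A\<close>. So by induction \<open>h\<close>
  is in the product of the other ideals. The cancellations use only that the order of vanishing
  along \<open>I\<^sub>A\<close> is a valuation (\<open>lin_pow_valuation\<close>); this also makes the powers primary. The valuation is
  computed by substitution: splitting every vector into its component in \<open>W\<close>, multiplied by a variable
  \<open>s\<close>, and the rest, the power \<open>(W)\<^sup>k\<close> consists of the elements which every substitution of scalars makes
  divisible by \<open>s\<^sup>k\<close> (\<open>lin_pow_iff_graded_subst\<close>).

  \<^emph>\<open>Components with small Dilworth rank are superfluous\<close> (\<open>in_lin_pow_if_saturated\<close>). Let some partition of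
  \<open>B\<close> have \<open>\<Sum>(rk - 1) < rk B - 1\<close>. Then for a hyperplane \<open>H\<close> containing no \<open>V\<^sub>i\<close>, the sections
  \<open>V\<^sub>i \<inter> H\<close> do not span \<open>V\<^sub>B \<inter> H\<close>. So there is a plane of functionals, containing the equation of \<open>H\<close>, on which
  every \<open>V\<^sub>i\<close> restricts to a line. Restricted to this plane, the product of the \<open>I\<^sub>i\<close> becomes principal,
  generated by a product of \<open>#B\<close> linear forms, and principal ideals have no embedded primes. So an
  element that all the smaller flats allow satisfies the condition at \<open>B\<close> too.

  \<^emph>\<open>The other components are needed\<close> (\<open>essential_witness\<close>). If no partition is that small, then by a theorem
  of Lovasz some hyperplane \<open>H\<close> has sections \<open>V\<^sub>i \<inter> H\<close> spanning \<open>V\<^sub>B \<inter> H\<close>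
  (\<open>spanning_hyperplane_section_exists\<close>). With \<open>u\<^sub>i \<in> V\<^sub>i\<close> outside \<open>H\<close>, writing the differences
  \<open>u\<^sub>i - u\<^sub>j\<close> through the sections gives a matrix with one row fewer than columns, zero row sums and \<open>i\<close>-th
  column in \<open>V\<^sub>i\<close>. Up to sign all its maximal minors are one and the same polynomial \<open>f\<close> of degree \<open>#B - 1\<close>,
  which therefore lies in the product of the \<open>I\<^sub>j\<close>, \<open>j \<in> B\<close>, with any one factor left out, but not in
  \<open>I\<^sub>B\<^sup>#\<^sup>B\<close>. Multiplied by suitable linear forms outside \<open>I\<^sub>B\<close>, it has annihilator \<open>I\<^sub>B\<close> modulo \<open>J\<close>.
\<close>

section \<open>Linear algebra over an infinite field\<close>

context finite_dimensional_vector_space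
begin

abbreviation functional :: "('b \<Rightarrow> 'a) \<Rightarrow> bool"
  where "functional \<phi> \<equiv> Vector_Spaces.linear scale (*) \<phi>"

abbreviation endo :: "('b \<Rightarrow> 'b) \<Rightarrow> bool"
  where "endo \<pi> \<equiv> Vector_Spaces.linear scale scale \<pi>"

definition join :: "(nat \<Rightarrow> 'b set) \<Rightarrow> nat set \<Rightarrow> 'b set"
  where "join V A = span (\<Union>i\<in>A. V i)"

lemma vector_space_field: "vector_space ((*) :: 'a \<Rightarrow> 'a \<Rightarrow> 'a)"
  by unfold_locales (simp_all add: algebra_simps)

lemma functional_iff:
  "functional \<phi> \<longleftrightarrow> (\<forall>v w. \<phi> (v + w) = \<phi> v + \<phi> w) \<and> (\<forall>c v. \<phi> (scale c v) = c * \<phi> v)"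
  using vector_space_field vector_space_axioms unfolding Vector_Spaces.linear_iff by blast

lemma endo_iff:
  "endo \<pi> \<longleftrightarrow> (\<forall>v w. \<pi> (v + w) = \<pi> v + \<pi> w) \<and> (\<forall>c v. \<pi> (scale c v) = scale c (\<pi> v))"
  using vector_space_axioms unfolding Vector_Spaces.linear_iff by blast

lemma functional_0: "functional \<phi> \<Longrightarrow> \<phi> 0 = 0"
  and functional_diff: "functional \<phi> \<Longrightarrow> \<phi> (v - w) = \<phi> v - \<phi> w"
  using module_hom.zero module_hom.diff by (metis linear_iff_module_hom)+

lemma endo_0: "endo \<pi> \<Longrightarrow> \<pi> 0 = 0"
  and endo_diff: "endo \<pi> \<Longrightarrow> \<pi> (v - w) = \<pi> v - \<pi> w"
  using module_hom.zero module_hom.diff by (metis linear_iff_module_hom)+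

lemma functional_compose: "functional \<phi> \<Longrightarrow> endo \<pi> \<Longrightarrow> functional (\<lambda>v. \<phi> (\<pi> v))"
  by (simp add: functional_iff endo_iff)

lemma subspace_kernel_functional: "functional \<phi> \<Longrightarrow> subspace {v. \<phi> v = 0}"
  by (rule subspaceI) (auto simp: functional_iff functional_0)

lemma subspace_image_endo: "endo \<pi> \<Longrightarrow> subspace W \<Longrightarrow> subspace (\<pi> ` W)"
  using module_hom.subspace_image linear_iff_module_hom by metis

lemma functional_exists:
  assumes "subspace W" "v \<notin> W"
  shows "\<exists>\<phi>. functional \<phi> \<and> \<phi> v = 1 \<and> (\<forall>w\<in>W. \<phi> w = 0)"
proof -
  interpret K: vector_space "(*) :: 'a \<Rightarrow> 'a \<Rightarrow> 'a" by (rule vector_space_field)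
  interpret P: vector_space_pair scale "(*) :: 'a \<Rightarrow> 'a \<Rightarrow> 'a" by unfold_locales
  obtain B where B: "B \<subseteq> W" "independent B" "W \<subseteq> span B"
    using basis_exists by metis
  have "v \<notin> span B" using B assms span_minimal by blast
  then have "independent (insert v B)" using B(2) independent_insertI by blast
  then obtain \<phi> where \<phi>: "functional \<phi>" "\<forall>x\<in>insert v B. \<phi> x = (if x = v then 1 else 0)"
    using P.linear_independent_extend[of "insert v B" "\<lambda>x. if x = v then 1 else 0"] by blast
  have "v \<notin> B" using \<open>v \<notin> span B\<close> span_base by blast
  then have "\<forall>x\<in>B. \<phi> x = 0" using \<phi>(2) by auto
  then have "B \<subseteq> {x. \<phi> x = 0}" by auto
  then have "span B \<subseteq> {x. \<phi> x = 0}"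
    using span_minimal subspace_kernel_functional[OF \<phi>(1)] by blast
  then show ?thesis using \<phi> B by auto
qed

lemma projection_exists:
  assumes "subspace W"
  shows "\<exists>\<pi>. endo \<pi> \<and> (\<forall>v. \<pi> v \<in> W) \<and> (\<forall>w\<in>W. \<pi> w = w)"
proof -
  interpret P: vector_space_pair scale scale by unfold_locales
  obtain B where B: "B \<subseteq> W" "independent B" "W \<subseteq> span B"
    using basis_exists by metis
  obtain \<pi> where \<pi>: "endo \<pi>" "\<forall>x\<in>B. \<pi> x = x" "range \<pi> = span ((\<lambda>x. x) ` B)"
    using P.linear_independent_extend_subspace[OF B(2), of "\<lambda>x. x"] by blast
  have W: "span B = W" using B assms span_subspace by blast
  have "subspace {x. \<pi> x = x}"
    using \<pi>(1) by (intro subspaceI) (auto simp: endo_iff endo_0)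
  then have "W \<subseteq> {x. \<pi> x = x}"
    using span_minimal[of B "{x. \<pi> x = x}"] \<pi>(2) W by auto
  then show ?thesis using \<pi> W by auto
qed

text \<open>
  Projecting along a line models the quotient by that line inside the same space. The last clause
  makes the dimension of every subspace containing the line drop.
\<close>

lemma line_projection_exists:
  assumes "l \<noteq> 0"
  shows "\<exists>\<pi>. endo \<pi> \<and> \<pi> l = 0 \<and> (\<forall>v. \<exists>c. v - \<pi> v = scale c l) \<and> (\<forall>W. subspace W \<longrightarrow> l \<in> W \<longrightarrow> l \<notin> \<pi> ` W)"
proof -
  obtain \<phi> where \<phi>: "functional \<phi>" "\<phi> l = 1"
    using functional_exists[OF subspace_single_0, of l] assms by auto
  define \<pi> where "\<pi> v = v - scale (\<phi> v) l" for v
  have "endo \<pi>"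
    using \<phi>(1) by (simp add: endo_iff functional_iff \<pi>_def scale_left_distrib scale_right_diff_distrib)
  moreover have "\<phi> (\<pi> v) = 0" for v
    using \<phi> by (simp add: \<pi>_def functional_diff) (simp add: functional_iff)
  then have "l \<noteq> \<pi> v" for v using \<phi>(2) by (metis zero_neq_one)
  ultimately show ?thesis
    using \<phi>(2) by (intro exI[of _ \<pi>]) (auto simp: \<pi>_def)
qed

lemma subspace_avoids_finite_union:
  assumes "infinite (UNIV :: 'a set)" "finite F" "subspace U"
    and "\<And>X. X \<in> F \<Longrightarrow> subspace X" "\<And>X. X \<in> F \<Longrightarrow> \<not> U \<subseteq> X"
  shows "\<exists>u\<in>U. \<forall>X\<in>F. u \<notin> X"
  using assms(2,4,5)
proof (induction F rule: finite_induct)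
  case empty
  then show ?case using subspace_0[OF assms(3)] by blast
next
  case (insert X F)
  then obtain u where u: "u \<in> U" "\<forall>Y\<in>F. u \<notin> Y" by blast
  obtain v where v: "v \<in> U" "v \<notin> X" using insert.prems by blast
  show ?case
  proof (cases "u \<in> X")
    case False
    then show ?thesis using u by blast
  next
    case True
    \<comment> \<open>Here \<open>u\<close> avoids all of \<open>F\<close> and lies in \<open>X\<close>. The points \<open>v + c u\<close> all avoid \<open>X\<close>, and each member of \<open>F\<close>
      contains at most one of them.\<close>
    have one: "\<exists>\<^sub>\<le>\<^sub>1 c. v + scale c u \<in> Y" if "Y \<in> F" for Y
    proof (rule Uniq_I)
      fix c d assume c: "v + scale c u \<in> Y" "v + scale d u \<in> Y"
      have Y: "subspace Y" using insert.prems that by blast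
      have "scale (c - d) u \<in> Y"
        using subspace_diff[OF Y c] by (simp add: scale_left_diff_distrib)
      then have "c - d = 0"
        using u(2) that subspace_scale[OF Y, of "scale (c - d) u" "inverse (c - d)"] by force
      then show "c = d" by simp
    qed
    have "finite (\<Union>Y\<in>F. {c. v + scale c u \<in> Y})"
    proof (intro finite_UN_I insert.hyps)
      fix Y assume "Y \<in> F"
      then have "{c. v + scale c u \<in> Y} = {} \<or> (\<exists>c. {c. v + scale c u \<in> Y} = {c})"
        using one[of Y] unfolding Uniq_def by blast
      then show "finite {c. v + scale c u \<in> Y}" by (metis finite.emptyI finite.insertI)
    qed
    then obtain c where c: "c \<notin> (\<Union>Y\<in>F. {c. v + scale c u \<in> Y})"
      using assms(1) ex_new_if_finite by blast
    have X: "subspace X" using insert.prems by blast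
    have "v + scale c u \<notin> X"
    proof
      assume "v + scale c u \<in> X"
      from subspace_diff[OF X this subspace_scale[OF X True, of c]] show False using v by simp
    qed
    moreover have "v + scale c u \<in> U"
      using u v subspace_add subspace_scale assms(3) by blast
    ultimately show ?thesis using c by blast
  qed
qed

lemma subspace_join [simp]: "subspace (join V A)"
  by (simp add: join_def)

lemma join_upper: "i \<in> A \<Longrightarrow> V i \<subseteq> join V A"
  unfolding join_def using span_superset by blast

lemma join_least: "subspace W \<Longrightarrow> (\<And>i. i \<in> A \<Longrightarrow> V i \<subseteq> W) \<Longrightarrow> join V A \<subseteq> W"
  unfolding join_def by (intro span_minimal) auto

lemma join_mono: "A \<subseteq> B \<Longrightarrow> join V A \<subseteq> join V B"
  unfolding join_def by (intro span_mono UN_mono) auto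

lemma join_singleton: "subspace (V i) \<Longrightarrow> join V {i} = V i"
  by (simp add: join_def)

lemma join_Un: "join V (A \<union> B) = {x + y | x y. x \<in> join V A \<and> y \<in> join V B}"
  by (simp add: join_def UN_Un span_Un)

lemma join_image:
  assumes "endo \<pi>"
  shows "join (\<lambda>i. \<pi> ` V i) A = \<pi> ` join V A"
  using module_hom.span_image[of scale scale \<pi> "\<Union>i\<in>A. V i"] assms
  by (simp add: join_def image_UN linear_iff_module_hom)

lemma in_joinE:
  assumes "finite A" "\<And>i. i \<in> A \<Longrightarrow> subspace (V i)" "x \<in> join V A"
  shows "\<exists>y. (\<forall>i\<in>A. y i \<in> V i) \<and> x = (\<Sum>i\<in>A. y i)"
  using assms
proof (induction A arbitrary: x rule: finite_induct)
  case empty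
  then show ?case by (simp add: join_def)
next
  case (insert i A)
  from insert.prems(2) join_Un[of V "{i}" A] obtain a b
    where ab: "x = a + b" "a \<in> join V {i}" "b \<in> join V A" by auto
  obtain y where y: "\<forall>j\<in>A. y j \<in> V j" "b = (\<Sum>j\<in>A. y j)"
    using insert.IH[OF _ ab(3)] insert.prems(1) by blast
  have "a \<in> V i" using ab(2) join_singleton insert.prems(1) by blast
  have "(\<Sum>j\<in>A. (y(i := a)) j) = (\<Sum>j\<in>A. y j)"
    using insert.hyps(2) by (intro sum.cong) auto
  then show ?case
    using y ab(1) \<open>a \<in> V i\<close> insert.hyps by (intro exI[of _ "y(i := a)"]) simp
qed

text \<open>
  The submodularity of the rank in the form needed to merge blocks of a partition that all
  contain one subspace.
\<close>

lemma dim_join_Un_le: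
  assumes "U \<subseteq> join V A" "U \<subseteq> join V B"
  shows "dim (join V (A \<union> B)) + dim U \<le> dim (join V A) + dim (join V B)"
proof -
  have "dim U \<le> dim (join V A \<inter> join V B)" using assms by (intro dim_subset) blast
  then show ?thesis
    using dim_sums_Int[OF subspace_join[of V A] subspace_join[of V B]] join_Un[of V A B] by simp
qed

lemma dim_image_line_projection:
  assumes "endo \<pi>" "\<And>v. \<exists>c. v - \<pi> v = scale c l" "subspace W"
  shows "dim W \<le> dim (\<pi> ` W) + 1"
    and "l \<notin> W \<Longrightarrow> dim (\<pi> ` W) = dim W"
proof -
  have "W \<subseteq> span (insert l (\<pi> ` W))"
  proof
    fix w assume "w \<in> W"
    obtain c where "w - \<pi> w = scale c l" using assms(2) by blast
    then have "w = \<pi> w + scale c l" by (metis add.commute diff_add_cancel)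
    then show "w \<in> span (insert l (\<pi> ` W))"
      using \<open>w \<in> W\<close> by (metis imageI insertCI span_add span_base span_scale)
  qed
  then have "dim W \<le> dim (insert l (\<pi> ` W))" by (rule dim_mono)
  then show "dim W \<le> dim (\<pi> ` W) + 1" by (simp add: dim_insert split: if_splits)
  assume "l \<notin> W"
  interpret P: finite_dimensional_vector_space_pair_1 scale Basis scale by unfold_locales
  have "inj_on \<pi> W"
  proof (rule inj_onI)
    fix v w assume vw: "v \<in> W" "w \<in> W" "\<pi> v = \<pi> w"
    obtain c where c: "(v - w) - \<pi> (v - w) = scale c l" using assms(2) by blast
    then have c: "v - w = scale c l" using vw(3) by (simp add: endo_diff[OF assms(1)])
    have "scale c l \<in> W" using vw c subspace_diff[OF assms(3)] by metis
    have "c = 0"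
    proof (rule ccontr)
      assume "c \<noteq> 0"
      then show False
        using \<open>l \<notin> W\<close> subspace_scale[OF assms(3) \<open>scale c l \<in> W\<close>, of "inverse c"] by simp
    qed
    then show "v = w" using c by simp
  qed
  moreover have "span W = W" using assms(3) by simp
  ultimately show "dim (\<pi> ` W) = dim W"
    using P.dim_image_eq[OF assms(1), of W] by (simp only:)
qed

lemma dim_image_line_projection_less:
  assumes "endo \<pi>" "\<And>v. \<exists>c. v - \<pi> v = scale c l" "subspace W" "l \<in> W" "l \<notin> \<pi> ` W"
  shows "dim (\<pi> ` W) < dim W"
proof -
  have "\<pi> v \<in> W" if "v \<in> W" for v
  proof -
    obtain c where "v - \<pi> v = scale c l" using assms(2) by blast
    then have "\<pi> v = v - scale c l" by (metis add_diff_cancel_left' diff_add_cancel)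
    then show ?thesis using that assms(3,4) subspace_diff subspace_scale by metis
  qed
  then have "\<pi> ` W \<subset> W" using assms(4,5) by blast
  then show ?thesis
    using dim_psubset[of "\<pi> ` W" W]
    by (simp only: span_eq_iff[THEN iffD2] assms(3) subspace_image_endo[OF assms(1,3)])
qed

section \<open>Generic hyperplane sections and the Dilworth truncation\<close>

lemma arr_rk_join: "arr_rk scale V A = int (dim (join V A))"
  by (simp add: arr_rk_def join_def)

lemma dim_line:
  assumes "subspace U" "U \<noteq> {0}" "dim U \<le> 1" "l \<in> U" "l \<noteq> 0"
  shows "U = span {l}"
  using subspace_dim_equal[of "span {l}" U] assms span_minimal[of "{l}" U] by auto

lemma rk_Union_le:
  assumes "finite Q" "Q \<noteq> {}" "\<And>C. C \<in> Q \<Longrightarrow> U \<subseteq> join V C"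
  shows "arr_rk scale V (\<Union>Q) + (int (card Q) - 1) * int (dim U) \<le> (\<Sum>C\<in>Q. arr_rk scale V C)"
    and "U \<subseteq> join V (\<Union>Q)"
  using assms
proof (induction Q rule: finite_ne_induct)
  case (singleton C)
  { case 1 then show ?case by simp next case 2 then show ?case by simp }
next
  case (insert C Q)
  { case 1
    have "U \<subseteq> join V C" "U \<subseteq> join V (\<Union>Q)" using insert.IH(2) 1 by auto
    from dim_join_Un_le[OF this]
    have "arr_rk scale V (C \<union> \<Union>Q) + int (dim U) \<le> arr_rk scale V C + arr_rk scale V (\<Union>Q)"
      by (simp add: arr_rk_join)
    moreover have "arr_rk scale V (\<Union>Q) + (int (card Q) - 1) * int (dim U) \<le> (\<Sum>C\<in>Q. arr_rk scale V C)"
      using insert.IH(1) 1 by blast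
    ultimately show ?case using insert.hyps by (simp add: algebra_simps) }
  { case 2
    have "join V C \<subseteq> join V (\<Union>(insert C Q))" by (intro join_mono) auto
    then show ?case using 2 by blast }
qed

text \<open>
  Lovasz' theorem in its extremal case. The induction contracts a generic vector \<open>l\<close> of some \<open>V\<^sub>k\<close> of
  dimension at least two. This lowers the rank of a block exactly if the block already spans \<open>V\<^sub>k\<close>, so the
  rank condition could only fail if several blocks of a partition span \<open>V\<^sub>k\<close>; but merging those
  blocks loses at least \<open>dim V\<^sub>k\<close> in rank for each block that disappears, so the original condition
  for the merged partition leaves enough room. A hyperplane for the contracted spaces pulls back to
  one containing \<open>l\<close>. If all \<open>V\<^sub>i\<close> are lines, the partition into singletons shows that they coincide.
\<close>

lemma spanning_hyperplane_section_exists: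
  assumes inf: "infinite (UNIV :: 'a set)" and N: "finite N" "N \<noteq> {}"
    and V: "\<And>i. i \<in> N \<Longrightarrow> subspace (V i)" "\<And>i. i \<in> N \<Longrightarrow> V i \<noteq> {0}"
    and rk: "\<And>P. partition_on N P \<Longrightarrow> arr_rk scale V N - 1 \<le> (\<Sum>C\<in>P. arr_rk scale V C - 1)"
  shows "\<exists>\<phi>. functional \<phi> \<and> (\<forall>i\<in>N. \<exists>u\<in>V i. \<phi> u \<noteq> 0) \<and>
           join V N \<inter> {v. \<phi> v = 0} \<subseteq> join (\<lambda>i. V i \<inter> {v. \<phi> v = 0}) N"
  using V rk
proof (induction "\<Sum>i\<in>N. dim (V i)" arbitrary: V rule: less_induct)
  case less
  note sub = less.prems(1) and nz = less.prems(2) and rk = less.prems(3)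
  show ?case
  proof (cases "\<exists>i\<in>N. 2 \<le> dim (V i)")
    case False
    have part: "partition_on N ((\<lambda>i. {i}) ` N)"
      by (auto simp: partition_on_def disjoint_def)
    have "(\<Sum>C\<in>(\<lambda>i. {i}) ` N. arr_rk scale V C - 1) = (\<Sum>i\<in>N. int (dim (V i)) - 1)"
      by (subst sum.reindex) (auto simp: arr_rk_join join_singleton sub intro!: sum.cong)
    also have "\<dots> \<le> 0" using False by (intro sum_nonpos) force
    finally have "dim (join V N) \<le> 1" using rk[OF part] by (simp add: arr_rk_join)
    obtain i where i: "i \<in> N" using N by blast
    obtain l where l: "l \<in> V i" "l \<noteq> 0" using subspace_0[OF sub[OF i]] nz[OF i] by blast
    have "l \<in> join V N" using l i join_upper by blast
    then have J: "join V N = span {l}"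
      using dim_line[of "join V N" l] \<open>dim (join V N) \<le> 1\<close> l by auto
    obtain \<phi> where \<phi>: "functional \<phi>" "\<phi> l = 1"
      using functional_exists[OF subspace_single_0, of l] l by auto
    have ker: "v = 0" if "v \<in> join V N" "\<phi> v = 0" for v
      using that \<phi> by (auto simp: J span_singleton functional_iff)
    have "\<exists>u\<in>V j. \<phi> u \<noteq> 0" if j: "j \<in> N" for j
    proof -
      obtain u where "u \<in> V j" "u \<noteq> 0" using subspace_0[OF sub[OF j]] nz[OF j] by blast
      then show ?thesis using ker[of u] join_upper[OF j, of V] by blast
    qed
    moreover have "join V N \<inter> {v. \<phi> v = 0} \<subseteq> join (\<lambda>i. V i \<inter> {v. \<phi> v = 0}) N"
      using ker subspace_0[OF subspace_join] by auto
    ultimately show ?thesis using \<phi>(1) by blast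
  next
    case True
    then obtain k where k: "k \<in> N" "2 \<le> dim (V k)" by blast
    \<comment> \<open>Genericity of \<open>l\<close>: it lies in a join only if all of \<open>V k\<close> does.\<close>
    define F where "F = {join V A | A. A \<subseteq> N \<and> \<not> V k \<subseteq> join V A}"
    have "F \<subseteq> join V ` Pow N" by (auto simp: F_def)
    then have "finite F" using N(1) finite_subset by blast
    have "\<exists>l\<in>V k. \<forall>X\<in>F. l \<notin> X"
      by (rule subspace_avoids_finite_union[OF inf \<open>finite F\<close> sub[OF k(1)]]) (auto simp: F_def)
    then obtain l where l: "l \<in> V k" "\<forall>X\<in>F. l \<notin> X" by blast
    have lA: "V k \<subseteq> join V A" if "A \<subseteq> N" "l \<in> join V A" for A
      using that l(2) unfolding F_def by blast
    have "join V {} = {0}" by (simp add: join_def)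
    then have "l \<noteq> 0" using lA[of "{}"] nz[OF k(1)] subspace_0[OF sub[OF k(1)]] by auto
    then obtain \<pi> where \<pi>: "endo \<pi>" "\<pi> l = 0" "\<And>v. \<exists>c. v - \<pi> v = scale c l"
      "\<And>W. subspace W \<Longrightarrow> l \<in> W \<Longrightarrow> l \<notin> \<pi> ` W"
      using line_projection_exists by blast
    define V' where "V' i = \<pi> ` V i" for i
    have J': "join V' A = \<pi> ` join V A" for A
      unfolding V'_def by (rule join_image[OF \<pi>(1)])
    have sub': "subspace (V' i)" if "i \<in> N" for i
      unfolding V'_def using subspace_image_endo[OF \<pi>(1) sub[OF that]] .
    have nz': "V' i \<noteq> {0}" if i: "i \<in> N" for i
    proof
      assume "V' i = {0}"
      then have "dim (V i) \<le> 1"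
        using dim_image_line_projection(1)[OF \<pi>(1,3) sub[OF i]] by (simp add: V'_def)
      moreover have "l \<in> V i"
      proof -
        obtain u where u: "u \<in> V i" "u \<noteq> 0"
          using subspace_0[OF sub[OF i]] nz[OF i] by blast
        obtain c where c: "u - \<pi> u = scale c l" using \<pi>(3) by blast
        have "\<pi> u = 0" using \<open>V' i = {0}\<close> u(1) by (auto simp: V'_def)
        then have "u = scale c l" using c by simp
        then have "c \<noteq> 0" "l = scale (inverse c) u" using u(2) by auto
        then show ?thesis using subspace_scale[OF sub[OF i] u(1)] by simp
      qed
      then have "V k \<subseteq> V i" using lA[of "{i}"] i join_singleton[of V i] sub by auto
      then have "dim (V k) \<le> dim (V i)" by (rule dim_subset)
      ultimately show False using k(2) by linarith
    qed
    have kN: "V k \<subseteq> join V N" using join_upper k(1) by blast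
    have d': "arr_rk scale V' N \<le> arr_rk scale V N - 1"
      using dim_image_line_projection_less[OF \<pi>(1,3) subspace_join _ \<pi>(4)] kN l(1) J'
      by (force simp: arr_rk_join)
    have rk': "arr_rk scale V' N - 1 \<le> (\<Sum>C\<in>P. arr_rk scale V' C - 1)" if P: "partition_on N P" for P
    proof -
      have fP: "finite P" using finite_elements[OF N(1) P] .
      have PN: "C \<subseteq> N" if "C \<in> P" for C using that P by (auto simp: partition_on_def)
      define Q where "Q = {C \<in> P. V k \<subseteq> join V C}"
      have "Q \<subseteq> P" "finite Q" using fP by (auto simp: Q_def)
      have "arr_rk scale V C \<le> arr_rk scale V' C + (if C \<in> Q then 1 else 0)" if "C \<in> P" for C
      proof (cases "l \<in> join V C")
        case True
        then have "C \<in> Q" using lA[OF PN[OF that]] that by (auto simp: Q_def)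
        then show ?thesis
          using dim_image_line_projection(1)[OF \<pi>(1,3) subspace_join, of V C]
          by (simp add: J' arr_rk_join)
      next
        case False
        then show ?thesis
          using dim_image_line_projection(2)[OF \<pi>(1,3) subspace_join, of V C]
          by (simp add: J' arr_rk_join)
      qed
      then have "(\<Sum>C\<in>P. arr_rk scale V C - 1) \<le> (\<Sum>C\<in>P. (arr_rk scale V' C - 1) + (if C \<in> Q then 1 else 0))"
        by (intro sum_mono) force
      also have "\<dots> = (\<Sum>C\<in>P. arr_rk scale V' C - 1) + int (card Q)"
        using fP \<open>Q \<subseteq> P\<close> by (simp add: sum.distrib sum.If_cases Int_absorb1 flip: Collect_mem_eq)
      finally have *: "(\<Sum>C\<in>P. arr_rk scale V C - 1) \<le> (\<Sum>C\<in>P. arr_rk scale V' C - 1) + int (card Q)" .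
      show ?thesis
      proof (cases "Q = {}")
        case True
        then show ?thesis using * rk[OF P] d' by simp
      next
        case False
        \<comment> \<open>\<open>Q\<close> collects the blocks whose rank drops; they are merged into one.\<close>
        define P' where "P' = insert (\<Union>Q) (P - Q)"
        have ne: "{} \<notin> P" and dj: "\<And>C D. C \<in> P \<Longrightarrow> D \<in> P \<Longrightarrow> C \<noteq> D \<Longrightarrow> C \<inter> D = {}"
          using P by (auto simp: partition_on_def disjoint_def)
        obtain C where C: "C \<in> Q" using False by blast
        then have "C \<noteq> {}" using ne \<open>Q \<subseteq> P\<close> by blast
        have dQ: "D \<inter> \<Union>Q = {}" if "D \<in> P - Q" for D
          using that dj \<open>Q \<subseteq> P\<close> by blast
        have nin: "\<Union>Q \<notin> P - Q"
          using dQ[of "\<Union>Q"] C \<open>C \<noteq> {}\<close> by blast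
        have "partition_on N P'"
        proof (rule partition_onI)
          show "\<Union>P' = N" using P \<open>Q \<subseteq> P\<close> by (auto simp: partition_on_def P'_def)
          show "{} \<notin> P'" using ne C \<open>C \<noteq> {}\<close> unfolding P'_def by blast
          show "disjnt p q" if pq: "p \<in> P'" "q \<in> P'" "p \<noteq> q" for p q
          proof -
            have "p \<in> P - Q \<and> q \<in> P - Q \<or> p \<in> P - Q \<and> q = \<Union>Q \<or> p = \<Union>Q \<and> q \<in> P - Q"
              using pq unfolding P'_def by blast
            then show ?thesis
              using dj pq(3) dQ[of p] dQ[of q] unfolding disjnt_def by blast
          qed
        qed
        from rk[OF this] have f1: "arr_rk scale V N - 1
            \<le> (arr_rk scale V (\<Union>Q) - 1) + (\<Sum>C\<in>P - Q. arr_rk scale V C - 1)"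
          unfolding P'_def using fP nin by simp
        have f2: "(\<Sum>C\<in>P. arr_rk scale V C - 1)
            = (\<Sum>C\<in>P - Q. arr_rk scale V C - 1) + (\<Sum>C\<in>Q. arr_rk scale V C - 1)"
          using sum.subset_diff[OF \<open>Q \<subseteq> P\<close> fP] .
        have f3: "(\<Sum>C\<in>Q. arr_rk scale V C - 1) = (\<Sum>C\<in>Q. arr_rk scale V C) - int (card Q)"
          by (simp add: sum_subtractf)
        have f4: "arr_rk scale V (\<Union>Q) + (int (card Q) - 1) * int (dim (V k))
            \<le> (\<Sum>C\<in>Q. arr_rk scale V C)"
          using rk_Union_le(1)[OF \<open>finite Q\<close> False, of "V k" V] by (auto simp: Q_def)
        have f5: "(int (card Q) - 1) * 2 \<le> (int (card Q) - 1) * int (dim (V k))"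
        proof (rule mult_left_mono)
          show "2 \<le> int (dim (V k))" using k(2) by linarith
          have "0 < card Q" using False \<open>finite Q\<close> card_gt_0_iff by blast
          then show "0 \<le> int (card Q) - 1" by linarith
        qed
        have arith: "e - 1 \<le> s'"
          if "d - 1 \<le> (r - 1) + t" "s = t + u" "u = w - q" "r + x \<le> w" "(q - 1) * 2 \<le> x"
            "s \<le> s' + q" "e \<le> d - 1" for d e r s s' t u w x q :: int
          using that by presburger
        show ?thesis by (rule arith[OF f1 f2 f3 f4 f5 * d'])
      qed
    qed
    have "(\<Sum>i\<in>N. dim (V' i)) < (\<Sum>i\<in>N. dim (V i))"
    proof (rule sum_strict_mono_ex1[OF N(1)])
      interpret P: finite_dimensional_vector_space_pair_1 scale Basis scale by unfold_locales
      show "\<forall>i\<in>N. dim (V' i) \<le> dim (V i)"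
        unfolding V'_def using P.dim_image_le[OF \<pi>(1)] by blast
      show "\<exists>i\<in>N. dim (V' i) < dim (V i)"
        unfolding V'_def
        using dim_image_line_projection_less[OF \<pi>(1,3) sub[OF k(1)] l(1) \<pi>(4)] sub l(1) k(1) by blast
    qed
    from less.hyps[OF this sub' nz' rk']
    obtain \<psi> where \<psi>: "functional \<psi>" "\<forall>i\<in>N. \<exists>u\<in>V' i. \<psi> u \<noteq> 0"
      "join V' N \<inter> {v. \<psi> v = 0} \<subseteq> join (\<lambda>i. V' i \<inter> {v. \<psi> v = 0}) N" by blast
    define \<phi> where "\<phi> v = \<psi> (\<pi> v)" for v
    define W where "W i = V i \<inter> {v. \<phi> v = 0}" for i
    have \<phi>: "functional \<phi>"
      unfolding \<phi>_def by (rule functional_compose[OF \<psi>(1) \<pi>(1)])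
    have "\<phi> l = 0" by (simp add: \<phi>_def \<pi>(2) functional_0[OF \<psi>(1)])
    then have lW: "l \<in> join W N" using l(1) k(1) join_upper[of k N W] by (auto simp: W_def)
    have lift_W: "v \<in> join W N" if "\<pi> v \<in> join W N" for v
    proof -
      obtain c where "v - \<pi> v = scale c l" using \<pi>(3) by blast
      then have "v = \<pi> v + scale c l" by (metis add.commute diff_add_cancel)
      then show ?thesis
        using that lW subspace_add[OF subspace_join] subspace_scale[OF subspace_join] by metis
    qed
    have "V' i \<inter> {v. \<psi> v = 0} \<subseteq> join W N" if "i \<in> N" for i
    proof
      fix y assume "y \<in> V' i \<inter> {v. \<psi> v = 0}"
      then obtain v where v: "v \<in> V i" "y = \<pi> v" "\<psi> (\<pi> v) = 0" by (auto simp: V'_def)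
      then have "v \<in> join W N" using join_upper[OF that, of W] by (auto simp: W_def \<phi>_def)
      obtain c where "v - \<pi> v = scale c l" using \<pi>(3) by blast
      then have "y = v - scale c l" using v(2) by (metis add_diff_cancel_left' diff_add_cancel)
      then show "y \<in> join W N"
        using \<open>v \<in> join W N\<close> lW subspace_diff[OF subspace_join] subspace_scale[OF subspace_join] by metis
    qed
    then have "join (\<lambda>i. V' i \<inter> {v. \<psi> v = 0}) N \<subseteq> join W N"
      by (intro join_least subspace_join) auto
    with \<psi>(3) have "join V N \<inter> {v. \<phi> v = 0} \<subseteq> join W N"
      using lift_W by (auto simp: J' \<phi>_def)
    moreover have "\<forall>i\<in>N. \<exists>u\<in>V i. \<phi> u \<noteq> 0" using \<psi>(2) by (auto simp: V'_def \<phi>_def)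
    ultimately show ?thesis using \<phi> unfolding W_def by blast
  qed
qed

end

section \<open>Substitution homomorphisms out of the symmetric algebra\<close>

context finite_dimensional_vector_space
begin

abbreviation S :: "(('b \<Rightarrow>\<^sub>0 nat) \<Rightarrow>\<^sub>0 'a) ring" where "S \<equiv> sym_algebra Basis"

abbreviation lin :: "'b \<Rightarrow> (('b \<Rightarrow>\<^sub>0 nat) \<Rightarrow>\<^sub>0 'a)" where "lin \<equiv> sym_emb scale Basis"

interpretation R: cring S by (rule cring_sym_algebra)

lemma carrier_add: "p \<in> carrier S \<Longrightarrow> q \<in> carrier S \<Longrightarrow> p + q \<in> carrier S"
  and carrier_mult: "p \<in> carrier S \<Longrightarrow> q \<in> carrier S \<Longrightarrow> p * q \<in> carrier S"
  and carrier_0: "0 \<in> carrier S" and carrier_1: "1 \<in> carrier S"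
  using R.add.m_closed[of p q] R.m_closed[of p q] R.zero_closed R.one_closed
  by (simp_all add: sym_algebra_ops)

lemma carrier_const: "sym_const c \<in> carrier S"
  by (auto simp: sym_algebra_def sym_const_def split: if_splits)

lemma sym_const_hom: "sym_const 1 = 1" "sym_const (c + d) = sym_const c + sym_const d"
  "sym_const (c * d) = sym_const c * sym_const d"
  by (simp_all add: sym_const_def single_add mult_single)

lemma carrier_uminus: "p \<in> carrier S \<Longrightarrow> - p \<in> carrier S"
  by (simp add: sym_algebra_def in_keys_iff)

lemma carrier_diff: "p \<in> carrier S \<Longrightarrow> q \<in> carrier S \<Longrightarrow> p - q \<in> carrier S"
  using carrier_add[of p "- q"] carrier_uminus by simp

lemma carrier_sum: "(\<And>i. i \<in> A \<Longrightarrow> f i \<in> carrier S) \<Longrightarrow> (\<Sum>i\<in>A. f i) \<in> carrier S"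
  by (induction A rule: infinite_finite_induct) (auto simp: carrier_add carrier_0)

lemma carrier_prod: "(\<And>i. i \<in> A \<Longrightarrow> f i \<in> carrier S) \<Longrightarrow> (\<Prod>i\<in>A. f i) \<in> carrier S"
  by (induction A rule: infinite_finite_induct) (auto simp: carrier_mult carrier_1)

lemma carrier_power: "p \<in> carrier S \<Longrightarrow> p ^ k \<in> carrier S"
  by (induction k) (auto simp: carrier_mult carrier_1)

lemmas lin_carrier = sym_emb_linear(1)[OF finite_dimensional_vector_space_axioms]
  and lin_add = sym_emb_linear(2)[OF finite_dimensional_vector_space_axioms]
  and lin_scale = sym_emb_linear(3)[OF finite_dimensional_vector_space_axioms]

lemmas carrier_intros = carrier_add carrier_mult carrier_0 carrier_1 carrier_const carrier_uminus
  carrier_diff carrier_sum carrier_prod carrier_power lin_carrier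

lemma lin_0: "lin 0 = 0"
  using lin_add[of 0 0] by simp

lemma lin_diff: "lin (v - w) = lin v - lin w"
  using lin_add[of "v - w" w] by (simp add: algebra_simps)

text \<open>
  The scalars and the linear forms generate the symmetric algebra; all comparisons of substitutions
  below are by this induction.
\<close>

lemma carrier_induct [consumes 1, case_names const lin add mult]:
  assumes "p \<in> carrier S"
    and const: "\<And>c. P (sym_const c)" and lin: "\<And>v. P (lin v)"
    and add: "\<And>p q. \<lbrakk>p \<in> carrier S; q \<in> carrier S; P p; P q\<rbrakk> \<Longrightarrow> P (p + q)"
    and mult: "\<And>p q. \<lbrakk>p \<in> carrier S; q \<in> carrier S; P p; P q\<rbrakk> \<Longrightarrow> P (p * q)"
  shows "P p"
proof -
  define E where "E = {q \<in> carrier S. P q}"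
  have E: "q + r \<in> E" "q * r \<in> E" if "q \<in> E" "r \<in> E" for q r
    using that add mult by (auto simp: E_def carrier_add carrier_mult)
  have cE: "sym_const c \<in> E" for c
    using const by (simp add: E_def carrier_const)
  have E01: "0 \<in> E" "1 \<in> E"
    using cE[of 0] cE[of 1] by (simp_all add: sym_const_def)
  have vE: "Poly_Mapping.single (Poly_Mapping.single b 1) 1 \<in> E" if "b \<in> Basis" for b
    using lin[of b] sym_emb_basis[OF finite_dimensional_vector_space_axioms that] lin_carrier[of b]
    by (simp add: E_def)
  have powE: "q ^ k \<in> E" if "q \<in> E" for q k
    by (induction k) (use that E01 E in auto)
  have prodE: "(\<Prod>i\<in>A. g i) \<in> E" if "\<And>i. i \<in> A \<Longrightarrow> g i \<in> E" for A :: "'b set" and g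
    using that by (induction A rule: infinite_finite_induct) (use E01 E in auto)
  have sumE: "(\<Sum>i\<in>A. g i) \<in> E" if "\<And>i. i \<in> A \<Longrightarrow> g i \<in> E" for A :: "('b \<Rightarrow>\<^sub>0 nat) set" and g
    using that by (induction A rule: infinite_finite_induct) (use E01 E in auto)
  have "p \<in> E"
    by (subst sum_const_monomial[of p], intro sumE E prodE powE cE vE)
      (use assms(1) in \<open>auto simp: sym_algebra_def\<close>)
  then show ?thesis by (simp add: E_def)
qed

text \<open>
  A structure of algebra over the scalars together with a linear map into it, which is what
  the universal property of the symmetric algebra extends to a homomorphism.
\<close>

definition alg_data :: "('a \<Rightarrow> 'c::comm_ring_1) \<Rightarrow> ('b \<Rightarrow> 'c) \<Rightarrow> bool" where
  "alg_data h f \<longleftrightarrow> h 1 = 1 \<and> (\<forall>a b. h (a + b) = h a + h b) \<and> (\<forall>a b. h (a * b) = h a * h b) \<and>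
     (\<forall>v w. f (v + w) = f v + f w) \<and> (\<forall>c v. f (scale c v) = h c * f v)"

definition subst :: "('a \<Rightarrow> 'c::comm_ring_1) \<Rightarrow> ('b \<Rightarrow> 'c) \<Rightarrow> (('b \<Rightarrow>\<^sub>0 nat) \<Rightarrow>\<^sub>0 'a) \<Rightarrow> 'c" where
  "subst h f = (SOME F. (\<forall>p \<in> carrier S. \<forall>q \<in> carrier S. F (p + q) = F p + F q \<and> F (p * q) = F p * F q) \<and>
     (\<forall>c. F (sym_const c) = h c) \<and> (\<forall>v. F (lin v) = f v))"

context
  fixes h :: "'a \<Rightarrow> 'c::comm_ring_1" and f :: "'b \<Rightarrow> 'c"
  assumes hf: "alg_data h f"
begin

lemma subst_spec:
  "(\<forall>p \<in> carrier S. \<forall>q \<in> carrier S. subst h f (p + q) = subst h f p + subst h f q \<and>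
      subst h f (p * q) = subst h f p * subst h f q) \<and>
   (\<forall>c. subst h f (sym_const c) = h c) \<and> (\<forall>v. subst h f (lin v) = f v)"
proof -
  have "\<exists>F. (\<forall>p \<in> carrier S. \<forall>q \<in> carrier S. F (p + q) = F p + F q \<and> F (p * q) = F p * F q) \<and>
     (\<forall>c. F (sym_const c) = h c) \<and> (\<forall>v. F (lin v) = f v)"
    using hf by (intro sym_algebra_universal_ex finite_dimensional_vector_space_axioms)
      (auto simp: alg_data_def)
  then show ?thesis unfolding subst_def by (rule someI_ex)
qed

lemma subst_add: "p \<in> carrier S \<Longrightarrow> q \<in> carrier S \<Longrightarrow> subst h f (p + q) = subst h f p + subst h f q"
  and subst_mult: "p \<in> carrier S \<Longrightarrow> q \<in> carrier S \<Longrightarrow> subst h f (p * q) = subst h f p * subst h f q"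
  and subst_const: "subst h f (sym_const c) = h c"
  and subst_lin: "subst h f (lin v) = f v"
  using subst_spec by blast+

lemma subst_0: "subst h f 0 = 0"
  using subst_add[OF carrier_0 carrier_0] by simp

lemma subst_1: "subst h f 1 = 1"
  using subst_const[of 1] hf by (simp add: sym_const_hom alg_data_def)

lemma subst_sum:
  "(\<And>i. i \<in> A \<Longrightarrow> g i \<in> carrier S) \<Longrightarrow> subst h f (\<Sum>i\<in>A. g i) = (\<Sum>i\<in>A. subst h f (g i))"
  by (induction A rule: infinite_finite_induct) (auto simp: subst_0 subst_add carrier_sum)

lemma subst_prod:
  "(\<And>i. i \<in> A \<Longrightarrow> g i \<in> carrier S) \<Longrightarrow> subst h f (\<Prod>i\<in>A. g i) = (\<Prod>i\<in>A. subst h f (g i))"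
  by (induction A rule: infinite_finite_induct) (auto simp: subst_1 subst_mult carrier_prod)

lemma subst_power: "p \<in> carrier S \<Longrightarrow> subst h f (p ^ k) = subst h f p ^ k"
  by (induction k) (auto simp: subst_1 subst_mult carrier_power)

end

lemmas subst_simps = subst_add subst_mult subst_const subst_lin

lemma alg_data_functional: "functional \<phi> \<Longrightarrow> alg_data (\<lambda>c. c) \<phi>"
  by (simp add: alg_data_def functional_iff)

lemma alg_data_lin: "alg_data sym_const lin"
  by (simp add: alg_data_def sym_const_hom lin_add lin_scale)

text \<open>
  The classical induction on the number of variables. The separation hypothesis survives the removal of
  a variable \<open>x\<close> on passing to the monomials that share the \<open>x\<close>-exponent of \<open>m0\<close>; once the other
  variables have values, these give a nonzero coefficient of a polynomial in \<open>x\<close> alone.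
\<close>

lemma separated_monomials_eval_nonzero:
  fixes c :: "'i \<Rightarrow> 'a" and e :: "'i \<Rightarrow> 'v \<Rightarrow> nat"
  assumes inf: "infinite (UNIV :: 'a set)"
    and "finite X" "finite M" "\<And>m m'. m \<in> M \<Longrightarrow> m' \<in> M \<Longrightarrow> m \<noteq> m' \<Longrightarrow> \<exists>b\<in>X. e m b \<noteq> e m' b"
    and "m0 \<in> M" "c m0 \<noteq> 0"
  shows "\<exists>y :: 'v \<Rightarrow> 'a. (\<Sum>m\<in>M. c m * (\<Prod>b\<in>X. y b ^ e m b)) \<noteq> 0"
  using assms(2-)
proof (induction X arbitrary: M rule: finite_induct)
  case empty
  then have "M = {m0}" by auto
  then show ?case using empty.prems by simp
next
  case (insert x X)
  define M' where "M' = {m \<in> M. e m x = e m0 x}"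
  have "\<exists>y :: 'v \<Rightarrow> 'a. (\<Sum>m\<in>M'. c m * (\<Prod>b\<in>X. y b ^ e m b)) \<noteq> 0"
  proof (rule insert.IH)
    show "finite M'" using insert.prems(1) by (simp add: M'_def)
    show "\<exists>b\<in>X. e m b \<noteq> e m' b" if "m \<in> M'" "m' \<in> M'" "m \<noteq> m'" for m m'
      using that insert.prems(2)[of m m'] by (auto simp: M'_def)
    show "m0 \<in> M'" "c m0 \<noteq> 0" using insert.prems by (auto simp: M'_def)
  qed
  then obtain y where y: "(\<Sum>m\<in>M'. c m * (\<Prod>b\<in>X. y b ^ e m b)) \<noteq> 0" by blast
  define q where "q = (\<Sum>m\<in>M. monom (c m * (\<Prod>b\<in>X. y b ^ e m b)) (e m x))"
  have "coeff q (e m0 x) = (\<Sum>m\<in>M. if e m x = e m0 x then c m * (\<Prod>b\<in>X. y b ^ e m b) else 0)"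
    by (simp add: q_def coeff_sum)
  also have "\<dots> = (\<Sum>m\<in>M'. c m * (\<Prod>b\<in>X. y b ^ e m b))"
    unfolding M'_def using insert.prems(1) by (intro sum.inter_filter[symmetric])
  finally have "q \<noteq> 0" using y by auto
  then have "finite {t. poly q t = 0}" by (rule poly_roots_finite)
  then obtain t where t: "poly q t \<noteq> 0" using inf ex_new_if_finite by blast
  have "(\<Sum>m\<in>M. c m * (\<Prod>b\<in>insert x X. (y(x := t)) b ^ e m b)) = poly q t"
  proof -
    have "(\<Prod>b\<in>insert x X. (y(x := t)) b ^ e m b) = t ^ e m x * (\<Prod>b\<in>X. y b ^ e m b)" for m
    proof -
      have "(\<Prod>b\<in>X. (y(x := t)) b ^ e m b) = (\<Prod>b\<in>X. y b ^ e m b)"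
        using insert.hyps(2) by (intro prod.cong) auto
      then show ?thesis using insert.hyps by simp
    qed
    then show ?thesis by (simp add: q_def poly_sum poly_monom mult_ac)
  qed
  then show ?case using t by metis
qed

lemma eval_nonzero_exists:
  assumes "infinite (UNIV :: 'a set)" "p \<in> carrier S" "p \<noteq> 0"
  shows "\<exists>\<phi>. functional \<phi> \<and> subst (\<lambda>c. c) \<phi> p \<noteq> 0"
proof -
  have supp: "Poly_Mapping.keys m \<subseteq> Basis" if "m \<in> Poly_Mapping.keys p" for m
    using assms(2) that by (auto simp: sym_algebra_def)
  obtain m0 where m0: "m0 \<in> Poly_Mapping.keys p" using assms(3) by fastforce
  have "\<exists>y :: 'b \<Rightarrow> 'a. (\<Sum>m\<in>Poly_Mapping.keys p. Poly_Mapping.lookup p m *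
      (\<Prod>b\<in>Basis. y b ^ Poly_Mapping.lookup m b)) \<noteq> 0"
  proof (rule separated_monomials_eval_nonzero[OF assms(1) finite_Basis _ _ m0])
    show "Poly_Mapping.lookup p m0 \<noteq> 0" using m0 by (simp add: in_keys_iff)
    fix m m' assume m: "m \<in> Poly_Mapping.keys p" "m' \<in> Poly_Mapping.keys p" "m \<noteq> m'"
    then obtain b where b: "Poly_Mapping.lookup m b \<noteq> Poly_Mapping.lookup m' b"
      by (metis poly_mapping_eqI)
    then have "b \<in> Poly_Mapping.keys m \<union> Poly_Mapping.keys m'" by (auto simp: in_keys_iff)
    then show "\<exists>b\<in>Basis. Poly_Mapping.lookup m b \<noteq> Poly_Mapping.lookup m' b"
      using supp m b by blast
  qed simp
  then obtain y where y: "(\<Sum>m\<in>Poly_Mapping.keys p. Poly_Mapping.lookup p m *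
      (\<Prod>b\<in>Basis. y b ^ Poly_Mapping.lookup m b)) \<noteq> 0" by blast
  interpret K: vector_space "(*) :: 'a \<Rightarrow> 'a \<Rightarrow> 'a" by (rule vector_space_field)
  interpret P: vector_space_pair scale "(*) :: 'a \<Rightarrow> 'a \<Rightarrow> 'a" by unfold_locales
  obtain \<phi> where \<phi>: "functional \<phi>" "\<forall>b\<in>Basis. \<phi> b = y b"
    using P.linear_independent_extend[OF independent_Basis] by blast
  note hom = alg_data_functional[OF \<phi>(1)]
  let ?x = "\<lambda>b. Poly_Mapping.single (Poly_Mapping.single b 1) 1"
  have x: "?x b \<in> carrier S" "subst (\<lambda>c. c) \<phi> (?x b) = y b" if "b \<in> Basis" for b
    using sym_emb_basis[OF finite_dimensional_vector_space_axioms that] lin_carrier[of b]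
      subst_lin[OF hom, of b] \<phi>(2) that by auto
  have mono: "(\<Prod>b\<in>Poly_Mapping.keys m. ?x b ^ Poly_Mapping.lookup m b) \<in> carrier S"
    "subst (\<lambda>c. c) \<phi> (\<Prod>b\<in>Poly_Mapping.keys m. ?x b ^ Poly_Mapping.lookup m b)
        = (\<Prod>b\<in>Basis. y b ^ Poly_Mapping.lookup m b)" if "m \<in> Poly_Mapping.keys p" for m
  proof -
    show "(\<Prod>b\<in>Poly_Mapping.keys m. ?x b ^ Poly_Mapping.lookup m b) \<in> carrier S"
      using x(1) supp[OF that] by (intro carrier_prod carrier_power) blast
    have "subst (\<lambda>c. c) \<phi> (\<Prod>b\<in>Poly_Mapping.keys m. ?x b ^ Poly_Mapping.lookup m b)
        = (\<Prod>b\<in>Poly_Mapping.keys m. subst (\<lambda>c. c) \<phi> (?x b ^ Poly_Mapping.lookup m b))"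
      using x(1) supp[OF that] by (intro subst_prod[OF hom] carrier_power) blast
    also have "\<dots> = (\<Prod>b\<in>Poly_Mapping.keys m. y b ^ Poly_Mapping.lookup m b)"
      using x supp[OF that] by (intro prod.cong refl) (auto simp: subst_power[OF hom])
    also have "\<dots> = (\<Prod>b\<in>Basis. y b ^ Poly_Mapping.lookup m b)"
      using supp[OF that] finite_Basis by (intro prod.mono_neutral_left) (auto simp: in_keys_iff)
    finally show "subst (\<lambda>c. c) \<phi> (\<Prod>b\<in>Poly_Mapping.keys m. ?x b ^ Poly_Mapping.lookup m b)
        = (\<Prod>b\<in>Basis. y b ^ Poly_Mapping.lookup m b)" .
  qed
  have "subst (\<lambda>c. c) \<phi> (\<Sum>m\<in>Poly_Mapping.keys p. sym_const (Poly_Mapping.lookup p m) *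
      (\<Prod>b\<in>Poly_Mapping.keys m. ?x b ^ Poly_Mapping.lookup m b))
      = (\<Sum>m\<in>Poly_Mapping.keys p. subst (\<lambda>c. c) \<phi> (sym_const (Poly_Mapping.lookup p m) *
      (\<Prod>b\<in>Poly_Mapping.keys m. ?x b ^ Poly_Mapping.lookup m b)))"
    using mono(1) by (intro subst_sum[OF hom] carrier_mult carrier_const)
  also have "\<dots> = (\<Sum>m\<in>Poly_Mapping.keys p. Poly_Mapping.lookup p m *
      (\<Prod>b\<in>Basis. y b ^ Poly_Mapping.lookup m b))"
    using mono by (intro sum.cong refl) (simp add: subst_mult[OF hom] subst_const[OF hom] carrier_const)
  finally have "subst (\<lambda>c. c) \<phi> p \<noteq> 0"
    using y sum_const_monomial[of p] by simp
  then show ?thesis using \<phi>(1) by blast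
qed

end

section \<open>Ideals generated by subspaces and the valuations they define\<close>

context finite_dimensional_vector_space
begin

interpretation R: cring S by (rule cring_sym_algebra)

lemma idealI_carrier:
  assumes "I \<subseteq> carrier S" "0 \<in> I" "\<And>a b. a \<in> I \<Longrightarrow> b \<in> I \<Longrightarrow> a + b \<in> I"
    "\<And>r a. r \<in> carrier S \<Longrightarrow> a \<in> I \<Longrightarrow> r * a \<in> I"
  shows "ideal I S"
proof (rule idealI[OF R.ring_axioms])
  show "subgroup I (add_monoid S)"
  proof (rule R.add.subgroupI)
    fix a assume a: "a \<in> I"
    have "\<ominus>\<^bsub>S\<^esub> a = - a"
      using a assms(1) carrier_uminus[of a] by (intro R.minus_equality) (auto simp: sym_algebra_ops)
    moreover have "- 1 * a \<in> I" using a assms(4) carrier_uminus[OF carrier_1] by blast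
    ultimately show "\<ominus>\<^bsub>S\<^esub> a \<in> I" by simp
  qed (use assms in \<open>auto simp: sym_algebra_ops\<close>)
next
  fix a x assume "a \<in> I" "x \<in> carrier S"
  then show "x \<otimes>\<^bsub>S\<^esub> a \<in> I" "a \<otimes>\<^bsub>S\<^esub> x \<in> I"
    using assms(4)[of x a] by (simp_all add: sym_algebra_ops mult.commute)
qed

lemma ideal_facts:
  assumes "ideal I S"
  shows ideal_carrier: "a \<in> I \<Longrightarrow> a \<in> carrier S" and ideal_0: "0 \<in> I"
    and ideal_add: "a \<in> I \<Longrightarrow> b \<in> I \<Longrightarrow> a + b \<in> I"
    and ideal_mult: "r \<in> carrier S \<Longrightarrow> a \<in> I \<Longrightarrow> r * a \<in> I"
    and ideal_mult_right: "r \<in> carrier S \<Longrightarrow> a \<in> I \<Longrightarrow> a * r \<in> I"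
proof -
  interpret ideal I S by fact
  show "a \<in> I \<Longrightarrow> a \<in> carrier S" "0 \<in> I" "a \<in> I \<Longrightarrow> b \<in> I \<Longrightarrow> a + b \<in> I"
    "r \<in> carrier S \<Longrightarrow> a \<in> I \<Longrightarrow> r * a \<in> I" "r \<in> carrier S \<Longrightarrow> a \<in> I \<Longrightarrow> a * r \<in> I"
    using Icarr zero_closed a_closed[of a b] I_l_closed[of a r] I_r_closed[of a r]
    by (simp_all add: sym_algebra_ops)
qed

lemma ideal_diff: "ideal I S \<Longrightarrow> a \<in> I \<Longrightarrow> b \<in> I \<Longrightarrow> a - b \<in> I"
  using ideal_add[of I a "- 1 * b"] ideal_mult[of I "- 1" b] carrier_uminus[OF carrier_1] by simp

lemma ideal_sum: "ideal I S \<Longrightarrow> (\<And>i. i \<in> A \<Longrightarrow> f i \<in> I) \<Longrightarrow> (\<Sum>i\<in>A. f i) \<in> I"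
  by (induction A rule: infinite_finite_induct) (auto simp: ideal_0 ideal_add)

definition lin_ideal :: "'b set \<Rightarrow> (('b \<Rightarrow>\<^sub>0 nat) \<Rightarrow>\<^sub>0 'a) set" where
  "lin_ideal W = Idl\<^bsub>S\<^esub> (lin ` W)"

definition lin_pow :: "'b set \<Rightarrow> nat \<Rightarrow> (('b \<Rightarrow>\<^sub>0 nat) \<Rightarrow>\<^sub>0 'a) set" where
  "lin_pow W k = lin_ideal W [^]\<^bsub>ideals_set S\<^esub> k"

lemma lin_ideal_ideal: "ideal (lin_ideal W) S"
  unfolding lin_ideal_def using lin_carrier by (intro R.genideal_ideal) auto

lemma lin_in_lin_ideal: "w \<in> W \<Longrightarrow> lin w \<in> lin_ideal W"
  unfolding lin_ideal_def using R.genideal_self[of "lin ` W"] lin_carrier by auto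

lemma lin_ideal_least: "ideal I S \<Longrightarrow> (\<And>w. w \<in> W \<Longrightarrow> lin w \<in> I) \<Longrightarrow> lin_ideal W \<subseteq> I"
  unfolding lin_ideal_def by (intro R.genideal_minimal) auto

lemma lin_ideal_mono: "W \<subseteq> W' \<Longrightarrow> lin_ideal W \<subseteq> lin_ideal W'"
  by (intro lin_ideal_least lin_ideal_ideal lin_in_lin_ideal) auto

lemma lin_ideal_zero: "lin_ideal {0} = {0}"
proof -
  have "ideal {0} S" by (rule idealI_carrier) (auto simp: carrier_0)
  then have "lin_ideal {0} \<subseteq> {0}" by (rule lin_ideal_least) (auto simp: lin_0)
  then show ?thesis using ideal_0[OF lin_ideal_ideal, of "{0}"] by blast
qed

lemma ideals_set_simps:
  "carrier (ideals_set S) = {I. ideal I S}" "x \<otimes>\<^bsub>ideals_set S\<^esub> y = x \<cdot>\<^bsub>S\<^esub> y"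
  "\<one>\<^bsub>ideals_set S\<^esub> = carrier S" "\<zero>\<^bsub>ideals_set S\<^esub> = {0}" "x \<oplus>\<^bsub>ideals_set S\<^esub> y = x <+>\<^bsub>S\<^esub> y"
  by (simp_all add: ideals_set_def sym_algebra_ops)

interpretation M: comm_monoid "ideals_set S" by (rule R.ideals_set_is_comm_monoid)

lemma prod_in_ideal_prod: "a \<in> I \<Longrightarrow> b \<in> J \<Longrightarrow> a * b \<in> I \<cdot>\<^bsub>S\<^esub> J"
  using ideal_prod.prod[of a I b J S] by (simp add: sym_algebra_ops)

lemma ideal_prod_least:
  assumes "ideal K S" "\<And>a b. a \<in> I \<Longrightarrow> b \<in> J \<Longrightarrow> a * b \<in> K"
  shows "I \<cdot>\<^bsub>S\<^esub> J \<subseteq> K"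
proof
  fix x assume "x \<in> I \<cdot>\<^bsub>S\<^esub> J"
  then show "x \<in> K"
    by (induction rule: ideal_prod.induct) (use assms ideal_add in \<open>auto simp: sym_algebra_ops\<close>)
qed

lemma lin_pow_ideal: "ideal (lin_pow W k) S"
  using M.nat_pow_closed[of "lin_ideal W" k] lin_ideal_ideal by (simp add: lin_pow_def ideals_set_simps)

lemma lin_pow_0 [simp]: "lin_pow W 0 = carrier S"
  by (simp add: lin_pow_def ideals_set_simps)

lemma lin_pow_1: "lin_pow W 1 = lin_ideal W"
  using M.l_one[of "lin_ideal W"] lin_ideal_ideal by (simp add: lin_pow_def ideals_set_simps)

lemma lin_pow_Suc: "lin_pow W (Suc k) = lin_pow W k \<cdot>\<^bsub>S\<^esub> lin_ideal W"
  by (simp add: lin_pow_def ideals_set_simps)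

lemma lin_pow_mult: "p \<in> lin_pow W k \<Longrightarrow> q \<in> lin_pow W j \<Longrightarrow> p * q \<in> lin_pow W (k + j)"
  using M.nat_pow_mult[of "lin_ideal W" k j] prod_in_ideal_prod[of p "lin_pow W k" q "lin_pow W j"]
    lin_ideal_ideal by (simp add: lin_pow_def ideals_set_simps)

lemma lin_pow_antimono: "k \<le> j \<Longrightarrow> lin_pow W j \<subseteq> lin_pow W k"
proof (induction j rule: dec_induct)
  case (step j)
  have "lin_pow W (Suc j) \<subseteq> lin_pow W j"
    unfolding lin_pow_Suc using lin_pow_ideal ideal_mult_right lin_ideal_ideal ideal_carrier
    by (intro ideal_prod_least) metis+
  with step show ?case by simp
qed simp

lemma lin_pow_mono: "W \<subseteq> W' \<Longrightarrow> lin_pow W k \<subseteq> lin_pow W' k"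
proof (induction k)
  case (Suc k)
  have "lin_ideal W \<subseteq> lin_ideal W'" using Suc.prems by (rule lin_ideal_mono)
  then show ?case
    using Suc.IH[OF Suc.prems] lin_pow_ideal[of W' "Suc k"]
    unfolding lin_pow_Suc by (intro ideal_prod_least prod_in_ideal_prod) auto
qed simp

lemma power_in_lin_pow: "p \<in> lin_ideal W \<Longrightarrow> p ^ k \<in> lin_pow W k"
proof (induction k)
  case (Suc k)
  then show ?case
    using lin_pow_mult[of "p ^ k" W k p 1] lin_pow_1[of W] by (simp add: mult.commute)
qed (simp add: carrier_1)

text \<open>
  The component of a vector in the range of the projection \<open>\<pi>\<close> is marked by the polynomial variable,
  and \<open>\<alpha>\<close> is applied to both components. The order at zero of the result is how the order of vanishing along
  the ideal of the range of \<open>\<pi>\<close> is measured.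
\<close>

definition graded_subst ::
    "('a \<Rightarrow> 'c::comm_ring_1) \<Rightarrow> ('b \<Rightarrow> 'c) \<Rightarrow> ('b \<Rightarrow> 'b) \<Rightarrow> (('b \<Rightarrow>\<^sub>0 nat) \<Rightarrow>\<^sub>0 'a) \<Rightarrow> 'c poly" where
  "graded_subst h \<alpha> \<pi> = subst (\<lambda>c. [:h c:]) (\<lambda>v. [:\<alpha> (v - \<pi> v), \<alpha> (\<pi> v):])"

lemma alg_data_diff: "alg_data h \<alpha> \<Longrightarrow> \<alpha> (v - w) = \<alpha> v - \<alpha> w"
  unfolding alg_data_def by (metis add_diff_cancel_right' diff_add_cancel)

lemma alg_data_zero: "alg_data h \<alpha> \<Longrightarrow> \<alpha> 0 = 0" "alg_data h \<alpha> \<Longrightarrow> h 0 = 0"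
  unfolding alg_data_def by (metis add_cancel_right_right)+

lemma alg_data_graded:
  assumes "alg_data h \<alpha>" "endo \<pi>"
  shows "alg_data (\<lambda>c. [:h c:]) (\<lambda>v. [:\<alpha> (v - \<pi> v), \<alpha> (\<pi> v):])"
  using assms unfolding alg_data_def
  by (simp add: alg_data_diff[OF assms(1)] endo_iff algebra_simps one_pCons)

lemma graded_subst_simps:
  assumes "alg_data h \<alpha>" "endo \<pi>"
  shows "p \<in> carrier S \<Longrightarrow> q \<in> carrier S \<Longrightarrow>
      graded_subst h \<alpha> \<pi> (p + q) = graded_subst h \<alpha> \<pi> p + graded_subst h \<alpha> \<pi> q"
    and "p \<in> carrier S \<Longrightarrow> q \<in> carrier S \<Longrightarrow>
      graded_subst h \<alpha> \<pi> (p * q) = graded_subst h \<alpha> \<pi> p * graded_subst h \<alpha> \<pi> q"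
    and "graded_subst h \<alpha> \<pi> (sym_const c) = [:h c:]"
    and "graded_subst h \<alpha> \<pi> (lin v) = [:\<alpha> (v - \<pi> v), \<alpha> (\<pi> v):]"
  unfolding graded_subst_def using subst_simps[OF alg_data_graded[OF assms]] by simp_all

lemma lin_pow_graded_subst_dvd:
  fixes h :: "'a \<Rightarrow> 'c::comm_ring_1"
  assumes hf: "alg_data h \<alpha>" "endo \<pi>" and W: "\<forall>w\<in>W. \<pi> w = w" and p: "p \<in> lin_pow W k"
  shows "monom 1 k dvd graded_subst h \<alpha> \<pi> p"
proof -
  let ?F = "graded_subst h \<alpha> \<pi>"
  note F = graded_subst_simps[OF hf]
  have pre: "ideal {p \<in> carrier S. d dvd ?F p} S" for d
  proof (rule idealI_carrier)
    show "0 \<in> {p \<in> carrier S. d dvd ?F p}"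
      using F(1)[OF carrier_0 carrier_0] by (simp add: carrier_0)
  qed (auto simp: F carrier_intros)
  have "lin_pow W k \<subseteq> {p \<in> carrier S. monom 1 k dvd ?F p}" for k
  proof (induction k)
    case 0
    show ?case by auto
  next
    case (Suc k)
    have "lin_ideal W \<subseteq> {p \<in> carrier S. [:0, 1:] dvd ?F p}"
    proof (rule lin_ideal_least[OF pre])
      fix w assume "w \<in> W"
      then have "?F (lin w) = [:0, 1:] * [:\<alpha> w:]" using W by (simp add: F alg_data_zero[OF hf(1)])
      then show "lin w \<in> {p \<in> carrier S. [:0, 1:] dvd ?F p}"
        using lin_carrier by (metis (mono_tags, lifting) dvd_triv_left mem_Collect_eq)
    qed
    moreover have "monom 1 (Suc k) = monom 1 k * [:0, 1 :: 'c:]"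
      by (simp add: monom_Suc)
    ultimately have "a * b \<in> {p \<in> carrier S. monom 1 (Suc k) dvd ?F p}"
      if "a \<in> lin_pow W k" "b \<in> lin_ideal W" for a b
      using Suc.IH that mult_dvd_mono[of "monom 1 k" "?F a" "[:0, 1:]" "?F b"]
      by (auto simp only: F carrier_mult mem_Collect_eq subset_eq)
    then show ?case
      unfolding lin_pow_Suc by (intro ideal_prod_least[OF pre])
  qed
  then show ?thesis using p by blast
qed

lemma coeff_graded_subst_hom:
  assumes hf: "alg_data h \<alpha>" "endo \<pi>" and p: "p \<in> carrier S"
    and \<theta>: "\<And>x y. \<theta> (x + y) = \<theta> x + \<theta> y" "\<And>x y. \<theta> (x * y) = \<theta> x * \<theta> y" "\<theta> 1 = 1"
  shows "coeff (graded_subst (\<lambda>c. \<theta> (h c)) (\<lambda>v. \<theta> (\<alpha> v)) \<pi> p) i = \<theta> (coeff (graded_subst h \<alpha> \<pi> p) i)"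
proof -
  have hf': "alg_data (\<lambda>c. \<theta> (h c)) (\<lambda>v. \<theta> (\<alpha> v))"
    using hf(1) \<theta> by (simp add: alg_data_def)
  note F = graded_subst_simps[OF hf] and G = graded_subst_simps[OF hf' hf(2)]
  have \<theta>0: "\<theta> 0 = 0" using \<theta>(1)[of 0 0] by simp
  have \<theta>sum: "\<theta> (\<Sum>j\<in>A. g j) = (\<Sum>j\<in>A. \<theta> (g j))" for A :: "nat set" and g
    by (induction A rule: infinite_finite_induct) (auto simp: \<theta> \<theta>0)
  from p show ?thesis
  proof (induction p arbitrary: i rule: carrier_induct)
    case (const c)
    show ?case by (simp add: F G coeff_pCons \<theta>0 split: nat.split)
  next
    case (lin v)
    show ?case by (simp add: F G coeff_pCons \<theta>0 split: nat.split)
  next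
    case (add p q)
    then show ?case by (simp add: F G \<theta>)
  next
    case (mult p q)
    then show ?case by (simp add: F G coeff_mult \<theta> \<theta>sum)
  qed
qed

text \<open>
  Taking \<open>\<alpha>\<close> to be the embedding of the linear forms decomposes an element into its homogeneous parts
  with respect to \<open>W\<close>: the \<open>i\<close>-th part lies in the \<open>i\<close>-th power, and the parts add up to the element. Every
  scalar substitution is a specialisation of this one.
\<close>

lemma coeff_generic_graded_subst:
  assumes \<pi>: "endo \<pi>" "\<forall>v. \<pi> v \<in> W" and p: "p \<in> carrier S"
  shows "coeff (graded_subst sym_const lin \<pi> p) i \<in> lin_pow W i"
    and "poly (graded_subst sym_const lin \<pi> p) 1 = p"
    and "functional \<phi> \<Longrightarrow> coeff (graded_subst (\<lambda>c. c) \<phi> \<pi> p) i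
      = subst (\<lambda>c. c) \<phi> (coeff (graded_subst sym_const lin \<pi> p) i)"
proof -
  note F = graded_subst_simps[OF alg_data_lin \<pi>(1)]
  show A: "coeff (graded_subst sym_const lin \<pi> p) i \<in> lin_pow W i" for i
    using p
  proof (induction p arbitrary: i rule: carrier_induct)
    case (const c)
    show ?case by (auto simp: F coeff_pCons carrier_intros ideal_0 lin_pow_ideal split: nat.split)
  next
    case (lin v)
    have "lin (\<pi> v) \<in> lin_pow W 1" using lin_in_lin_ideal \<pi>(2) by (simp only: lin_pow_1)
    then show ?case
      by (auto simp: F coeff_pCons carrier_intros ideal_0 lin_pow_ideal split: nat.split)
  next
    case (add p q)
    then show ?case by (simp add: F ideal_add lin_pow_ideal)
  next
    case (mult p q)
    have "coeff (graded_subst sym_const lin \<pi> p) j * coeff (graded_subst sym_const lin \<pi> q) (i - j)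
        \<in> lin_pow W i" if "j \<le> i" for j
      using lin_pow_mult[OF mult.IH(1)[of j] mult.IH(2)[of "i - j"]] that by simp
    then show ?case using mult.hyps by (auto simp: F coeff_mult intro!: ideal_sum lin_pow_ideal)
  qed
  show "poly (graded_subst sym_const lin \<pi> p) 1 = p"
    using p
  proof (induction p rule: carrier_induct)
    case (lin v)
    then show ?case by (simp add: F flip: lin_add)
  qed (simp_all add: F)
  assume \<phi>: "functional \<phi>"
  note hom = alg_data_functional[OF \<phi>]
  note G = graded_subst_simps[OF hom \<pi>(1)]
  have C: "coeff (graded_subst sym_const lin \<pi> p) i \<in> carrier S" if "p \<in> carrier S" for p i
    using that
  proof (induction p arbitrary: i rule: carrier_induct)
    case (mult p q)
    then show ?case by (auto simp: F coeff_mult intro!: carrier_intros)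
  qed (auto simp: F coeff_pCons carrier_intros split: nat.split)
  show "coeff (graded_subst (\<lambda>c. c) \<phi> \<pi> p) i
      = subst (\<lambda>c. c) \<phi> (coeff (graded_subst sym_const lin \<pi> p) i)"
    using p
  proof (induction p arbitrary: i rule: carrier_induct)
    case (mult p q)
    then show ?case
      by (simp add: F G coeff_mult subst_sum[OF hom] subst_mult[OF hom] C carrier_intros)
  next
    case (add p q)
    then show ?case by (simp add: F G subst_add[OF hom] C)
  qed (auto simp: F G coeff_pCons subst_simps[OF hom] subst_0[OF hom] split: nat.split)
qed

text \<open>
  If every functional makes the image divisible by the \<open>k\<close>-th power of the variable, then the homogeneous
  parts of degree below \<open>k\<close> vanish at all points, hence vanish because the field is infinite; the
  other parts lie in the \<open>k\<close>-th power of the ideal.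
\<close>

lemma lin_pow_iff_graded_subst:
  assumes inf: "infinite (UNIV :: 'a set)"
    and \<pi>: "endo \<pi>" "\<forall>v. \<pi> v \<in> W" "\<forall>w\<in>W. \<pi> w = w" and p: "p \<in> carrier S"
  shows "p \<in> lin_pow W k \<longleftrightarrow> (\<forall>\<phi>. functional \<phi> \<longrightarrow> monom 1 k dvd graded_subst (\<lambda>c. c) \<phi> \<pi> p)"
proof
  show "\<forall>\<phi>. functional \<phi> \<longrightarrow> monom 1 k dvd graded_subst (\<lambda>c. c) \<phi> \<pi> p" if "p \<in> lin_pow W k"
    using lin_pow_graded_subst_dvd[OF alg_data_functional \<pi>(1,3) that] by blast
next
  assume dvd: "\<forall>\<phi>. functional \<phi> \<longrightarrow> monom 1 k dvd graded_subst (\<lambda>c. c) \<phi> \<pi> p"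
  let ?q = "graded_subst sym_const lin \<pi> p"
  note c = coeff_generic_graded_subst[OF \<pi>(1,2) p]
  have "coeff ?q i = 0" if "i < k" for i
  proof (rule ccontr)
    assume "coeff ?q i \<noteq> 0"
    moreover have "coeff ?q i \<in> carrier S" using c(1)[of i] lin_pow_ideal ideal_carrier by blast
    ultimately obtain \<phi> where "functional \<phi>" "subst (\<lambda>c. c) \<phi> (coeff ?q i) \<noteq> 0"
      using eval_nonzero_exists[OF inf] by blast
    then show False using dvd c(3)[of \<phi> i] that by (simp add: monom_1_dvd_iff')
  qed
  then have "coeff ?q i \<in> lin_pow W k" for i
    using c(1)[of i] lin_pow_antimono[of k i W] ideal_0[OF lin_pow_ideal, of W k] by (cases "i < k") auto
  then have "(\<Sum>i\<le>degree ?q. coeff ?q i) \<in> lin_pow W k"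
    by (intro ideal_sum lin_pow_ideal)
  then show "p \<in> lin_pow W k" using c(2) by (simp add: poly_altdef)
qed

lemma monom_dvd_mult_cases:
  fixes p q :: "'c::idom poly"
  assumes "monom 1 (a + b + 1) dvd p * q"
  shows "monom 1 (a + 1) dvd p \<or> monom 1 (b + 1) dvd q"
proof (cases "p = 0 \<or> q = 0")
  case False
  then have "a + b + 1 \<le> Polynomial.order 0 p + Polynomial.order 0 q"
    using assms by (simp add: monom_1_dvd_iff order_mult)
  then show ?thesis using False by (simp add: monom_1_dvd_iff) linarith
qed auto

text \<open>
  If both conclusions fail, each failure is witnessed by a functional. Put the two functionals on the line
  \<open>\<phi> + t (\<psi> - \<phi>)\<close> with an indeterminate \<open>t\<close>: over the domain of polynomials in \<open>t\<close> orders are additive, so one of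
  the factors has a large order, and specialising \<open>t\<close> to 0 or to 1 contradicts its witness.
\<close>

lemma lin_pow_valuation:
  assumes inf: "infinite (UNIV :: 'a set)" and W: "subspace W"
    and p: "p \<in> carrier S" and q: "q \<in> carrier S" and pq: "p * q \<in> lin_pow W (a + b + 1)"
  shows "p \<in> lin_pow W (a + 1) \<or> q \<in> lin_pow W (b + 1)"
proof (rule ccontr)
  assume neg: "\<not> ?thesis"
  obtain \<pi> where \<pi>: "endo \<pi>" "\<forall>v. \<pi> v \<in> W" "\<forall>w\<in>W. \<pi> w = w"
    using projection_exists[OF W] by blast
  obtain \<phi> where \<phi>: "functional \<phi>" "\<not> monom 1 (a + 1) dvd graded_subst (\<lambda>c. c) \<phi> \<pi> p"
    using neg lin_pow_iff_graded_subst[OF inf \<pi> p] by blast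
  obtain \<psi> where \<psi>: "functional \<psi>" "\<not> monom 1 (b + 1) dvd graded_subst (\<lambda>c. c) \<psi> \<pi> q"
    using neg lin_pow_iff_graded_subst[OF inf \<pi> q] by blast
  define \<alpha> where "\<alpha> v = [:\<phi> v, \<psi> v - \<phi> v:]" for v
  have \<alpha>: "alg_data (\<lambda>c. [:c:]) \<alpha>"
    using \<phi>(1) \<psi>(1) by (simp add: alg_data_def \<alpha>_def functional_iff one_pCons algebra_simps)
  let ?G = "graded_subst (\<lambda>c. [:c:]) \<alpha> \<pi>"
  have ev: "coeff (graded_subst (\<lambda>c. c) (\<lambda>v. poly (\<alpha> v) t) \<pi> r) i = poly (coeff (?G r) i) t"
    if "r \<in> carrier S" for r i t
    using coeff_graded_subst_hom[OF \<alpha> \<pi>(1) that, of "\<lambda>x. poly x t" i] by simp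
  have "monom 1 (a + b + 1) dvd ?G p * ?G q"
    using lin_pow_graded_subst_dvd[OF \<alpha> \<pi>(1,3) pq] graded_subst_simps(2)[OF \<alpha> \<pi>(1) p q] by simp
  then consider "monom 1 (a + 1) dvd ?G p" | "monom 1 (b + 1) dvd ?G q"
    using monom_dvd_mult_cases by blast
  then show False
  proof cases
    case 1
    then have "monom 1 (a + 1) dvd graded_subst (\<lambda>c. c) \<phi> \<pi> p"
      using ev[OF p, of 0] by (simp add: monom_1_dvd_iff' \<alpha>_def)
    then show False using \<phi>(2) by blast
  next
    case 2
    then have "monom 1 (b + 1) dvd graded_subst (\<lambda>c. c) \<psi> \<pi> q"
      using ev[OF q, of 1] by (simp add: monom_1_dvd_iff' \<alpha>_def)
    then show False using \<psi>(2) by blast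
  qed
qed

lemma lin_in_lin_ideal_iff:
  assumes W: "subspace W"
  shows "lin v \<in> lin_ideal W \<longleftrightarrow> v \<in> W"
proof
  assume v: "lin v \<in> lin_ideal W"
  obtain \<pi> where \<pi>: "endo \<pi>" "\<forall>v. \<pi> v \<in> W" "\<forall>w\<in>W. \<pi> w = w"
    using projection_exists[OF W] by blast
  show "v \<in> W"
  proof (rule ccontr)
    assume "v \<notin> W"
    then have "v - \<pi> v \<noteq> 0" using \<pi>(2) by (metis eq_iff_diff_eq_0)
    then obtain \<phi> where \<phi>: "functional \<phi>" "\<phi> (v - \<pi> v) = 1"
      using functional_exists[OF subspace_single_0, of "v - \<pi> v"] by auto
    have "monom 1 1 dvd graded_subst (\<lambda>c. c) \<phi> \<pi> (lin v)"
      using lin_pow_graded_subst_dvd[OF alg_data_functional[OF \<phi>(1)] \<pi>(1,3)] v lin_pow_1[of W] by simp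
    then show False
      using \<phi>(2) by (simp only: graded_subst_simps[OF alg_data_functional[OF \<phi>(1)] \<pi>(1)] monom_1_dvd_iff')
        auto
  qed
qed (rule lin_in_lin_ideal)

text \<open>
  Together with the valuation property this says that a nonzero linear form in \<open>W\<close> has order exactly one.
\<close>

lemma lin_notin_lin_square:
  assumes W: "subspace W" and "v \<noteq> 0"
  shows "lin v \<notin> lin_pow W 2"
proof
  assume v: "lin v \<in> lin_pow W 2"
  obtain \<pi> where \<pi>: "endo \<pi>" "\<forall>v. \<pi> v \<in> W" "\<forall>w\<in>W. \<pi> w = w"
    using projection_exists[OF W] by blast
  obtain \<phi> where \<phi>: "functional \<phi>" "\<phi> v = 1"
    using functional_exists[OF subspace_single_0, of v] \<open>v \<noteq> 0\<close> by auto
  note F = graded_subst_simps(4)[OF alg_data_functional[OF \<phi>(1)] \<pi>(1)]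
  have "\<forall>i<2. coeff (graded_subst (\<lambda>c. c) \<phi> \<pi> (lin v)) i = 0"
    using lin_pow_graded_subst_dvd[OF alg_data_functional[OF \<phi>(1)] \<pi>(1,3) v] monom_1_dvd_iff' by blast
  from this[rule_format, of 0] this[rule_format, of 1]
  have "\<phi> (v - \<pi> v) = 0" "\<phi> (\<pi> v) = 0" by (simp_all add: F)
  then show False using \<phi> by (simp add: functional_diff)
qed

lemma one_notin_lin_ideal:
  assumes "subspace W"
  shows "1 \<notin> lin_ideal W"
proof
  assume one: "1 \<in> lin_ideal W"
  obtain \<pi> where \<pi>: "endo \<pi>" "\<forall>v. \<pi> v \<in> W" "\<forall>w\<in>W. \<pi> w = w"
    using projection_exists[OF assms] by blast
  have 0: "functional (\<lambda>_. 0)" by (simp add: functional_iff)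
  have "monom 1 1 dvd graded_subst (\<lambda>c. c) (\<lambda>_. 0) \<pi> (sym_const 1)"
    using lin_pow_graded_subst_dvd[OF alg_data_functional[OF 0] \<pi>(1,3)] one lin_pow_1[of W]
    by (simp add: sym_const_hom)
  then show False
    by (simp only: graded_subst_simps[OF alg_data_functional[OF 0] \<pi>(1)] monom_1_dvd_iff') auto
qed

context
  assumes inf: "infinite (UNIV :: 'a set)"
begin

text \<open>
  The case in which one factor has order zero; it contains the primality of linear ideals and the
  primary property of their powers.
\<close>

lemma lin_pow_cancel:
  assumes W: "subspace W" and "p \<in> carrier S" "q \<in> carrier S" "p * q \<in> lin_pow W k" "p \<notin> lin_ideal W"
  shows "q \<in> lin_pow W k"
proof (cases k)
  case 0
  then show ?thesis using assms by simp
next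
  case (Suc j)
  then show ?thesis
    using lin_pow_valuation[OF inf W, of p q 0 j] assms lin_pow_1[of W] by simp
qed

lemma lin_ideal_prime:
  assumes "subspace W" "p \<in> carrier S" "q \<in> carrier S" "p * q \<in> lin_ideal W"
  shows "p \<in> lin_ideal W \<or> q \<in> lin_ideal W"
  using lin_pow_cancel[OF assms(1-3), of 1] assms(4) lin_pow_1[of W] by metis

lemma lin_ideal_primeideal:
  assumes "subspace W"
  shows "primeideal (lin_ideal W) S"
proof (rule primeidealI[OF lin_ideal_ideal cring_sym_algebra])
  show "carrier S \<noteq> lin_ideal W" using one_notin_lin_ideal[OF assms] carrier_1 by blast
  show "a \<in> lin_ideal W \<or> b \<in> lin_ideal W"
    if "a \<in> carrier S" "b \<in> carrier S" "a \<otimes>\<^bsub>S\<^esub> b \<in> lin_ideal W" for a b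
    using lin_ideal_prime[OF assms, of a b] that by (simp add: sym_algebra_ops)
qed

lemma nat_pow_carrier: "a [^]\<^bsub>S\<^esub> (k::nat) = a ^ k"
  by (induction k) (simp_all add: sym_algebra_ops mult.commute)

lemma power_in_lin_ideal:
  assumes "subspace W" "a \<in> carrier S" "a ^ k \<in> lin_ideal W"
  shows "a \<in> lin_ideal W"
  using assms(3)
proof (induction k)
  case 0
  then show ?case using one_notin_lin_ideal[OF assms(1)] by simp
next
  case (Suc k)
  then show ?case using lin_ideal_prime[OF assms(1,2) carrier_power[OF assms(2)]] by auto
qed

lemma radical_lin_pow:
  assumes W: "subspace W" and "0 < k"
  shows "radical_ideal S (lin_pow W k) = lin_ideal W"
proof -
  have "lin_pow W k \<subseteq> lin_ideal W"
    using lin_pow_antimono[of 1 k W] lin_pow_1[of W] assms(2) by simp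
  then show ?thesis
    using power_in_lin_ideal[OF W] power_in_lin_pow[of _ W k] ideal_carrier[OF lin_ideal_ideal]
    unfolding radical_ideal_def nat_pow_carrier by blast
qed

lemma primary_lin_pow:
  assumes W: "subspace W" and "0 < k"
  shows "primary_ideal S (lin_pow W k)"
  unfolding primary_ideal_def radical_lin_pow[OF assms]
proof (intro conjI ballI impI)
  show "lin_pow W k \<noteq> carrier S"
    using lin_pow_antimono[of 1 k W] lin_pow_1[of W] assms(2) one_notin_lin_ideal[OF W] carrier_1 by auto
  fix a b assume "a \<in> carrier S" "b \<in> carrier S" "a \<otimes>\<^bsub>S\<^esub> b \<in> lin_pow W k"
  then show "a \<in> lin_pow W k \<or> b \<in> lin_ideal W"
    using lin_pow_cancel[OF W, of b a k] by (auto simp: sym_algebra_ops mult.commute)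
qed (rule lin_pow_ideal)

end

end

section \<open>Products of linear ideals as intersections of powers\<close>

context finite_dimensional_vector_space
begin

interpretation R: cring S by (rule cring_sym_algebra)
interpretation M: comm_monoid "ideals_set S" by (rule R.ideals_set_is_comm_monoid)

definition lin_prod :: "(nat \<Rightarrow> 'b set) \<Rightarrow> nat set \<Rightarrow> (('b \<Rightarrow>\<^sub>0 nat) \<Rightarrow>\<^sub>0 'a) set" where
  "lin_prod V A = (\<Otimes>\<^bsub>ideals_set S\<^esub> i\<in>A. lin_ideal (V i))"

lemma lin_prod_ideal: "ideal (lin_prod V A) S"
  using M.finprod_closed[of "\<lambda>i. lin_ideal (V i)" A] lin_ideal_ideal
  by (auto simp: lin_prod_def ideals_set_simps)

lemma lin_prod_empty [simp]: "lin_prod V {} = carrier S"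
  by (simp add: lin_prod_def ideals_set_simps)

lemma lin_prod_insert:
  "finite A \<Longrightarrow> i \<notin> A \<Longrightarrow> lin_prod V (insert i A) = lin_ideal (V i) \<cdot>\<^bsub>S\<^esub> lin_prod V A"
  using M.finprod_insert[of A i "\<lambda>i. lin_ideal (V i)"] lin_ideal_ideal
  by (auto simp: lin_prod_def ideals_set_simps)

lemma lin_prod_subset_lin_pow:
  assumes "finite A" "\<And>i. i \<in> A \<Longrightarrow> V i \<subseteq> W"
  shows "lin_prod V A \<subseteq> lin_pow W (card A)"
  using assms
proof (induction A rule: finite_induct)
  case (insert i A)
  have "lin_ideal (V i) \<subseteq> lin_pow W 1"
    using insert.prems by (simp only: lin_pow_1) (simp add: lin_ideal_mono)
  moreover have "lin_prod V A \<subseteq> lin_pow W (card A)" using insert by simp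
  ultimately have "a * b \<in> lin_pow W (1 + card A)" if "a \<in> lin_ideal (V i)" "b \<in> lin_prod V A" for a b
    using that by (intro lin_pow_mult) auto
  then show ?case
    unfolding lin_prod_insert[OF insert.hyps] using insert.hyps
    by (intro ideal_prod_least lin_pow_ideal) simp
qed simp

lemma lin_prod_antimono:
  assumes "finite B" "A \<subseteq> B"
  shows "lin_prod V B \<subseteq> lin_prod V A"
proof -
  have "lin_prod V (C \<union> A) \<subseteq> lin_prod V A" if "finite C" "finite A" for C
    using that
  proof (induction C rule: finite_induct)
    case (insert i C)
    show ?case
    proof (cases "i \<in> C \<union> A")
      case False
      then have "lin_prod V (insert i (C \<union> A)) = lin_ideal (V i) \<cdot>\<^bsub>S\<^esub> lin_prod V (C \<union> A)"
        using insert by (intro lin_prod_insert) auto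
      also have "\<dots> \<subseteq> lin_prod V A"
        using insert ideal_mult[OF lin_prod_ideal] ideal_carrier[OF lin_ideal_ideal]
        by (intro ideal_prod_least lin_prod_ideal) blast
      finally show ?thesis by simp
    qed (use insert in \<open>auto simp: insert_absorb\<close>)
  qed simp
  from this[of B] show ?thesis using assms finite_subset[OF assms(2,1)] by (simp add: Un_absorb2)
qed

lemma lin_prod_subset_join: "finite B \<Longrightarrow> A \<subseteq> B \<Longrightarrow> lin_prod V B \<subseteq> lin_pow (join V A) (card A)"
  using lin_prod_antimono[of B A V] lin_prod_subset_lin_pow[of A V "join V A"] join_upper
  by (meson finite_subset order_trans)

lemma prod_in_lin_prod:
  "finite A \<Longrightarrow> (\<And>i. i \<in> A \<Longrightarrow> f i \<in> lin_ideal (V i)) \<Longrightarrow> (\<Prod>i\<in>A. f i) \<in> lin_prod V A"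
  by (induction A rule: finite_induct) (auto simp: carrier_1 lin_prod_insert intro!: prod_in_ideal_prod)

text \<open>
  Modulo the linear form \<open>l\<close> the product of the ideals depends only on the spaces modulo \<open>l\<close>. It is used to
  lift a product of projected spaces.
\<close>

lemma lin_prod_perturb:
  assumes "finite A" "\<And>i v'. i \<in> A \<Longrightarrow> v' \<in> V' i \<Longrightarrow> \<exists>v\<in>V i. \<exists>c. v' = v + scale c l"
    and "p \<in> lin_prod V' A"
  shows "\<exists>g\<in>lin_prod V A. \<exists>h\<in>carrier S. p = g + lin l * h"
  using assms
proof (induction A arbitrary: p rule: finite_induct)
  case empty
  then show ?case by (intro bexI[of _ p] bexI[of _ 0]) (auto simp: carrier_0)
next
  case (insert i A)
  let ?K = "\<lambda>I. {g + lin l * h | g h. g \<in> I \<and> h \<in> carrier S}"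
  have K: "ideal (?K I) S" if I: "ideal I S" for I
  proof (rule idealI_carrier)
    show "?K I \<subseteq> carrier S" using ideal_carrier[OF I] by (auto intro!: carrier_intros)
    show "0 \<in> ?K I" using ideal_0[OF I] carrier_0 by force
    show "a + b \<in> ?K I" if "a \<in> ?K I" "b \<in> ?K I" for a b
    proof -
      obtain g h g' h' where gh: "a = g + lin l * h" "b = g' + lin l * h'" "g \<in> I" "g' \<in> I"
        "h \<in> carrier S" "h' \<in> carrier S" using \<open>a \<in> ?K I\<close> \<open>b \<in> ?K I\<close> by auto
      have "a + b = (g + g') + lin l * (h + h')" by (simp add: gh algebra_simps)
      then show ?thesis using gh ideal_add[OF I] carrier_add by blast
    qed
    show "r * a \<in> ?K I" if "r \<in> carrier S" "a \<in> ?K I" for r a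
    proof -
      obtain g h where gh: "a = g + lin l * h" "g \<in> I" "h \<in> carrier S" using \<open>a \<in> ?K I\<close> by auto
      have "r * a = r * g + lin l * (r * h)" by (simp add: gh algebra_simps)
      then show ?thesis using gh ideal_mult[OF I] carrier_mult \<open>r \<in> carrier S\<close> by blast
    qed
  qed
  let ?P = "lin_ideal (V i) \<cdot>\<^bsub>S\<^esub> lin_prod V A"
  have P: "ideal ?P S" using lin_prod_ideal[of V "insert i A"] lin_prod_insert[OF insert.hyps] by simp
  have "lin_ideal (V' i) \<subseteq> ?K (lin_ideal (V i))"
  proof (rule lin_ideal_least[OF K[OF lin_ideal_ideal]])
    fix v' assume "v' \<in> V' i"
    then obtain v c where "v \<in> V i" "v' = v + scale c l" using insert.prems(1) by blast
    then have "lin v' = lin v + lin l * sym_const c" by (simp add: lin_add lin_scale mult.commute)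
    then show "lin v' \<in> ?K (lin_ideal (V i))"
      using lin_in_lin_ideal \<open>v \<in> V i\<close> carrier_const by blast
  qed
  moreover have "a * b \<in> ?K ?P" if ab: "a \<in> ?K (lin_ideal (V i))" "b \<in> lin_prod V' A" for a b
  proof -
    obtain g h where gh: "a = g + lin l * h" "g \<in> lin_ideal (V i)" "h \<in> carrier S" using ab(1) by auto
    obtain g' h' where gh': "b = g' + lin l * h'" "g' \<in> lin_prod V A" "h' \<in> carrier S"
      using insert.IH[OF _ ab(2)] insert.prems(1) by blast
    have "g \<in> carrier S" "g' \<in> carrier S"
      using gh gh' ideal_carrier lin_ideal_ideal lin_prod_ideal by blast+
    moreover have "a * b = g * g' + lin l * (h * g' + g * h' + lin l * (h * h'))"
      by (simp add: gh gh' algebra_simps)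
    ultimately show ?thesis using gh gh' prod_in_ideal_prod by (blast intro!: carrier_intros)
  qed
  ultimately have "lin_prod V' (insert i A) \<subseteq> ?K ?P"
    unfolding lin_prod_insert[OF insert.hyps] by (intro ideal_prod_least K[OF P]) blast
  then show ?case using insert.prems(2) unfolding lin_prod_insert[OF insert.hyps] by blast
qed

lemma lin_pow_subst:
  assumes "endo \<pi>" "p \<in> lin_pow W k"
  shows "subst sym_const (\<lambda>v. lin (\<pi> v)) p \<in> lin_pow (\<pi> ` W) k"
proof -
  have hom: "alg_data sym_const (\<lambda>v. lin (\<pi> v))"
    using assms(1) by (simp add: alg_data_def sym_const_hom lin_add lin_scale endo_iff)
  let ?F = "subst sym_const (\<lambda>v. lin (\<pi> v))"
  have car: "?F p \<in> carrier S" if "p \<in> carrier S" for p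
    using that by (induction p rule: carrier_induct) (auto simp: subst_simps[OF hom] carrier_intros)
  have pre: "ideal {p \<in> carrier S. ?F p \<in> I} S" if "ideal I S" for I
    by (rule idealI_carrier)
      (auto simp: subst_simps[OF hom] subst_0[OF hom] carrier_intros car ideal_0 ideal_add ideal_mult that)
  have "lin_pow W k \<subseteq> {p \<in> carrier S. ?F p \<in> lin_pow (\<pi> ` W) k}" for k
  proof (induction k)
    case (Suc k)
    have "lin_ideal W \<subseteq> {p \<in> carrier S. ?F p \<in> lin_ideal (\<pi> ` W)}"
      by (intro lin_ideal_least pre lin_ideal_ideal)
        (auto simp: subst_simps[OF hom] lin_carrier lin_in_lin_ideal)
    with Suc.IH have "a * b \<in> {p \<in> carrier S. ?F p \<in> lin_pow (\<pi> ` W) (Suc k)}"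
      if "a \<in> lin_pow W k" "b \<in> lin_ideal W" for a b
      using that prod_in_ideal_prod[of "?F a" "lin_pow (\<pi> ` W) k" "?F b" "lin_ideal (\<pi> ` W)"]
      by (simp add: subset_eq subst_simps[OF hom] carrier_mult lin_pow_Suc)
    then show ?case
      unfolding lin_pow_Suc[of W] by (intro ideal_prod_least pre lin_pow_ideal)
  qed (auto simp: car)
  then show ?thesis using assms(2) by blast
qed

lemma subst_line_projection:
  assumes "endo \<pi>" "\<And>v. \<exists>c. v - \<pi> v = scale c l" "p \<in> carrier S"
  shows "\<exists>h\<in>carrier S. p = subst sym_const (\<lambda>v. lin (\<pi> v)) p + lin l * h"
proof -
  have hom: "alg_data sym_const (\<lambda>v. lin (\<pi> v))"
    using assms(1) by (simp add: alg_data_def sym_const_hom lin_add lin_scale endo_iff)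
  let ?F = "subst sym_const (\<lambda>v. lin (\<pi> v))"
  have car: "?F p \<in> carrier S" if "p \<in> carrier S" for p
    using that by (induction p rule: carrier_induct) (auto simp: subst_simps[OF hom] carrier_intros)
  show ?thesis
    using assms(3)
  proof (induction p rule: carrier_induct)
    case (const c)
    show ?case using carrier_0 by (intro bexI[of _ 0]) (auto simp: subst_simps[OF hom])
  next
    case (lin v)
    obtain c where "v - \<pi> v = scale c l" using assms(2) by blast
    then have "lin v - lin (\<pi> v) = lin l * sym_const c"
      by (metis lin_diff lin_scale mult.commute)
    then have "lin v = lin (\<pi> v) + lin l * sym_const c"
      by (metis add.commute diff_add_cancel)
    then have "lin v = ?F (lin v) + lin l * sym_const c"
      unfolding subst_lin[OF hom] .
    then show ?case using carrier_const by blast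
  next
    case (add p q)
    then obtain h k where hk: "h \<in> carrier S" "k \<in> carrier S" "p = ?F p + lin l * h" "q = ?F q + lin l * k"
      by blast
    have "p + q = (?F p + lin l * h) + (?F q + lin l * k)"
      using arg_cong2[OF hk(3,4), of "(+)"] .
    also have "\<dots> = (?F p + ?F q) + lin l * (h + k)" by (simp add: algebra_simps)
    finally have "p + q = ?F (p + q) + lin l * (h + k)"
      unfolding subst_add[OF hom add.hyps] .
    then show ?case using hk carrier_add by blast
  next
    case (mult p q)
    then obtain h k where hk: "h \<in> carrier S" "k \<in> carrier S" "p = ?F p + lin l * h" "q = ?F q + lin l * k"
      by blast
    have "p * q = (?F p + lin l * h) * (?F q + lin l * k)"
      using arg_cong2[OF hk(3,4), of "(*)"] .
    also have "\<dots> = ?F p * ?F q + lin l * (h * ?F q + ?F p * k + lin l * (h * k))"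
      by (simp add: algebra_simps)
    finally have "p * q = ?F (p * q) + lin l * (h * ?F q + ?F p * k + lin l * (h * k))"
      unfolding subst_mult[OF hom mult.hyps] .
    then show ?case using hk car mult.hyps by (blast intro!: carrier_intros)
  qed
qed

context
  assumes inf: "infinite (UNIV :: 'a set)"
begin

text \<open>
  If \<open>l\<close> lies in \<open>W\<close>, dividing by it lowers the order along \<open>W\<close> by one; the second hypothesis supplies the extra
  order in exactly that case.
\<close>

lemma divide_by_generic_linear_form:
  assumes W: "subspace W" and U: "l \<in> W \<Longrightarrow> U \<subseteq> W" and "l \<noteq> 0" and h: "h \<in> carrier S"
    and 1: "lin l * h \<in> lin_pow W k" and 2: "U \<subseteq> W \<Longrightarrow> lin l * h \<in> lin_pow W (Suc k)"
  shows "h \<in> lin_pow W k"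
proof (cases "l \<in> W")
  case False
  then show ?thesis
    using lin_pow_cancel[OF inf W lin_carrier h 1] lin_in_lin_ideal_iff[OF W] by blast
next
  case True
  show ?thesis
  proof (cases k)
    case (Suc j)
    have "lin l * h \<in> lin_pow W (1 + j + 1)" using 2[OF U[OF True]] Suc by simp
    moreover have "lin l \<notin> lin_pow W (1 + 1)"
      using lin_notin_lin_square[OF W \<open>l \<noteq> 0\<close>] unfolding one_add_one .
    ultimately have "h \<in> lin_pow W (j + 1)"
      using lin_pow_valuation[OF inf W lin_carrier h, of l 1 j] by blast
    then show ?thesis using Suc by simp
  qed (use h in simp)
qed

text \<open>
  The induction is on the number of spaces plus the sum of their dimensions: projecting along \<open>l\<close>
  lowers the dimension of \<open>V\<^sub>k\<close>, and the quotient by \<open>l\<close> involves one space less. Zero spaces have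
  to be admitted because the projection may create them.
\<close>

lemma in_lin_prod_if_in_lin_pows:
  assumes N: "finite N" and V: "\<And>i. i \<in> N \<Longrightarrow> subspace (V i)" and p: "p \<in> carrier S"
    and pow: "\<And>A. A \<subseteq> N \<Longrightarrow> A \<noteq> {} \<Longrightarrow> p \<in> lin_pow (join V A) (card A)"
  shows "p \<in> lin_prod V N"
  using N V p pow
proof (induction "card N + (\<Sum>i\<in>N. dim (V i))" arbitrary: N V p rule: less_induct)
  case less
  note N = less.prems(1) and V = less.prems(2) and p = less.prems(3) and pow = less.prems(4)
  show ?case
  proof (cases "N = {}")
    case True
    then show ?thesis using p by simp
  next
    case False
    then obtain k where k: "k \<in> N" by blast
    show ?thesis
    proof (cases "V k = {0}")
      case True
      have "p = 0"
        using pow[of "{k}"] k join_singleton[of V k, OF V[OF k]] True lin_pow_1[of "{0}"]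
        by (simp add: lin_ideal_zero)
      then show ?thesis using ideal_0[OF lin_prod_ideal] by simp
    next
      case False
      \<comment> \<open>As \<open>l\<close> avoids \<open>F\<close>, it lies in the join over \<open>A\<close> only if all of \<open>V k\<close> does.\<close>
      define F where "F = {join V A | A. A \<subseteq> N \<and> \<not> V k \<subseteq> join V A}"
      have "F \<subseteq> join V ` Pow N" by (auto simp: F_def)
      then have "finite F" using N finite_subset by blast
      have "\<exists>l\<in>V k. \<forall>X\<in>F. l \<notin> X"
        by (rule subspace_avoids_finite_union[OF inf \<open>finite F\<close> V[OF k]]) (auto simp: F_def)
      then obtain l where l: "l \<in> V k" "\<forall>X\<in>F. l \<notin> X" by blast
      have lA: "V k \<subseteq> join V A" if "A \<subseteq> N" "l \<in> join V A" for A
        using that l(2) unfolding F_def by blast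
      have "join V {} = {0}" by (simp add: join_def)
      then have "l \<noteq> 0" using lA[of "{}"] False subspace_0[OF V[OF k]] by auto
      then obtain \<pi> where \<pi>: "endo \<pi>" "\<pi> l = 0" "\<And>v. \<exists>c. v - \<pi> v = scale c l"
        "\<And>W. subspace W \<Longrightarrow> l \<in> W \<Longrightarrow> l \<notin> \<pi> ` W"
        using line_projection_exists by blast
      define V' where "V' i = \<pi> ` V i" for i
      let ?q = "subst sym_const (\<lambda>v. lin (\<pi> v)) p"
      obtain h1 where h1: "h1 \<in> carrier S" "p = ?q + lin l * h1"
        using subst_line_projection[OF \<pi>(1,3) p] by blast
      have q: "?q \<in> carrier S" using h1 carrier_diff[OF p carrier_mult[OF lin_carrier h1(1)]]
        by (metis add_diff_cancel_right')
      have "?q \<in> lin_prod V' N"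
      proof (rule less.hyps)
        have "(\<Sum>i\<in>N. dim (V' i)) < (\<Sum>i\<in>N. dim (V i))"
        proof (rule sum_strict_mono_ex1[OF N])
          interpret P: finite_dimensional_vector_space_pair_1 scale Basis scale by unfold_locales
          show "\<forall>i\<in>N. dim (V' i) \<le> dim (V i)"
            unfolding V'_def using P.dim_image_le[OF \<pi>(1)] by blast
          show "\<exists>i\<in>N. dim (V' i) < dim (V i)"
            unfolding V'_def
            using dim_image_line_projection_less[OF \<pi>(1,3) V[OF k] l(1) \<pi>(4)] V l(1) k by blast
        qed
        then show "card N + (\<Sum>i\<in>N. dim (V' i)) < card N + (\<Sum>i\<in>N. dim (V i))" by simp
        show "subspace (V' i)" if "i \<in> N" for i
          unfolding V'_def using subspace_image_endo[OF \<pi>(1) V[OF that]] .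
        show "?q \<in> lin_pow (join V' A) (card A)" if "A \<subseteq> N" "A \<noteq> {}" for A
          using lin_pow_subst[OF \<pi>(1) pow[OF that]] join_image[OF \<pi>(1), of V A]
          unfolding V'_def by simp
      qed (fact N q)+
      moreover have "\<exists>v\<in>V i. \<exists>c. v' = v + scale c l" if "v' \<in> V' i" for v' i
      proof -
        obtain v where v: "v \<in> V i" "v' = \<pi> v" using \<open>v' \<in> V' i\<close> by (auto simp: V'_def)
        obtain c where "v - \<pi> v = scale c l" using \<pi>(3) by blast
        then have "v' = v + scale (- c) l" using v(2) by (metis add_diff_cancel_left' diff_add_cancel diff_conv_add_uminus scale_minus_left)
        then show ?thesis using v(1) by blast
      qed
      ultimately obtain g h2 where g: "g \<in> lin_prod V N" and h2: "h2 \<in> carrier S" "?q = g + lin l * h2"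
        using lin_prod_perturb[OF N, of V' V l ?q] by blast
      define h where "h = h1 + h2"
      have h: "h \<in> carrier S" "p = g + lin l * h"
        using h1 h2 by (auto simp: h_def carrier_add algebra_simps)
      have lh: "lin l * h \<in> lin_pow (join V A) (card A)" if "A \<subseteq> N" "A \<noteq> {}" for A
      proof -
        have "g \<in> lin_pow (join V A) (card A)" using g lin_prod_subset_join[OF N that(1)] by blast
        from ideal_diff[OF lin_pow_ideal pow[OF that] this] show ?thesis using h(2) by simp
      qed
      have "h \<in> lin_prod V (N - {k})"
      proof (rule less.hyps)
        have "card (N - {k}) < card N" using N k by (rule card_Diff1_less)
        moreover have "(\<Sum>i\<in>N - {k}. dim (V i)) \<le> (\<Sum>i\<in>N. dim (V i))"
          using N by (intro sum_mono2) auto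
        ultimately show "card (N - {k}) + (\<Sum>i\<in>N - {k}. dim (V i)) < card N + (\<Sum>i\<in>N. dim (V i))"
          by linarith
        show "h \<in> lin_pow (join V A) (card A)" if A: "A \<subseteq> N - {k}" "A \<noteq> {}" for A
        proof (rule divide_by_generic_linear_form[where U = "V k"])
          show "subspace (join V A)" "l \<noteq> 0" "h \<in> carrier S" by (auto simp: h \<open>l \<noteq> 0\<close>)
          show "V k \<subseteq> join V A" if "l \<in> join V A" using lA[OF _ that] A by blast
          show "lin l * h \<in> lin_pow (join V A) (card A)" using lh[of A] A by blast
          have "finite A" "k \<notin> A" using A N finite_subset by auto
          then have "card (insert k A) = Suc (card A)" by simp
          \<comment> \<open>Adding \<open>k\<close> to \<open>A\<close> leaves the join unchanged and raises the exponent.\<close>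
          show "lin l * h \<in> lin_pow (join V A) (Suc (card A))" if kA: "V k \<subseteq> join V A"
          proof -
            have "V i \<subseteq> join V A" if "i \<in> insert k A" for i
              using that kA join_upper[of i A V] by (cases "i = k") auto
            then have "join V (insert k A) \<subseteq> join V A"
              by (intro join_least subspace_join)
            then have "lin_pow (join V (insert k A)) (Suc (card A)) \<subseteq> lin_pow (join V A) (Suc (card A))"
              by (rule lin_pow_mono)
            moreover have "insert k A \<subseteq> N" using A k by blast
            ultimately show ?thesis using lh[of "insert k A"] \<open>card (insert k A) = Suc (card A)\<close> by auto
          qed
        qed
      qed (use N V h in auto)
      then have "lin l * h \<in> lin_prod V (insert k (N - {k}))"
        using N lin_in_lin_ideal[OF l(1)] by (subst lin_prod_insert) (auto intro: prod_in_ideal_prod)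
      then have "lin l * h \<in> lin_prod V N" using k by (simp add: insert_absorb)
      then show ?thesis using g h(2) ideal_add[OF lin_prod_ideal] by simp
    qed
  qed
qed

end

end

section \<open>When a component is needed\<close>

context finite_dimensional_vector_space
begin

lemma det_in_lin_prod:
  assumes A: "A \<in> carrier_mat m m" and g: "inj_on g {..<m}"
    and ent: "\<And>i j. i < m \<Longrightarrow> j < m \<Longrightarrow> A $$ (i, j) \<in> lin_ideal (V (g j))"
  shows "det A \<in> lin_prod V (g ` {..<m})"
  unfolding det_col[OF A]
proof (rule ideal_sum[OF lin_prod_ideal])
  fix p assume "p \<in> {p. p permutes {0..<m}}"
  then have p: "p j < m" if "j < m" for j using that permutes_in_image[of p "{0..<m}" j] by auto
  define F where "F k = A $$ (p (inv_into {..<m} g k), inv_into {..<m} g k)" for k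
  have "(\<Prod>j<m. A $$ (p j, j)) = (\<Prod>k\<in>g ` {..<m}. F k)"
    using g by (simp add: prod.reindex F_def inv_into_f_f)
  also have "\<dots> \<in> lin_prod V (g ` {..<m})"
    using g p ent by (intro prod_in_lin_prod) (auto simp: F_def inv_into_f_f)
  finally have "(\<Prod>j<m. A $$ (p j, j)) \<in> lin_prod V (g ` {..<m})" .
  moreover have "signof p \<in> carrier S"
    by (simp add: sign_def carrier_1 carrier_uminus)
  ultimately show "signof p * (\<Prod>j<m. A $$ (p j, j)) \<in> lin_prod V (g ` {..<m})"
    by (intro ideal_mult lin_prod_ideal)
qed

lemma subst_det:
  assumes hf: "alg_data h f" and A: "A \<in> carrier_mat m m"
    and ent: "\<And>i j. i < m \<Longrightarrow> j < m \<Longrightarrow> A $$ (i, j) \<in> carrier S"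
  shows "subst h f (det A) = det (mat m m (\<lambda>ij. subst h f (A $$ ij)))"
proof -
  have sgn: "signof p \<in> carrier S" "subst h f (signof p) = signof p" for p :: "nat \<Rightarrow> nat"
  proof -
    have "subst h f (- 1) = - 1"
      using subst_add[OF hf carrier_1 carrier_uminus[OF carrier_1]]
      by (simp add: subst_0[OF hf] subst_1[OF hf] eq_neg_iff_add_eq_0 add.commute)
    then show "signof p \<in> carrier S" "subst h f (signof p) = signof p"
      by (simp_all add: sign_def carrier_1 carrier_uminus subst_1[OF hf])
  qed
  have P: "p j < m" if "p permutes {0..<m}" "j < m" for p j
    using that permutes_in_image[of p "{0..<m}" j] by auto
  have pr: "(\<Prod>i = 0..<m. A $$ (i, p i)) \<in> carrier S"
    "subst h f (\<Prod>i = 0..<m. A $$ (i, p i)) = (\<Prod>i = 0..<m. subst h f (A $$ (i, p i)))"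
    if "p permutes {0..<m}" for p
    using P[OF that] ent by (auto intro!: carrier_prod subst_prod[OF hf])
  have "subst h f (det A) = (\<Sum>p\<in>{p. p permutes {0..<m}}.
      subst h f (signof p * (\<Prod>i = 0..<m. A $$ (i, p i))))"
    unfolding det_def'[OF A] using sgn pr by (intro subst_sum[OF hf] carrier_mult) auto
  also have "\<dots> = (\<Sum>p\<in>{p. p permutes {0..<m}}. signof p * (\<Prod>i = 0..<m. subst h f (A $$ (i, p i))))"
    using sgn pr by (intro sum.cong) (simp_all add: subst_mult[OF hf])
  also have "\<dots> = det (mat m m (\<lambda>ij. subst h f (A $$ ij)))"
    using P by (subst det_def'[of _ m]) (auto intro!: sum.cong arg_cong2[of _ _ _ _ "(*)"] prod.cong)
  finally show ?thesis .
qed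

text \<open>
  The differences \<open>u\<^sub>i - u\<^sub>z\<close> lie in the hyperplane, hence are sums of vectors \<open>x\<^sub>i\<^sub>k\<close> of the sections. For
  \<open>i \<noteq> z\<close> the vectors \<open>x\<^sub>i\<^sub>k - \<delta>\<^sub>i\<^sub>k u\<^sub>i\<close>, completed by \<open>x\<^sub>i\<^sub>z + u\<^sub>z\<close> for \<open>k = z\<close>, have zero row sums. The minor
  without column \<open>z\<close> therefore does not change when one of its columns is replaced by the negative of
  column \<open>z\<close>, so it lies in each product with one factor left out. Evaluated at \<open>\<phi>\<close> the matrix is minus the
  identity, so the minor has order \<open>card N - 1\<close> and not more.
\<close>

lemma socle_element_exists:
  assumes N: "finite N" "N \<noteq> {}" and V: "\<And>i. i \<in> N \<Longrightarrow> subspace (V i)"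
    and \<phi>: "functional \<phi>" "\<forall>i\<in>N. \<exists>u\<in>V i. \<phi> u \<noteq> 0"
      "join V N \<inter> {v. \<phi> v = 0} \<subseteq> join (\<lambda>i. V i \<inter> {v. \<phi> v = 0}) N"
  shows "\<exists>f\<in>carrier S. (\<forall>k\<in>N. f \<in> lin_prod V (N - {k})) \<and> f \<notin> lin_pow (join V N) (card N)"
proof -
  have "\<exists>u. u \<in> V i \<and> \<phi> u = 1" if i: "i \<in> N" for i
  proof -
    obtain u where u: "u \<in> V i" "\<phi> u \<noteq> 0" using \<phi>(2) i by blast
    then have "scale (inverse (\<phi> u)) u \<in> V i" "\<phi> (scale (inverse (\<phi> u)) u) = 1"
      using subspace_scale[OF V[OF i]] \<phi>(1) by (auto simp: functional_iff)
    then show ?thesis by blast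
  qed
  then obtain u where "\<forall>i\<in>N. u i \<in> V i \<and> \<phi> (u i) = 1" by metis
  then have u: "\<And>i. i \<in> N \<Longrightarrow> u i \<in> V i" "\<And>i. i \<in> N \<Longrightarrow> \<phi> (u i) = 1" by blast+
  have "card N \<noteq> 0" using N by simp
  then obtain m where m: "card N = Suc m" using not0_implies_Suc by blast
  obtain g where g: "bij_betw g {0..<card N} N" using ex_bij_betw_nat_finite[OF N(1)] by blast
  define z where "z = g 0"
  define e where "e j = g (Suc j)" for j
  have zN: "z \<in> N" and eN: "\<And>j. j < m \<Longrightarrow> e j \<in> N"
    using bij_betwE[OF g] m unfolding z_def e_def by auto
  have inj: "inj_on g {0..<Suc m}" using g m by (simp add: bij_betw_def)
  have e_inj: "inj_on e {..<m}"
    by (rule inj_onI) (use inj_onD[OF inj] in \<open>force simp: e_def\<close>)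
  have e_ne: "e j \<noteq> z" if "j < m" for j
    using inj_onD[OF inj, of "Suc j" 0] that unfolding e_def z_def by auto
  have Nz: "N = insert z (e ` {..<m})"
  proof -
    have "{0..<Suc m} = insert 0 (Suc ` {..<m})"
      by (auto simp: image_iff less_Suc_eq_0_disj)
    then have "g ` {0..<Suc m} = insert z (e ` {..<m})"
      by (auto simp: z_def e_def)
    then show ?thesis using g m by (simp add: bij_betw_def)
  qed
  have "\<exists>x. (\<forall>k\<in>N. x k \<in> V k \<inter> {v. \<phi> v = 0}) \<and> u i - u z = (\<Sum>k\<in>N. x k)" if i: "i \<in> N" for i
  proof (rule in_joinE[OF N(1)])
    show "subspace (V k \<inter> {v. \<phi> v = 0})" if "k \<in> N" for k
      using V[OF that] subspace_kernel_functional[OF \<phi>(1)] subspace_inter by blast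
    have "u i \<in> join V N" "u z \<in> join V N" using u(1)[OF i] u(1)[OF zN] join_upper[OF i, of V] join_upper[OF zN, of V] by auto
    then have "u i - u z \<in> join V N \<inter> {v. \<phi> v = 0}"
      using u(2) i zN subspace_diff[OF subspace_join] by (auto simp: functional_diff[OF \<phi>(1)])
    then show "u i - u z \<in> join (\<lambda>i. V i \<inter> {v. \<phi> v = 0}) N" using \<phi>(3) by blast
  qed
  then obtain x where "\<forall>i\<in>N. (\<forall>k\<in>N. x i k \<in> V k \<inter> {v. \<phi> v = 0}) \<and> u i - u z = (\<Sum>k\<in>N. x i k)"
    by metis
  then have x: "\<And>i k. i \<in> N \<Longrightarrow> k \<in> N \<Longrightarrow> x i k \<in> V k" "\<And>i k. i \<in> N \<Longrightarrow> k \<in> N \<Longrightarrow> \<phi> (x i k) = 0"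
    "\<And>i. i \<in> N \<Longrightarrow> u i - u z = (\<Sum>k\<in>N. x i k)" by auto
  define a where "a i j = x (e i) (e j) - (if i = j then u (e i) else 0)" for i j
  define A where "A = mat m m (\<lambda>(i, j). lin (a i j))"
  have A: "A \<in> carrier_mat m m" by (simp add: A_def)
  have aV: "a i j \<in> V (e j)" if "i < m" "j < m" for i j
    using x(1)[OF eN eN] u(1)[OF eN] V[OF eN] that subspace_diff[of "V (e j)"]
    by (auto simp: a_def)
  have \<phi>a: "\<phi> (a i j) = (if i = j then - 1 else 0)" if "i < m" "j < m" for i j
    using x(2)[OF eN eN] u(2)[OF eN] that by (simp add: a_def functional_diff[OF \<phi>(1)] functional_0[OF \<phi>(1)])
  have row: "(\<Sum>j<m. a i j) = - (u z + x (e i) z)" if "i < m" for i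
  proof -
    have "u (e i) - u z = x (e i) z + (\<Sum>k\<in>e ` {..<m}. x (e i) k)"
      using x(3)[OF eN[OF that]] e_ne by (subst (asm) Nz) (auto simp: sum.insert_if)
    also have "(\<Sum>k\<in>e ` {..<m}. x (e i) k) = (\<Sum>j<m. x (e i) (e j))"
      using e_inj by (simp add: sum.reindex)
    finally have "(\<Sum>j<m. x (e i) (e j)) = u (e i) - u z - x (e i) z" by (simp add: algebra_simps)
    moreover have "(\<Sum>j<m. if i = j then u (e i) else 0) = u (e i)" using that by simp
    ultimately show ?thesis by (simp add: a_def sum_subtractf algebra_simps)
  qed
  have lin_sum: "lin (\<Sum>j\<in>J. b j) = (\<Sum>j\<in>J. lin (b j))" for J :: "nat set" and b
    by (induction J rule: infinite_finite_induct) (simp_all add: lin_0 lin_add)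
  have "det A \<in> lin_prod V (e ` {..<m})"
    using A e_inj by (rule det_in_lin_prod) (simp add: A_def lin_in_lin_ideal aV)
  moreover have "N - {z} = e ` {..<m}" using Nz e_ne by auto
  ultimately have detz: "det A \<in> lin_prod V (N - {z})" by simp
  have detk: "det A \<in> lin_prod V (N - {e k})" if k: "k < m" for k
  proof -
    \<comment> \<open>The matrix times the all-ones vector is the vector of row sums, that is, the negative of column
      \<open>z\<close>; Cramer's rule for it is the replacement of a column.\<close>
    define w where "w = vec m (\<lambda>_. 1 :: ('b \<Rightarrow>\<^sub>0 nat) \<Rightarrow>\<^sub>0 'a)"
    have w: "w \<in> carrier_vec m" by (simp add: w_def)
    define g' where "g' j = (if j = k then z else e j)" for j
    have "det (replace_col A (A *\<^sub>v w) k) \<in> lin_prod V (g' ` {..<m})"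
    proof (rule det_in_lin_prod)
      show "replace_col A (A *\<^sub>v w) k \<in> carrier_mat m m" using A by (simp add: replace_col_def)
      show "inj_on g' {..<m}"
        using e_inj e_ne by (auto simp: g'_def inj_on_def)
      fix i j assume ij: "i < m" "j < m"
      have "(A *\<^sub>v w) $ i = (\<Sum>j<m. lin (a i j))"
        using ij A by (simp add: w_def A_def scalar_prod_def atLeast0LessThan)
      also have "\<dots> = lin (- (u z + x (e i) z))" by (simp only: lin_sum[symmetric] row[OF ij(1)])
      finally have "(A *\<^sub>v w) $ i = lin (- (u z + x (e i) z))" .
      moreover have "- (u z + x (e i) z) \<in> V z"
        using x(1)[OF eN[OF ij(1)] zN] u(1)[OF zN] V[OF zN] subspace_add subspace_neg by blast
      ultimately show "replace_col A (A *\<^sub>v w) k $$ (i, j) \<in> lin_ideal (V (g' j))"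
        using ij A aV[OF ij] by (auto simp: replace_col_def g'_def A_def lin_in_lin_ideal)
    qed
    moreover have "det (replace_col A (A *\<^sub>v w) k) = det A"
      using cramer_lemma_mat[OF A w k] k by (simp add: w_def)
    moreover have "g' ` {..<m} = N - {e k}"
    proof -
      have "g' ` {..<m} = insert z (e ` ({..<m} - {k}))"
        using k by (auto simp: g'_def)
      also have "e ` ({..<m} - {k}) = e ` {..<m} - {e k}"
        using e_inj k by (subst inj_on_image_set_diff[OF e_inj]) auto
      finally show ?thesis using Nz e_ne[OF k] by auto
    qed
    ultimately show ?thesis by simp
  qed
  have all: "det A \<in> lin_prod V (N - {k})" if "k \<in> N" for k
    using that detz detk Nz by auto
  have "det A \<notin> lin_pow (join V N) (card N)"
  proof
    assume "det A \<in> lin_pow (join V N) (card N)"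
    obtain \<pi> where \<pi>: "endo \<pi>" "\<forall>v. \<pi> v \<in> join V N" "\<forall>w\<in>join V N. \<pi> w = w"
      using projection_exists[OF subspace_join] by blast
    note hom = alg_data_graded[OF alg_data_functional[OF \<phi>(1)] \<pi>(1)]
    have ent: "graded_subst (\<lambda>c. c) \<phi> \<pi> (lin (a i j)) = (if i = j then [:0, - 1:] else 0)"
      if "i < m" "j < m" for i j
    proof -
      have "\<pi> (a i j) = a i j" using \<pi>(3) aV[OF that] join_upper[OF eN[OF that(2)], of V] by blast
      then show ?thesis
        using \<phi>a[OF that]
        by (simp add: graded_subst_simps(4)[OF alg_data_functional[OF \<phi>(1)] \<pi>(1)] functional_0[OF \<phi>(1)])
    qed
    have m1: "[:- 1 :: 'a:] = - 1" by (simp add: one_pCons)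
    have "graded_subst (\<lambda>c. c) \<phi> \<pi> (det A) = det (mat m m (\<lambda>ij. graded_subst (\<lambda>c. c) \<phi> \<pi> (A $$ ij)))"
      unfolding graded_subst_def by (rule subst_det[OF hom A]) (simp add: A_def lin_carrier)
    also have "mat m m (\<lambda>ij. graded_subst (\<lambda>c. c) \<phi> \<pi> (A $$ ij)) = [:0, - 1:] \<cdot>\<^sub>m 1\<^sub>m m"
      by (rule eq_matI) (auto simp: A_def ent m1)
    also have "det \<dots> = [:0, - 1:] ^ m" by simp
    also have "\<dots> = monom ((- 1) ^ m) m"
      by (simp add: monom_power flip: monom_0 monom_Suc)
    finally have "coeff (graded_subst (\<lambda>c. c) \<phi> \<pi> (det A)) m \<noteq> 0" by simp
    moreover have "monom 1 (Suc m) dvd graded_subst (\<lambda>c. c) \<phi> \<pi> (det A)"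
      using lin_pow_graded_subst_dvd[OF alg_data_functional[OF \<phi>(1)] \<pi>(1,3)]
        \<open>det A \<in> lin_pow (join V N) (card N)\<close> m by simp
    ultimately show False by (simp add: monom_1_dvd_iff')
  qed
  moreover have "det A \<in> carrier S" using detz ideal_carrier[OF lin_prod_ideal] by blast
  ultimately show ?thesis using all by blast
qed

lemma dim_span_UN_le:
  assumes "finite P" "\<And>C. C \<in> P \<Longrightarrow> subspace (X C)"
  shows "dim (span (\<Union>C\<in>P. X C)) \<le> (\<Sum>C\<in>P. dim (X C))"
  using assms
proof (induction P rule: finite_induct)
  case (insert C P)
  have "span (\<Union>D\<in>insert C P. X D) = {x + y | x y. x \<in> span (X C) \<and> y \<in> span (\<Union>D\<in>P. X D)}"
    by (simp add: span_Un)
  then have "dim (span (\<Union>D\<in>insert C P. X D)) \<le> dim (span (X C)) + dim (span (\<Union>D\<in>P. X D))"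
    using dim_sums_Int[OF subspace_span[of "X C"] subspace_span[of "\<Union>D\<in>P. X D"]] by simp
  then show ?case using insert by simp
qed simp

lemma dim_Int_kernel:
  assumes W: "subspace W" and \<phi>: "functional \<phi>" and u: "u \<in> W" "\<phi> u \<noteq> 0"
  shows "dim (W \<inter> {v. \<phi> v = 0}) + 1 = dim W"
proof -
  let ?H = "W \<inter> {v. \<phi> v = 0}"
  have H: "subspace ?H" using W subspace_kernel_functional[OF \<phi>] subspace_inter by blast
  have "W \<subseteq> span (insert u ?H)"
  proof
    fix w assume w: "w \<in> W"
    have "w - scale (\<phi> w / \<phi> u) u \<in> ?H"
      using w u subspace_diff[OF W] subspace_scale[OF W] \<phi>
      by (auto simp: functional_diff[OF \<phi>]) (simp add: functional_iff)
    then have "w - scale (\<phi> w / \<phi> u) u \<in> span ?H" by (rule span_base)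
    then show "w \<in> span (insert u ?H)" using span_breakdown_eq by blast
  qed
  moreover have "span (insert u ?H) \<subseteq> W" using u W by (intro span_minimal) auto
  ultimately have "dim W = dim (insert u ?H)" by (metis dim_span subset_antisym)
  moreover have "u \<notin> span ?H" using u(2) H by (simp add: span_eq_iff[THEN iffD2])
  ultimately show ?thesis by (simp add: dim_insert)
qed

text \<open>
  The section of the span of each block of the partition loses one dimension. All the sections
  \<open>V\<^sub>i \<inter> H\<close> lie in the sum of these, whose dimension is at most \<open>\<Sum>(rk C - 1)\<close>, too small for \<open>V\<^sub>N \<inter> H\<close>.
\<close>

lemma hyperplane_section_deficient:
  assumes N: "finite N" "N \<noteq> {}" and P: "partition_on N P"
    and rk: "(\<Sum>C\<in>P. arr_rk scale V C - 1) < arr_rk scale V N - 1"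
    and \<phi>: "functional \<phi>" and u: "\<And>i. i \<in> N \<Longrightarrow> u i \<in> V i" "\<And>i. i \<in> N \<Longrightarrow> \<phi> (u i) \<noteq> 0"
  shows "\<exists>z\<in>join V N. \<phi> z = 0 \<and> z \<notin> join (\<lambda>i. V i \<inter> {v. \<phi> v = 0}) N"
proof (rule ccontr)
  assume neg: "\<not> ?thesis"
  define H where "H = {v. \<phi> v = 0}"
  have H: "subspace H" unfolding H_def by (rule subspace_kernel_functional[OF \<phi>])
  have fP: "finite P" using finite_elements[OF N(1) P] .
  have PN: "\<Union>P = N" "{} \<notin> P" using P by (auto simp: partition_on_def)
  have sub: "subspace (join V C \<inter> H)" for C using H subspace_join subspace_inter by blast
  have step: "dim (join V C \<inter> H) + 1 = dim (join V C)" if C: "C \<subseteq> N" "C \<noteq> {}" for C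
  proof -
    obtain i where i: "i \<in> C" using C by blast
    then have "u i \<in> join V C" "\<phi> (u i) \<noteq> 0" using u C(1) join_upper[OF i, of V] by auto
    then show ?thesis using dim_Int_kernel[OF subspace_join \<phi>] unfolding H_def by blast
  qed
  have "join (\<lambda>i. V i \<inter> H) N \<subseteq> span (\<Union>C\<in>P. join V C \<inter> H)"
  proof (rule join_least[OF subspace_span])
    fix i assume "i \<in> N"
    then obtain C where C: "C \<in> P" "i \<in> C" using PN(1) by blast
    then have "V i \<inter> H \<subseteq> (\<Union>C\<in>P. join V C \<inter> H)" using join_upper[OF C(2), of V] by blast
    then show "V i \<inter> H \<subseteq> span (\<Union>C\<in>P. join V C \<inter> H)" using span_superset by blast
  qed
  then have "join V N \<inter> H \<subseteq> span (\<Union>C\<in>P. join V C \<inter> H)" using neg by (auto simp: H_def)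
  then have "dim (join V N \<inter> H) \<le> dim (span (\<Union>C\<in>P. join V C \<inter> H))" by (rule dim_subset)
  also have "\<dots> \<le> (\<Sum>C\<in>P. dim (join V C \<inter> H))" using fP sub by (rule dim_span_UN_le)
  finally have "int (dim (join V N \<inter> H)) \<le> (\<Sum>C\<in>P. int (dim (join V C \<inter> H)))"
    by (simp flip: of_nat_sum)
  also have "\<dots> = (\<Sum>C\<in>P. arr_rk scale V C - 1)"
  proof (rule sum.cong[OF refl])
    fix C assume "C \<in> P"
    then have "C \<subseteq> N" "C \<noteq> {}" using PN by auto
    from step[OF this] show "int (dim (join V C \<inter> H)) = arr_rk scale V C - 1"
      by (simp add: arr_rk_join)
  qed
  finally show False using rk step[OF subset_refl N(2)] by (simp add: arr_rk_join)
qed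

text \<open>
  Multiplying \<open>p\<close> by the linear forms \<open>u\<^sub>i\<close> turns the two demands on \<open>\<phi>\<close> into one: each factor raises the order
  by exactly one, and a functional detecting the order of the product cannot kill any of the factors.
\<close>

lemma generic_functional_exists:
  assumes inf: "infinite (UNIV :: 'a set)" and W: "subspace W"
    and \<pi>: "endo \<pi>" "\<forall>v. \<pi> v \<in> W" "\<forall>w\<in>W. \<pi> w = w"
    and p: "p \<in> carrier S" "p \<notin> lin_pow W n"
    and N: "finite N" and u: "\<And>i. i \<in> N \<Longrightarrow> u i \<in> W" "\<And>i. i \<in> N \<Longrightarrow> u i \<noteq> 0"
  shows "\<exists>\<phi>. functional \<phi> \<and> (\<forall>i\<in>N. \<phi> (u i) \<noteq> 0) \<and> \<not> monom 1 n dvd graded_subst (\<lambda>c. c) \<phi> \<pi> p"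
proof -
  have n: "n \<noteq> 0" using p by (cases n) auto
  have "p * (\<Prod>i\<in>A. lin (u i)) \<notin> lin_pow W (n + card A)" if "A \<subseteq> N" for A
    using finite_subset[OF that N] that
  proof (induction A rule: finite_induct)
    case empty
    then show ?case using p by simp
  next
    case (insert i A)
    let ?r = "p * (\<Prod>i\<in>A. lin (u i))"
    have r: "?r \<in> carrier S" using p by (intro carrier_intros)
    have ih: "?r \<notin> lin_pow W (n + card A)" using insert by blast
    show ?case
    proof
      assume "p * (\<Prod>i\<in>insert i A. lin (u i)) \<in> lin_pow W (n + card (insert i A))"
      then have "?r * lin (u i) \<in> lin_pow W ((n + card A - 1) + 1 + 1)"
        using insert.hyps n by (simp add: mult_ac)
      then have "?r \<in> lin_pow W ((n + card A - 1) + 1) \<or> lin (u i) \<in> lin_pow W (1 + 1)"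
        by (rule lin_pow_valuation[OF inf W r lin_carrier])
      moreover have "lin (u i) \<notin> lin_pow W (1 + 1)"
        using lin_notin_lin_square[OF W u(2)] insert.prems unfolding one_add_one by blast
      ultimately show False using ih n by simp
    qed
  qed
  then have "p * (\<Prod>i\<in>N. lin (u i)) \<notin> lin_pow W (n + card N)" by blast
  moreover have pr: "(\<Prod>i\<in>N. lin (u i)) \<in> carrier S" by (intro carrier_intros)
  ultimately obtain \<phi> where \<phi>: "functional \<phi>"
    "\<not> monom 1 (n + card N) dvd graded_subst (\<lambda>c. c) \<phi> \<pi> (p * (\<Prod>i\<in>N. lin (u i)))"
    using lin_pow_iff_graded_subst[OF inf \<pi> carrier_mult[OF p(1) pr]] by blast
  let ?F = "graded_subst (\<lambda>c. c) \<phi> \<pi>"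
  note hom = alg_data_functional[OF \<phi>(1)]
  note F = graded_subst_simps[OF hom \<pi>(1)]
  have "?F (\<Prod>i\<in>N. lin (u i)) = (\<Prod>i\<in>N. ?F (lin (u i)))"
    unfolding graded_subst_def by (intro subst_prod[OF alg_data_graded[OF hom \<pi>(1)]] lin_carrier)
  also have "\<dots> = (\<Prod>i\<in>N. monom (\<phi> (u i)) 1)"
    using u(1) \<pi>(3) by (intro prod.cong) (auto simp: F functional_0[OF \<phi>(1)] monom_Suc monom_0)
  also have "\<dots> = monom (\<Prod>i\<in>N. \<phi> (u i)) (card N)"
    using N by (induction N rule: finite_induct) (simp_all add: mult_monom monom_0 one_pCons)
  finally have *: "?F (p * (\<Prod>i\<in>N. lin (u i))) = ?F p * monom (\<Prod>i\<in>N. \<phi> (u i)) (card N)"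
    by (simp add: F(2) p pr)
  have "(\<Prod>i\<in>N. \<phi> (u i)) \<noteq> 0"
  proof
    assume "(\<Prod>i\<in>N. \<phi> (u i)) = 0"
    then show False using \<phi>(2) unfolding * by simp
  qed
  moreover have "\<not> monom 1 n dvd ?F p"
  proof
    assume "monom 1 n dvd ?F p"
    moreover have "monom 1 (card N) dvd monom (\<Prod>i\<in>N. \<phi> (u i)) (card N)"
      by (simp add: monom_1_dvd_iff')
    ultimately have "monom 1 n * monom 1 (card N) dvd ?F p * monom (\<Prod>i\<in>N. \<phi> (u i)) (card N)"
      by (rule mult_dvd_mono)
    then show False using \<phi>(2) unfolding * by (simp add: mult_monom)
  qed
  ultimately show ?thesis using \<phi>(1) N by auto
qed

lemma dvd_cancel_power_X:
  fixes p q :: "'c::idom poly"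
  assumes "[:0, 1:] ^ m dvd p * q" "poly p 0 \<noteq> 0"
  shows "[:0, 1:] ^ m dvd q"
proof (cases "q = 0")
  case False
  have "p \<noteq> 0" using assms(2) by auto
  moreover have X: "[:0, 1:] ^ m = monom (1 :: 'c) m" by (simp add: monom_altdef)
  ultimately have "m \<le> Polynomial.order 0 p + Polynomial.order 0 q"
    using assms(1) False by (simp add: monom_1_dvd_iff order_mult X)
  then show ?thesis using assms(2) False by (simp add: X monom_1_dvd_iff order_root order_0I)
qed simp

text \<open>
  With \<open>z\<close> in the hyperplane \<open>\<phi> = 0\<close> but outside the span of the sections, choose \<open>\<psi>\<close> vanishing on the
  sections with \<open>\<psi> z = 1\<close>, and substitute \<open>\<phi> s + \<psi> t\<close> on \<open>W\<close>; here \<open>s\<close> is the inner and \<open>t\<close> the outer variable.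
  Then \<open>V\<^sub>i\<close> becomes the line of multiples of \<open>L\<^sub>i = s + c\<^sub>i t\<close>, and \<open>z\<close> becomes \<open>t\<close>. So \<open>t\<^sup>m\<close> times the image of \<open>p\<close> is a
  multiple of \<open>\<Prod>L\<^sub>i\<close>, which is prime to \<open>t\<close>, and hence the image of \<open>p\<close> is itself such a multiple. At
  \<open>t = 0\<close> this gives \<open>p\<close> order at least \<open>card N\<close> at \<open>\<phi>\<close>, which was chosen
  to witness a smaller order.
\<close>

lemma in_lin_pow_if_saturated:
  assumes inf: "infinite (UNIV :: 'a set)" and N: "finite N" "N \<noteq> {}"
    and V: "\<And>i. i \<in> N \<Longrightarrow> subspace (V i)" "\<And>i. i \<in> N \<Longrightarrow> V i \<noteq> {0}"
    and P: "partition_on N P" and rk: "(\<Sum>C\<in>P. arr_rk scale V C - 1) < arr_rk scale V N - 1"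
    and p: "p \<in> carrier S" and sat: "\<And>z. z \<in> join V N \<Longrightarrow> \<exists>m. lin z ^ m * p \<in> lin_prod V N"
  shows "p \<in> lin_pow (join V N) (card N)"
proof (rule ccontr)
  assume neg: "\<not> ?thesis"
  define W where "W = join V N"
  have W: "subspace W" by (simp add: W_def)
  obtain \<pi> where \<pi>: "endo \<pi>" "\<forall>v. \<pi> v \<in> W" "\<forall>w\<in>W. \<pi> w = w"
    using projection_exists[OF W] by blast
  have "\<exists>u. u \<in> V i \<and> u \<noteq> 0" if "i \<in> N" for i
    using subspace_0[OF V(1)[OF that]] V(2)[OF that] by blast
  then obtain u where u: "\<And>i. i \<in> N \<Longrightarrow> u i \<in> V i" "\<And>i. i \<in> N \<Longrightarrow> u i \<noteq> 0" by metis
  have VW: "v \<in> W" if "i \<in> N" "v \<in> V i" for i v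
    using that join_upper[of i N V] unfolding W_def by blast
  obtain \<phi> where \<phi>: "functional \<phi>" "\<forall>i\<in>N. \<phi> (u i) \<noteq> 0"
    "\<not> monom 1 (card N) dvd graded_subst (\<lambda>c. c) \<phi> \<pi> p"
    using generic_functional_exists[OF inf W \<pi> p _ N(1), of "card N" u] neg u VW unfolding W_def by blast
  obtain z where z: "z \<in> W" "\<phi> z = 0" "z \<notin> join (\<lambda>i. V i \<inter> {v. \<phi> v = 0}) N"
    using hyperplane_section_deficient[OF N P rk \<phi>(1), of u] u(1) \<phi>(2) unfolding W_def by blast
  obtain \<psi> where \<psi>: "functional \<psi>" "\<psi> z = 1" "\<forall>w\<in>join (\<lambda>i. V i \<inter> {v. \<phi> v = 0}) N. \<psi> w = 0"
    using functional_exists[OF subspace_join z(3)] by blast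
  define \<alpha> :: "'b \<Rightarrow> 'a poly poly" where "\<alpha> v = [:[:\<phi> (v - \<pi> v), \<phi> (\<pi> v):], [:\<psi> (\<pi> v):]:]" for v
  note hom = alg_data_functional[OF \<phi>(1)]
  have \<alpha>: "alg_data (\<lambda>c. [:[:c:]:]) \<alpha>"
    using alg_data_graded[OF hom \<pi>(1)] \<psi>(1) \<pi>(1)
    by (simp add: alg_data_def \<alpha>_def functional_iff endo_iff one_pCons)
  let ?E = "subst (\<lambda>c. [:[:c:]:]) \<alpha>"
  have \<alpha>0: "poly (\<alpha> v) 0 = [:\<phi> (v - \<pi> v), \<phi> (\<pi> v):]" for v by (simp add: \<alpha>_def)
  have E0: "poly (?E q) 0 = graded_subst (\<lambda>c. c) \<phi> \<pi> q" if "q \<in> carrier S" for q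
    using that
    by (induction q rule: carrier_induct)
      (simp_all add: subst_simps[OF \<alpha>] graded_subst_simps[OF hom \<pi>(1)] \<alpha>0)
  define L where "L i = [:[:0, 1:], [:\<psi> (u i) / \<phi> (u i):]:]" for i
  have EL: "?E (lin v) = [:[:\<phi> v:]:] * L i" if i: "i \<in> N" and v: "v \<in> V i" for i v
  proof -
    define c where "c = \<phi> v / \<phi> (u i)"
    have "v - scale c (u i) \<in> V i \<inter> {v. \<phi> v = 0}"
      using v u(1)[OF i] V(1)[OF i] \<phi>(2) i subspace_diff subspace_scale \<phi>(1)
      by (auto simp: functional_diff[OF \<phi>(1)] c_def) (simp add: functional_iff)
    then have "v - scale c (u i) \<in> join (\<lambda>i. V i \<inter> {v. \<phi> v = 0}) N"
      using join_upper[OF i, of "\<lambda>i. V i \<inter> {v. \<phi> v = 0}"] by blast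
    then have "\<psi> (v - scale c (u i)) = 0" using \<psi>(3) by blast
    then have "\<psi> v = c * \<psi> (u i)"
      using \<psi>(1) by (simp add: functional_diff) (simp add: functional_iff)
    moreover have "\<pi> v = v" using \<pi>(3) VW[OF i v] by blast
    ultimately show ?thesis
      using functional_0[OF \<phi>(1)] by (simp only: subst_lin[OF \<alpha>]) (simp add: \<alpha>_def L_def c_def)
  qed
  have pre: "ideal {q \<in> carrier S. d dvd ?E q} S" for d
    by (rule idealI_carrier) (auto simp: subst_simps[OF \<alpha>] subst_0[OF \<alpha>] carrier_intros)
  have "lin_prod V A \<subseteq> {q \<in> carrier S. (\<Prod>i\<in>A. L i) dvd ?E q}" if "A \<subseteq> N" for A
    using finite_subset[OF that N(1)] that
  proof (induction A rule: finite_induct)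
    case (insert i A)
    have "lin_ideal (V i) \<subseteq> {q \<in> carrier S. L i dvd ?E q}"
      using EL[of i] insert.prems by (intro lin_ideal_least pre) (auto simp: lin_carrier intro: dvd_smult)
    then have "a * b \<in> {q \<in> carrier S. L i * (\<Prod>i\<in>A. L i) dvd ?E q}"
      if "a \<in> lin_ideal (V i)" "b \<in> lin_prod V A" for a b
      using that insert.IH insert.prems by (auto simp: subset_eq subst_mult[OF \<alpha>] carrier_mult intro!: mult_dvd_mono)
    then show ?case
      unfolding lin_prod_insert[OF insert.hyps] prod.insert[OF insert.hyps]
      by (intro ideal_prod_least pre)
  qed simp
  then have div: "(\<Prod>i\<in>N. L i) dvd ?E q" if "q \<in> lin_prod V N" for q using that by blast
  obtain m where m: "lin z ^ m * p \<in> lin_prod V N" using sat z(1) unfolding W_def by blast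
  have "?E (lin z) = [:0, 1:]"
    using z \<psi>(2) \<pi>(3) functional_0[OF \<phi>(1)] by (simp only: subst_lin[OF \<alpha>]) (simp add: \<alpha>_def one_pCons)
  then have "?E (lin z ^ m * p) = [:0, 1:] ^ m * ?E p"
    by (simp add: subst_mult[OF \<alpha>] subst_power[OF \<alpha>] carrier_intros p)
  then obtain a where a: "[:0, 1:] ^ m * ?E p = (\<Prod>i\<in>N. L i) * a" using div[OF m] by (auto elim: dvdE)
  have L0: "poly (\<Prod>i\<in>N. L i) 0 = monom 1 (card N)"
    by (simp add: poly_prod L_def monom_altdef)
  have "[:0, 1:] ^ m dvd a"
    using dvd_cancel_power_X[of m "\<Prod>i\<in>N. L i" a] L0 a by (metis dvd_triv_left monom_eq_0_iff zero_neq_one)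
  then obtain b where "a = [:0, 1:] ^ m * b" by (auto elim: dvdE)
  then have "[:0, 1:] ^ m * ?E p = [:0, 1:] ^ m * ((\<Prod>i\<in>N. L i) * b)" using a by (simp add: mult_ac)
  then have "?E p = (\<Prod>i\<in>N. L i) * b" by simp
  then have "graded_subst (\<lambda>c. c) \<phi> \<pi> p = monom 1 (card N) * poly b 0"
    using E0[OF p] L0 by simp
  then show False using \<phi>(3) by simp
qed

end

section \<open>Flats, the Dilworth truncation and associated primes\<close>

lemma irredundant_primary_decomposition_cong:
  assumes "\<And>i. i \<in> T \<Longrightarrow> Q i = Q' i"
  shows "irredundant_primary_decomposition R J T Q = irredundant_primary_decomposition R J T Q'"
proof -
  have "(\<Inter>i\<in>T. Q i) = (\<Inter>i\<in>T. Q' i)" "(\<Inter>i\<in>T - {j}. Q i) = (\<Inter>i\<in>T - {j}. Q' i)" for j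
    using assms by auto
  moreover have "inj_on (\<lambda>i. radical_ideal R (Q i)) T = inj_on (\<lambda>i. radical_ideal R (Q' i)) T"
    using assms by (intro inj_on_cong) simp
  ultimately show ?thesis using assms by (simp add: irredundant_primary_decomposition_def)
qed

lemma (in cring) ass_quotient_iff:
  assumes "ideal J R"
  shows "P \<in> ass_quotient R J \<longleftrightarrow>
    primeideal P R \<and> (\<exists>y\<in>carrier R. P = {a \<in> carrier R. a \<otimes> y \<in> J})"
proof -
  interpret J: ideal J R by fact
  have zero: "J +> x = J \<longleftrightarrow> x \<in> J" if "x \<in> carrier R" for x
    using J.rcos_const_imp_mem[OF that] a_rcos_zero[OF assms] by blast
  have "(J +> a) \<otimes>\<^bsub>R Quot J\<^esub> (J +> y) = J +> (a \<otimes> y)"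
    if "a \<in> carrier R" "y \<in> carrier R" for a y
    using J.rcoset_mult_add[OF that] by (simp add: FactRing_def)
  moreover have "\<zero>\<^bsub>R Quot J\<^esub> = J" by (simp add: FactRing_def)
  ultimately have "{a \<in> carrier R. (J +> a) \<otimes>\<^bsub>R Quot J\<^esub> (J +> y) = \<zero>\<^bsub>R Quot J\<^esub>}
      = {a \<in> carrier R. a \<otimes> y \<in> J}" if "y \<in> carrier R" for y
    using that zero by (metis (no_types, lifting) m_closed)
  moreover have "carrier (R Quot J) = (\<lambda>y. J +> y) ` carrier R"
    by (auto simp: FactRing_simps)
  ultimately have "(\<exists>x\<in>carrier (R Quot J). P = {a \<in> carrier R. (J +> a) \<otimes>\<^bsub>R Quot J\<^esub> x = \<zero>\<^bsub>R Quot J\<^esub>})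
      \<longleftrightarrow> (\<exists>y\<in>carrier R. P = {a \<in> carrier R. a \<otimes> y \<in> J})" by simp
  then show ?thesis unfolding ass_quotient_def by (simp only: mem_Collect_eq)
qed

context finite_dimensional_vector_space
begin

interpretation R: cring S by (rule cring_sym_algebra)

lemma lin_ideal_join_insert:
  assumes "subspace (V i)"
  shows "lin_ideal (V i) <+>\<^bsub>S\<^esub> lin_ideal (join V A) = lin_ideal (join V (insert i A))"
proof
  have add: "a + b \<in> lin_ideal (V i) <+>\<^bsub>S\<^esub> lin_ideal (join V A)"
    if "a \<in> lin_ideal (V i)" "b \<in> lin_ideal (join V A)" for a b
    using that by (auto simp: set_add_def' sym_algebra_ops)
  have "V i \<subseteq> join V (insert i A)" "join V A \<subseteq> join V (insert i A)"
    using join_upper[of i "insert i A" V] join_mono[of A "insert i A" V] by auto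
  then have "lin_ideal (V i) \<subseteq> lin_ideal (join V (insert i A))"
    "lin_ideal (join V A) \<subseteq> lin_ideal (join V (insert i A))" by (intro lin_ideal_mono; simp)+
  then show "lin_ideal (V i) <+>\<^bsub>S\<^esub> lin_ideal (join V A) \<subseteq> lin_ideal (join V (insert i A))"
    using ideal_add[OF lin_ideal_ideal, of _ "join V (insert i A)"]
    by (auto simp: set_add_def' sym_algebra_ops subset_eq)
  show "lin_ideal (join V (insert i A)) \<subseteq> lin_ideal (V i) <+>\<^bsub>S\<^esub> lin_ideal (join V A)"
  proof (rule lin_ideal_least[OF R.add_ideals[OF lin_ideal_ideal lin_ideal_ideal]])
    fix w assume "w \<in> join V (insert i A)"
    then obtain x y where "x \<in> V i" "y \<in> join V A" "w = x + y"
      using join_Un[of V "{i}" A] join_singleton[of V i, OF assms] by auto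
    then show "lin w \<in> lin_ideal (V i) <+>\<^bsub>S\<^esub> lin_ideal (join V A)"
      using add lin_in_lin_ideal by (simp add: lin_add)
  qed
qed

lemma arr_ideal_eq: "arr_ideal scale Basis V i = lin_ideal (V i)"
  by (simp add: arr_ideal_def lin_ideal_def)

lemma arr_ideal_sum_eq:
  assumes "finite A" "\<And>i. i \<in> A \<Longrightarrow> subspace (V i)"
  shows "arr_ideal_sum scale Basis V A = lin_ideal (join V A)"
  using assms
proof (induction A rule: finite_induct)
  interpret I: semiring "ideals_set S" by (rule R.ideals_set_is_semiring)
  {
    case empty
    show ?case by (simp add: arr_ideal_sum_def ideals_set_simps join_def lin_ideal_zero)
  next
    case (insert i A)
    have "arr_ideal_sum scale Basis V (insert i A) = lin_ideal (V i) <+>\<^bsub>S\<^esub> arr_ideal_sum scale Basis V A"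
      using I.finsum_insert[OF insert.hyps, of "\<lambda>j. lin_ideal (V j)"] lin_ideal_ideal
      by (simp add: arr_ideal_sum_def ideals_set_simps arr_ideal_eq Pi_def)
    then show ?case using insert lin_ideal_join_insert by simp
  }
qed

lemma arr_ideal_prod_eq: "arr_ideal_prod scale Basis n V = lin_prod V {1..n}"
  by (simp add: arr_ideal_prod_def lin_prod_def arr_ideal_eq)

lemma dilworth_rk_eq_iff:
  assumes "finite B" "B \<noteq> {}"
  shows "dilworth_rk scale V B = arr_rk scale V B - 1 \<longleftrightarrow>
    (\<forall>P. partition_on B P \<longrightarrow> arr_rk scale V B - 1 \<le> (\<Sum>C\<in>P. arr_rk scale V C - 1))"
proof -
  let ?v = "\<lambda>P. (\<Sum>C\<in>P. arr_rk scale V C) - int (card P)"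
  let ?X = "{?v P | P. partition_on B P}"
  have v: "(\<Sum>C\<in>P. arr_rk scale V C - 1) = ?v P" for P by (simp add: sum_subtractf)
  have "?X = ?v ` {P. partition_on B P}" by auto
  then have fin: "finite ?X" using finitely_many_partition_on[OF assms(1)] by simp
  have "partition_on B {B}" using assms(2) by (auto simp: partition_on_def)
  then have mem: "arr_rk scale V B - 1 \<in> ?X" by (force intro: exI[of _ "{B}"])
  have "Min ?X = arr_rk scale V B - 1 \<longleftrightarrow> (\<forall>x\<in>?X. arr_rk scale V B - 1 \<le> x)"
  proof
    assume eq: "Min ?X = arr_rk scale V B - 1"
    show "\<forall>x\<in>?X. arr_rk scale V B - 1 \<le> x"
    proof
      fix x assume "x \<in> ?X"
      then have "Min ?X \<le> x" by (rule Min_le[OF fin])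
      then show "arr_rk scale V B - 1 \<le> x" unfolding eq .
    qed
  next
    assume "\<forall>x\<in>?X. arr_rk scale V B - 1 \<le> x"
    then show "Min ?X = arr_rk scale V B - 1" by (intro Min_eqI[OF fin _ mem]) (rule bspec)
  qed
  moreover have "dilworth_rk scale V B = Min ?X" using assms(2) by (simp add: dilworth_rk_def)
  ultimately show ?thesis unfolding v by auto
qed

lemma flat_subset: "B \<in> arr_flats scale n V \<Longrightarrow> B \<subseteq> {1..n}"
  by (simp add: arr_flats_def)

lemma flat_not_below:
  assumes "B \<in> arr_flats scale n V" "i \<in> {1..n}" "V i \<subseteq> join V B"
  shows "i \<in> B"
proof (rule ccontr)
  assume "i \<notin> B"
  then have "arr_rk scale V B < arr_rk scale V (insert i B)"
    using assms(1,2) unfolding arr_flats_def by blast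
  moreover have "join V (insert i B) \<subseteq> join V B"
    using assms(3) join_upper[of _ B V] by (intro join_least subspace_join) auto
  ultimately show False using dim_subset[of "join V (insert i B)" "join V B"] by (simp add: arr_rk_join)
qed

text \<open>
  Enlarging \<open>A\<close> to the flat with the same join keeps the ideal and raises the exponent, so only
  flats matter in the intersection.
\<close>

lemma flat_of_join:
  assumes "A \<subseteq> {1..n}"
  shows "\<exists>B\<in>arr_flats scale n V. A \<subseteq> B \<and> join V B = join V A"
proof -
  define B where "B = {i \<in> {1..n}. V i \<subseteq> join V A}"
  have AB: "A \<subseteq> B" using assms join_upper[of _ A V] by (auto simp: B_def)
  have "join V B \<subseteq> join V A" by (intro join_least subspace_join) (auto simp: B_def)
  then have J: "join V B = join V A" using join_mono[OF AB] by blast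
  have "arr_rk scale V B < arr_rk scale V C" if C: "B \<subset> C" "C \<subseteq> {1..n}" for C
  proof -
    obtain i where i: "i \<in> C" "i \<notin> B" using C by blast
    then have "\<not> V i \<subseteq> join V B" using C J by (auto simp: B_def)
    moreover have "V i \<subseteq> join V C" using join_upper[OF i(1)] .
    moreover have "join V B \<subseteq> join V C" using C join_mono by blast
    ultimately have "join V B \<subset> join V C" by blast
    then show ?thesis
      using dim_psubset[of "join V B" "join V C"] by (simp add: arr_rk_join span_eq_iff[THEN iffD2])
  qed
  then have "B \<in> arr_flats scale n V" by (auto simp: arr_flats_def B_def)
  then show ?thesis using AB J by blast
qed

lemma flats_eq_if_join_eq:
  assumes "B \<in> arr_flats scale n V" "C \<in> arr_flats scale n V" "join V B = join V C"
  shows "B = C"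
proof -
  note n = flat_subset[OF assms(1)] flat_subset[OF assms(2)]
  have "B \<subseteq> C"
  proof
    fix i assume i: "i \<in> B"
    show "i \<in> C"
      by (rule flat_not_below[OF assms(2) subsetD[OF n(1) i]]) (use join_upper[OF i, of V] assms(3) in simp)
  qed
  moreover have "C \<subseteq> B"
  proof
    fix i assume i: "i \<in> C"
    show "i \<in> B"
      by (rule flat_not_below[OF assms(1) subsetD[OF n(2) i]]) (use join_upper[OF i, of V] assms(3) in simp)
  qed
  ultimately show ?thesis by blast
qed

context
  fixes n :: nat and V :: "nat \<Rightarrow> 'b set"
  assumes inf: "infinite (UNIV :: 'a set)"
    and sub: "\<And>i. i \<in> {1..n} \<Longrightarrow> subspace (V i)" and nz: "\<And>i. i \<in> {1..n} \<Longrightarrow> V i \<noteq> {0}"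
begin

definition essential_flats :: "nat set set" where
  "essential_flats = {B \<in> arr_flats scale n V. dilworth_rk scale V B = arr_rk scale V B - 1}"

lemma essential_flat:
  assumes "B \<in> essential_flats"
  shows "B \<in> arr_flats scale n V" "B \<subseteq> {1..n}" "finite B" "B \<noteq> {}" "0 < card B"
proof -
  show B: "B \<in> arr_flats scale n V" using assms by (simp add: essential_flats_def)
  show "B \<subseteq> {1..n}" using flat_subset[OF B] .
  then show fin: "finite B" using finite_subset by blast
  show "B \<noteq> {}"
  proof
    assume "B = {}"
    then show False using assms by (simp add: essential_flats_def dilworth_rk_def arr_rk_def)
  qed
  then show "0 < card B" using fin by (simp add: card_gt_0_iff)
qed

lemma finite_essential_flats: "finite essential_flats"
  by (rule finite_subset[of _ "Pow {1..n}"]) (use essential_flat(2) in blast, simp)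

text \<open>
  Induction on the size of the flat. For a flat that is not essential, the conditions at the smaller flats put
  \<open>z\<^sup>#\<^sup>B p\<close> into the product over \<open>B\<close> for each \<open>z\<close> in the join: the subsets with a smaller join are covered by \<open>p\<close>,
  those with the same join by the power of \<open>z\<close>.
\<close>

lemma in_lin_pow_all_flats:
  assumes p: "p \<in> carrier S" and ess: "\<And>B. B \<in> essential_flats \<Longrightarrow> p \<in> lin_pow (join V B) (card B)"
    and B: "B \<in> arr_flats scale n V" "B \<noteq> {}"
  shows "p \<in> lin_pow (join V B) (card B)"
  using B
proof (induction "card B" arbitrary: B rule: less_induct)
  case less
  note B = less.prems
  have Bn: "B \<subseteq> {1..n}" using flat_subset[OF B(1)] .
  then have finB: "finite B" using finite_subset by blast
  show ?case
  proof (cases "B \<in> essential_flats")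
    case True
    then show ?thesis by (rule ess)
  next
    case False
    then have "dilworth_rk scale V B \<noteq> arr_rk scale V B - 1" using B by (simp add: essential_flats_def)
    then obtain P where P: "partition_on B P" "(\<Sum>C\<in>P. arr_rk scale V C - 1) < arr_rk scale V B - 1"
      using dilworth_rk_eq_iff[OF finB B(2)] by (meson not_le)
    have sat: "lin z ^ card B * p \<in> lin_prod V B" if z: "z \<in> join V B" for z
    proof (rule in_lin_prod_if_in_lin_pows[OF inf finB])
      show "subspace (V i)" if "i \<in> B" for i using sub Bn that by blast
      show "lin z ^ card B * p \<in> carrier S" using p by (intro carrier_intros)
      fix A assume A: "A \<subseteq> B" "A \<noteq> {}"
      show "lin z ^ card B * p \<in> lin_pow (join V A) (card A)"
      proof (cases "join V A = join V B")
        case True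
        have "lin z ^ card B \<in> lin_pow (join V A) (card B)"
          using power_in_lin_pow[OF lin_in_lin_ideal] z True by simp
        then have "lin z ^ card B \<in> lin_pow (join V A) (card A)"
          using lin_pow_antimono[OF card_mono[OF finB A(1)]] by blast
        then show ?thesis using p by (rule ideal_mult_right[OF lin_pow_ideal, rotated])
      next
        case False
        obtain C where C: "C \<in> arr_flats scale n V" "A \<subseteq> C" "join V C = join V A"
          using flat_of_join[of A n V] A(1) Bn by blast
        have "C \<subseteq> B"
        proof
          fix i assume i: "i \<in> C"
          have "V i \<subseteq> join V A" using join_upper[OF i, of V] unfolding C(3) .
          then have VB: "V i \<subseteq> join V B" using join_mono[OF A(1)] by (rule subset_trans)
          have "i \<in> {1..n}" using i flat_subset[OF C(1)] by blast
          then show "i \<in> B" by (rule flat_not_below[OF B(1) _ VB])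
        qed
        moreover have "C \<noteq> B" using C(3) False by blast
        ultimately have "C \<subset> B" by blast
        then have "card C < card B" "finite C" using finB psubset_card_mono finite_subset by auto
        then have "p \<in> lin_pow (join V A) (card C)" using less.hyps[of C] C A(2) by auto
        then have "p \<in> lin_pow (join V A) (card A)"
          using lin_pow_antimono[OF card_mono[OF \<open>finite C\<close> C(2)]] by blast
        then show ?thesis by (intro ideal_mult lin_pow_ideal carrier_power lin_carrier)
      qed
    qed
    show ?thesis
      by (rule in_lin_pow_if_saturated[OF inf finB B(2) _ _ P p])
        (use sub nz Bn sat in blast)+
  qed
qed

lemma lin_prod_eq_Inter_essential:
  "lin_prod V {1..n} = carrier S \<inter> (\<Inter>B\<in>essential_flats. lin_pow (join V B) (card B))"
proof (intro equalityI subsetI)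
  fix p assume "p \<in> lin_prod V {1..n}"
  then show "p \<in> carrier S \<inter> (\<Inter>B\<in>essential_flats. lin_pow (join V B) (card B))"
    using ideal_carrier[OF lin_prod_ideal] lin_prod_subset_join[of "{1..n}" _ V] essential_flat(2) by blast
next
  fix p assume p: "p \<in> carrier S \<inter> (\<Inter>B\<in>essential_flats. lin_pow (join V B) (card B))"
  show "p \<in> lin_prod V {1..n}"
  proof (rule in_lin_prod_if_in_lin_pows[OF inf])
    fix A assume A: "A \<subseteq> {1..n}" "A \<noteq> {}"
    obtain B where B: "B \<in> arr_flats scale n V" "A \<subseteq> B" "join V B = join V A"
      using flat_of_join[OF A(1)] by blast
    then have "p \<in> lin_pow (join V A) (card B)"
      using in_lin_pow_all_flats[of p B] p A(2) by auto
    moreover have "card A \<le> card B"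
      using B finite_subset[OF flat_subset[OF B(1)]] by (intro card_mono) auto
    ultimately show "p \<in> lin_pow (join V A) (card A)" using lin_pow_antimono by blast
  qed (use p sub in auto)
qed

text \<open>
  The minor \<open>f\<close> of \<open>socle_element_exists\<close> satisfies the conditions at all smaller flats, and multiplying it by
  elements of the ideal of \<open>B\<close> repairs the condition at \<open>B\<close>. A flat \<open>C\<close> not contained in \<open>B\<close> has a space
  with a vector outside the join of \<open>B\<close>; a high power of this vector satisfies the condition at \<open>C\<close>
  and is harmless at \<open>B\<close>, where its order is zero.
\<close>

lemma essential_witness:
  assumes B: "B \<in> essential_flats"
  shows "\<exists>x\<in>carrier S. x \<notin> lin_pow (join V B) (card B) \<and>
    (\<forall>C\<in>essential_flats - {B}. x \<in> lin_pow (join V C) (card C)) \<and>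
    (\<forall>a\<in>lin_ideal (join V B). a * x \<in> lin_prod V {1..n})"
proof -
  note B' = essential_flat[OF B]
  have rk: "arr_rk scale V B - 1 \<le> (\<Sum>C\<in>P. arr_rk scale V C - 1)" if "partition_on B P" for P
    using that B dilworth_rk_eq_iff[OF B'(3,4)] by (auto simp: essential_flats_def)
  have subB: "subspace (V i)" and nzB: "V i \<noteq> {0}" if "i \<in> B" for i using that sub nz B'(2) by blast+
  obtain \<phi> where \<phi>: "functional \<phi>" "\<forall>i\<in>B. \<exists>u\<in>V i. \<phi> u \<noteq> 0"
    "join V B \<inter> {v. \<phi> v = 0} \<subseteq> join (\<lambda>i. V i \<inter> {v. \<phi> v = 0}) B"
    using spanning_hyperplane_section_exists[of B V, OF inf B'(3,4) subB nzB rk] by blast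
  obtain f where f: "f \<in> carrier S" "\<And>k. k \<in> B \<Longrightarrow> f \<in> lin_prod V (B - {k})"
    "f \<notin> lin_pow (join V B) (card B)"
    using socle_element_exists[of B V, OF B'(3,4) subB \<phi>] by blast
  have "\<exists>w. w \<in> V i \<and> w \<notin> join V B" if "i \<in> {1..n} - B" for i
    using that flat_not_below[OF B'(1)] by blast
  then obtain w where w: "\<And>i. i \<in> {1..n} - B \<Longrightarrow> w i \<in> V i" "\<And>i. i \<in> {1..n} - B \<Longrightarrow> w i \<notin> join V B"
    by metis
  define s where "s = (\<Prod>i\<in>{1..n} - B. lin (w i) ^ n)"
  have s: "s \<in> carrier S" unfolding s_def by (intro carrier_intros)
  have "(\<Prod>i\<in>A. lin (w i) ^ n) \<notin> lin_ideal (join V B)" if "A \<subseteq> {1..n} - B" for A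
    using finite_subset[OF that] that
  proof (induction A rule: infinite_finite_induct)
    case empty
    then show ?case using one_notin_lin_ideal by simp
  next
    case (insert i A)
    have "lin (w i) \<notin> lin_ideal (join V B)"
      using w(2)[of i] insert.prems lin_in_lin_ideal_iff[OF subspace_join] by blast
    then have "lin (w i) ^ n \<notin> lin_ideal (join V B)"
      using power_in_lin_ideal[OF inf subspace_join lin_carrier] by blast
    then show ?case
      using insert lin_ideal_prime[OF inf subspace_join, of "lin (w i) ^ n" "\<Prod>i\<in>A. lin (w i) ^ n"]
      by (auto simp: carrier_intros)
  qed auto
  then have s_notin: "s \<notin> lin_ideal (join V B)" unfolding s_def by blast
  let ?x = "s * f"
  have xB: "?x \<notin> lin_pow (join V B) (card B)"
    using lin_pow_cancel[OF inf subspace_join s f(1) _ s_notin] f(3) by blast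
  have other: "?x \<in> lin_pow (join V C) (card C)" if C: "C \<in> essential_flats" "C \<noteq> B" for C
  proof (cases "C \<subseteq> B")
    case True
    then obtain k where k: "k \<in> B" "k \<notin> C" using C(2) by blast
    then have "lin_prod V (B - {k}) \<subseteq> lin_pow (join V C) (card C)"
      using True B'(3) by (intro lin_prod_subset_join) auto
    then have "f \<in> lin_pow (join V C) (card C)" using f(2)[OF k(1)] by blast
    then show ?thesis using s by (intro ideal_mult lin_pow_ideal)
  next
    case False
    then obtain i where i: "i \<in> C" "i \<in> {1..n} - B" using essential_flat(2)[OF C(1)] by blast
    have "w i \<in> join V C" using w(1)[OF i(2)] join_upper[OF i(1), of V] by blast
    then have "lin (w i) ^ n \<in> lin_pow (join V C) n"
      by (intro power_in_lin_pow lin_in_lin_ideal)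
    moreover have "card C \<le> n"
      using card_mono[OF _ essential_flat(2)[OF C(1)]] by simp
    ultimately have "lin (w i) ^ n \<in> lin_pow (join V C) (card C)" using lin_pow_antimono by blast
    moreover have "?x = lin (w i) ^ n * ((\<Prod>j\<in>{1..n} - B - {i}. lin (w j) ^ n) * f)"
      unfolding s_def using i(2) by (subst prod.remove[of _ i]) (auto simp: mult.assoc)
    ultimately show ?thesis
      using f(1) by (auto intro!: ideal_mult_right lin_pow_ideal carrier_intros)
  qed
  have ann: "a * ?x \<in> lin_prod V {1..n}" if a: "a \<in> lin_ideal (join V B)" for a
  proof -
    have aS: "a \<in> carrier S" using a ideal_carrier[OF lin_ideal_ideal] by blast
    obtain k where k: "k \<in> B" using B'(4) by blast
    have "f \<in> lin_pow (join V B) (card (B - {k}))"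
      using f(2)[OF k] lin_prod_subset_lin_pow[of "B - {k}" V "join V B"] join_upper[of _ B V] B'(3) by blast
    then have "a * f \<in> lin_pow (join V B) (1 + card (B - {k}))"
      using a lin_pow_1[of "join V B"] by (intro lin_pow_mult) simp_all
    moreover have "1 + card (B - {k}) = card B" using card.remove[OF B'(3) k] by simp
    ultimately have "a * f \<in> lin_pow (join V B) (card B)" by simp
    then have "s * (a * f) \<in> lin_pow (join V B) (card B)"
      by (rule ideal_mult[OF lin_pow_ideal s])
    then have "a * ?x \<in> lin_pow (join V B) (card B)" by (simp add: mult_ac)
    moreover have "a * ?x \<in> lin_pow (join V C) (card C)" if "C \<in> essential_flats" "C \<noteq> B" for C
      using ideal_mult[OF lin_pow_ideal aS other[OF that]] .
    ultimately show ?thesis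
      unfolding lin_prod_eq_Inter_essential using aS s f(1) by (auto intro!: carrier_intros)
  qed
  show ?thesis using s f(1) xB other ann by (intro bexI[of _ ?x]) (auto intro: carrier_mult)
qed

lemma irredundant_decomposition:
  "irredundant_primary_decomposition S (lin_prod V {1..n}) essential_flats
     (\<lambda>B. lin_pow (join V B) (card B))"
  unfolding irredundant_primary_decomposition_def
proof (intro conjI ballI)
  show "primary_ideal S (lin_pow (join V B) (card B))" if "B \<in> essential_flats" for B
    using primary_lin_pow[OF inf subspace_join essential_flat(5)[OF that]] .
  show "inj_on (\<lambda>B. radical_ideal S (lin_pow (join V B) (card B))) essential_flats"
  proof (rule inj_onI)
    fix B C assume BC: "B \<in> essential_flats" "C \<in> essential_flats"
      "radical_ideal S (lin_pow (join V B) (card B)) = radical_ideal S (lin_pow (join V C) (card C))"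
    then have "lin_ideal (join V B) = lin_ideal (join V C)"
      using radical_lin_pow[OF inf subspace_join essential_flat(5)] by simp
    then have "join V B = join V C" using lin_in_lin_ideal_iff[OF subspace_join] by blast
    then show "B = C" using flats_eq_if_join_eq essential_flat(1) BC by blast
  qed
  show "lin_prod V {1..n} \<noteq> carrier S \<inter> (\<Inter>C\<in>essential_flats - {B}. lin_pow (join V C) (card C))"
    if "B \<in> essential_flats" for B
    using essential_witness[OF that] lin_prod_eq_Inter_essential that by blast
qed (fact finite_essential_flats lin_prod_eq_Inter_essential)+

text \<open>
  An associated prime \<open>P\<close>, the annihilator of \<open>y\<close>, contains the intersection of the colon ideals of the
  components by \<open>y\<close>; being prime, it contains one of them with \<open>y\<close> outside the component, and then
  \<open>P\<close> is the radical of that component. Conversely, the witness above has the required annihilator.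
\<close>

lemma ass_lin_prod:
  "ass_quotient S (lin_prod V {1..n}) = (\<lambda>B. lin_ideal (join V B)) ` essential_flats"
proof (intro equalityI subsetI)
  fix P assume "P \<in> (\<lambda>B. lin_ideal (join V B)) ` essential_flats"
  then obtain B where B: "B \<in> essential_flats" "P = lin_ideal (join V B)" by blast
  obtain x where x: "x \<in> carrier S" "x \<notin> lin_pow (join V B) (card B)"
    "\<forall>a\<in>lin_ideal (join V B). a * x \<in> lin_prod V {1..n}"
    using essential_witness[OF B(1)] by blast
  have "a \<in> lin_ideal (join V B)" if "a \<in> carrier S" "a * x \<in> lin_prod V {1..n}" for a
    using lin_pow_cancel[OF inf subspace_join that(1) x(1)] that(2) x(2) B(1)
    unfolding lin_prod_eq_Inter_essential by blast
  then have "P = {a \<in> carrier S. a \<otimes>\<^bsub>S\<^esub> x \<in> lin_prod V {1..n}}"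
    using x(3) ideal_carrier[OF lin_ideal_ideal] by (auto simp: B(2) sym_algebra_ops)
  moreover have "primeideal P S"
    unfolding B(2) by (rule lin_ideal_primeideal[OF inf subspace_join])
  ultimately show "P \<in> ass_quotient S (lin_prod V {1..n})"
    unfolding R.ass_quotient_iff[OF lin_prod_ideal] using x(1) by (intro conjI bexI[of _ x])
next
  fix P assume "P \<in> ass_quotient S (lin_prod V {1..n})"
  then obtain y where P: "primeideal P S" and y: "y \<in> carrier S"
    and ann: "P = {a \<in> carrier S. a * y \<in> lin_prod V {1..n}}"
    unfolding R.ass_quotient_iff[OF lin_prod_ideal] sym_algebra_ops by blast
  interpret P: primeideal P S by fact
  have P1: "1 \<notin> P" using P.one_imp_carrier P.I_notcarr by (auto simp: sym_algebra_ops)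
  have Pprime: "a \<in> P \<or> b \<in> P" if "a \<in> carrier S" "b \<in> carrier S" "a * b \<in> P" for a b
    using P.I_prime[OF that(1,2)] that(3) by (simp add: sym_algebra_ops)
  let ?Q = "\<lambda>B. lin_pow (join V B) (card B)"
  have "\<exists>B\<in>essential_flats. y \<notin> ?Q B \<and> (\<forall>a\<in>carrier S. a * y \<in> ?Q B \<longrightarrow> a \<in> P)"
  proof (rule ccontr)
    assume neg: "\<not> ?thesis"
    have "\<exists>a. a \<in> carrier S \<and> a * y \<in> ?Q B \<and> a \<notin> P" if B: "B \<in> essential_flats" for B
    proof (cases "y \<in> ?Q B")
      case True
      then show ?thesis using P1 carrier_1 by (intro exI[of _ 1]) simp
    next
      case False
      then show ?thesis using neg B by blast
    qed
    then obtain a where a: "\<And>B. B \<in> essential_flats \<Longrightarrow> a B \<in> carrier S"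
      "\<And>B. B \<in> essential_flats \<Longrightarrow> a B * y \<in> ?Q B" "\<And>B. B \<in> essential_flats \<Longrightarrow> a B \<notin> P" by metis
    have "(\<Prod>B\<in>T. a B) \<notin> P" if "T \<subseteq> essential_flats" for T
      using that
    proof (induction T rule: infinite_finite_induct)
      case (insert B T)
      have car: "(\<Prod>B\<in>T. a B) \<in> carrier S" using a(1) insert.prems by (intro carrier_prod) blast
      have B: "B \<in> essential_flats" and ih: "(\<Prod>B\<in>T. a B) \<notin> P" using insert by blast+
      have "a B * (\<Prod>B\<in>T. a B) \<notin> P" using Pprime[OF a(1)[OF B] car] a(3)[OF B] ih by blast
      then show ?case unfolding prod.insert[OF insert.hyps] .
    qed (use P1 in auto)
    then have notin: "(\<Prod>B\<in>essential_flats. a B) \<notin> P" by blast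
    have car: "(\<Prod>B\<in>essential_flats. a B) \<in> carrier S" using a(1) by (rule carrier_prod)
    have "(\<Prod>B\<in>essential_flats. a B) * y \<in> ?Q B" if B: "B \<in> essential_flats" for B
    proof -
      have "(\<Prod>B\<in>essential_flats. a B) * y = (\<Prod>B\<in>essential_flats - {B}. a B) * (a B * y)"
        using B finite_essential_flats by (subst prod.remove[of _ B]) (auto simp: mult_ac)
      moreover have "(\<Prod>B\<in>essential_flats - {B}. a B) \<in> carrier S"
        using a(1) by (intro carrier_prod) blast
      ultimately show ?thesis using ideal_mult[OF lin_pow_ideal _ a(2)[OF B]] by simp
    qed
    then have "(\<Prod>B\<in>essential_flats. a B) * y \<in> lin_prod V {1..n}"
      unfolding lin_prod_eq_Inter_essential using carrier_mult[OF car y] by blast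
    then show False using notin car unfolding ann by blast
  qed
  then obtain B where B: "B \<in> essential_flats" "y \<notin> ?Q B" "\<And>a. a \<in> carrier S \<Longrightarrow> a * y \<in> ?Q B \<Longrightarrow> a \<in> P"
    by blast
  have "P \<subseteq> lin_ideal (join V B)"
  proof
    fix a assume "a \<in> P"
    then have "a \<in> carrier S" "a * y \<in> ?Q B"
      using B(1) unfolding ann lin_prod_eq_Inter_essential by blast+
    then show "a \<in> lin_ideal (join V B)"
      using lin_pow_cancel[OF inf subspace_join _ y] B(2) by blast
  qed
  moreover have "lin_ideal (join V B) \<subseteq> P"
  proof
    fix a assume a: "a \<in> lin_ideal (join V B)"
    then have aS: "a \<in> carrier S" using ideal_carrier[OF lin_ideal_ideal] by blast
    have "a ^ card B * y \<in> ?Q B"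
      using power_in_lin_pow[OF a] y by (intro ideal_mult_right lin_pow_ideal)
    then have "a ^ card B \<in> P" using B(3) carrier_power[OF aS] by blast
    moreover have "a \<in> P" if "a ^ k \<in> P" for k
      using that by (induction k) (use P1 Pprime[OF aS carrier_power[OF aS]] in auto)
    ultimately show "a \<in> P" by blast
  qed
  ultimately show "P \<in> (\<lambda>B. lin_ideal (join V B)) ` essential_flats" using B(1) by blast
qed

end

end

theorem theorem3p2:
  fixes scale :: "'k::field \<Rightarrow> 'v::ab_group_add \<Rightarrow> 'v"
    and Basis :: "'v set"
    and n :: nat
    and V :: "nat \<Rightarrow> 'v set"
  assumes "infinite (UNIV :: 'k set)"
    and "finite_dimensional_vector_space scale Basis"
    and "subspace_arrangement scale n V"
  shows "irredundant_primary_decomposition (sym_algebra Basis)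
           (arr_ideal_prod scale Basis n V)
           {B \<in> arr_flats scale n V. dilworth_rk scale V B = arr_rk scale V B - 1}
           (\<lambda>B. arr_ideal_sum scale Basis V B [^]\<^bsub>ideals_set (sym_algebra Basis)\<^esub> card B)
         \<and> ass_quotient (sym_algebra Basis) (arr_ideal_prod scale Basis n V) =
           {arr_ideal_sum scale Basis V B | B.
              B \<in> arr_flats scale n V \<and> dilworth_rk scale V B = arr_rk scale V B - 1}"
proof -
  interpret finite_dimensional_vector_space scale Basis by fact
  have sub: "\<And>i. i \<in> {1..n} \<Longrightarrow> subspace (V i)" and nz: "\<And>i. i \<in> {1..n} \<Longrightarrow> V i \<noteq> {0}"
    using assms(3) by (auto simp: subspace_arrangement_def)
  let ?T = "{B \<in> arr_flats scale n V. dilworth_rk scale V B = arr_rk scale V B - 1}"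
  have T: "essential_flats n V = ?T"
    by (rule essential_flats_def[where n = n and V = V, OF assms(1) sub nz])
  have sum: "arr_ideal_sum scale Basis V B = lin_ideal (join V B)" if "B \<in> ?T" for B
  proof (rule arr_ideal_sum_eq)
    have "B \<subseteq> {1..n}" using that flat_subset by blast
    then show "finite B" "\<And>i. i \<in> B \<Longrightarrow> subspace (V i)" using finite_subset sub by blast+
  qed
  have comp: "arr_ideal_sum scale Basis V B [^]\<^bsub>ideals_set (sym_algebra Basis)\<^esub> card B
      = lin_pow (join V B) (card B)" if "B \<in> ?T" for B
    by (simp only: sum[OF that] lin_pow_def)
  have "irredundant_primary_decomposition (sym_algebra Basis) (lin_prod V {1..n}) ?T
      (\<lambda>B. arr_ideal_sum scale Basis V B [^]\<^bsub>ideals_set (sym_algebra Basis)\<^esub> card B)"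
    using irredundant_decomposition[where n = n and V = V, OF assms(1) sub nz]
    unfolding T by (simp only: irredundant_primary_decomposition_cong[of ?T _ _, OF comp])
  moreover have "ass_quotient (sym_algebra Basis) (lin_prod V {1..n}) =
      (\<lambda>B. lin_ideal (join V B)) ` essential_flats n V"
    by (rule ass_lin_prod[where n = n and V = V, OF assms(1) sub nz])
  then have "ass_quotient (sym_algebra Basis) (lin_prod V {1..n}) =
      (\<lambda>B. arr_ideal_sum scale Basis V B) ` ?T"
    using sum unfolding T by (simp cong: image_cong_simp)
  ultimately show ?thesis
    unfolding arr_ideal_prod_eq by (simp only: Setcompr_eq_image[symmetric] mem_Collect_eq conj_assoc)
qed

end
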